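(* Let $A=(a_{ij})_{i,j\in I}$ be a generalized Cartan matrix, $\mathfrak g=\mathfrak g_A$ the corresponding Kac-Moody Lie algebra over $\mathbb C$, $\mathbf a=(a_i)_{i\in I}\in\mathbb C^I$, and let $\mathfrak g^{(\mathbf a)}$ be the Lie subalgebra of $\mathfrak g$ generated by $u_i:=e_i+a_i[e_i,f_i]-a_i^2f_i$, $i\in I$. Then the relations $$(\mathrm{ad}\,u_i)^{1-a_{ij}}(u_j)=-2\,\delta_{a_{ij},-1}\,a_{ji}\,a_i\,a_j\,u_i\qquad(i,j\in I,\ i\neq j)$$ give a presentation of the Lie algebra $\mathfrak g^{(\mathbf a)}$ on the generators $u_i$, $i\in I$. Moreover, $\mathfrak g^{(\mathbf a)}$ is a flat deformation of the nilpotent part $\mathfrak n=\langle e_i, i\in I\rangle$ of $\mathfrak g$, in the sense that for any $\mathbf a\in\mathbb C^I$ one has $\mathfrak g^{(\mathbf a)}\cong\mathfrak n$ as naturally filtered vector spaces.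
   Context: A generalized Cartan matrix $A=(a_{ij})_{i,j\in I}$ has $a_{ii}=2$, $a_{ij}\in\mathbb Z_{\le 0}$ for $i\ne j$, and $a_{ij}=0$ iff $a_{ji}=0$; it need not be symmetrizable. $\mathfrak g_A$ is the Lie algebra generated by $e_i,f_i$ ($i\in I$), with $h_i:=[e_i,f_i]$, subject to $[h_i,h_j]=0$, $[e_i,f_j]=\delta_{ij}h_i$, $[h_i,e_j]=a_{ij}e_j$, $[h_i,f_j]=-a_{ij}f_j$, and the Serre relations $(\mathrm{ad}\,e_i)^{1-a_{ij}}(e_j)=(\mathrm{ad}\,f_i)^{1-a_{ij}}(f_j)=0$ for $i\ne j$. $\mathfrak n$ is the subalgebra generated by all $e_i$. Entries with two indices $a_{ij}$ are Cartan matrix entries; those with one index $a_i$ are parameters. The natural filtration on a Lie algebra with a given generating set (here $\{u_i\}$ for $\mathfrak g^{(\mathbf a)}$ and $\{e_i\}$ for $\mathfrak n$) has $k$-th term the span of all iterated brackets of at most $k$ generators. *)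

theory Defs
  imports Complex_Main "HOL-Algebra.Module" "HOL-Algebra.Algebraic_Closure_Type"
begin

section \<open>Complex Lie algebras\<close>

abbreviation complex_field :: "complex ring" where
  "complex_field \<equiv> ring_of_type_algebra"

text \<open>
  The underlying vector space is a module over the complex field; the record fields
  \<^const>\<open>monoid.mult\<close> and \<^const>\<open>monoid.one\<close> inherited through \<^typ>\<open>('a, 'b) module\<close> carry no meaning.
\<close>

record 'a lie_alg = "(complex, 'a) module" +
  bracket :: "'a \<Rightarrow> 'a \<Rightarrow> 'a"

locale lie_algebra = module complex_field L for L :: "'a lie_alg" (structure) +
  assumes bracket_closed [simp, intro]:
      "\<lbrakk>x \<in> carrier L; y \<in> carrier L\<rbrakk> \<Longrightarrow> bracket L x y \<in> carrier L"
    and bracket_add_left: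
      "\<lbrakk>x \<in> carrier L; y \<in> carrier L; z \<in> carrier L\<rbrakk> \<Longrightarrow>
        bracket L (x \<oplus> y) z = bracket L x z \<oplus> bracket L y z"
    and bracket_add_right:
      "\<lbrakk>x \<in> carrier L; y \<in> carrier L; z \<in> carrier L\<rbrakk> \<Longrightarrow>
        bracket L x (y \<oplus> z) = bracket L x y \<oplus> bracket L x z"
    and bracket_smult_left:
      "\<lbrakk>x \<in> carrier L; y \<in> carrier L\<rbrakk> \<Longrightarrow> bracket L (c \<odot> x) y = c \<odot> bracket L x y"
    and bracket_smult_right:
      "\<lbrakk>x \<in> carrier L; y \<in> carrier L\<rbrakk> \<Longrightarrow> bracket L x (c \<odot> y) = c \<odot> bracket L x y"
    and bracket_self: "x \<in> carrier L \<Longrightarrow> bracket L x x = \<zero>"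
    and jacobi:
      "\<lbrakk>x \<in> carrier L; y \<in> carrier L; z \<in> carrier L\<rbrakk> \<Longrightarrow>
        bracket L x (bracket L y z) \<oplus> bracket L y (bracket L z x) \<oplus> bracket L z (bracket L x y) = \<zero>"

definition lie_span :: "'a lie_alg \<Rightarrow> 'a set \<Rightarrow> 'a set" where
  "lie_span L S = (\<lambda>H. submodule H complex_field L) hull S"

definition lie_subalgebra :: "'a set \<Rightarrow> 'a lie_alg \<Rightarrow> bool" where
  "lie_subalgebra H L \<longleftrightarrow>
    submodule H complex_field L \<and> (\<forall>x\<in>H. \<forall>y\<in>H. bracket L x y \<in> H)"

definition subalgebra_generated :: "'a lie_alg \<Rightarrow> 'a set \<Rightarrow> 'a lie_alg" where
  "subalgebra_generated L S = L\<lparr>carrier := (\<lambda>H. lie_subalgebra H L) hull S\<rparr>"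

definition linear_hom :: "'a lie_alg \<Rightarrow> 'b lie_alg \<Rightarrow> ('a \<Rightarrow> 'b) set" where
  "linear_hom L M = {\<phi>. \<phi> \<in> carrier L \<rightarrow> carrier M \<and>
    (\<forall>x\<in>carrier L. \<forall>y\<in>carrier L. \<phi> (x \<oplus>\<^bsub>L\<^esub> y) = \<phi> x \<oplus>\<^bsub>M\<^esub> \<phi> y) \<and>
    (\<forall>c. \<forall>x\<in>carrier L. \<phi> (c \<odot>\<^bsub>L\<^esub> x) = c \<odot>\<^bsub>M\<^esub> \<phi> x)}"

definition lie_hom :: "'a lie_alg \<Rightarrow> 'b lie_alg \<Rightarrow> ('a \<Rightarrow> 'b) set" where
  "lie_hom L M = {\<phi> \<in> linear_hom L M.
    \<forall>x\<in>carrier L. \<forall>y\<in>carrier L. \<phi> (bracket L x y) = bracket M (\<phi> x) (\<phi> y)}"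

definition lie_iso :: "'a lie_alg \<Rightarrow> 'b lie_alg \<Rightarrow> ('a \<Rightarrow> 'b) set" where
  "lie_iso L M = {\<phi> \<in> lie_hom L M. bij_betw \<phi> (carrier L) (carrier M)}"


section \<open>Lie algebras given by generators and relations\<close>

datatype 'x lie_term =
    Gen 'x
  | Zero
  | Add "'x lie_term" "'x lie_term"
  | Scale complex "'x lie_term"
  | Brk "'x lie_term" "'x lie_term"

text \<open>
  The least congruence on formal Lie expressions containing the identities of a complex Lie algebra
  and the given relations, a pair \<open>(s, t)\<close> standing for the relation \<open>s = t\<close>.
\<close>

inductive_set lie_cong :: "('x lie_term \<times> 'x lie_term) set \<Rightarrow> ('x lie_term \<times> 'x lie_term) set"
  for R :: "('x lie_term \<times> 'x lie_term) set" where
  relation: "(s, t) \<in> R \<Longrightarrow> (s, t) \<in> lie_cong R"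
| refl: "(t, t) \<in> lie_cong R"
| sym: "(s, t) \<in> lie_cong R \<Longrightarrow> (t, s) \<in> lie_cong R"
| trans: "(s, t) \<in> lie_cong R \<Longrightarrow> (t, w) \<in> lie_cong R \<Longrightarrow> (s, w) \<in> lie_cong R"
| cong_Add: "(s, s') \<in> lie_cong R \<Longrightarrow> (t, t') \<in> lie_cong R \<Longrightarrow> (Add s t, Add s' t') \<in> lie_cong R"
| cong_Scale: "(t, t') \<in> lie_cong R \<Longrightarrow> (Scale c t, Scale c t') \<in> lie_cong R"
| cong_Brk: "(s, s') \<in> lie_cong R \<Longrightarrow> (t, t') \<in> lie_cong R \<Longrightarrow> (Brk s t, Brk s' t') \<in> lie_cong R"
| add_assoc: "(Add (Add s t) w, Add s (Add t w)) \<in> lie_cong R"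
| add_commute: "(Add s t, Add t s) \<in> lie_cong R"
| add_zero: "(Add Zero t, t) \<in> lie_cong R"
| add_inverse: "(Add (Scale (-1) t) t, Zero) \<in> lie_cong R"
| scale_left: "(Scale (c + d) t, Add (Scale c t) (Scale d t)) \<in> lie_cong R"
| scale_right: "(Scale c (Add s t), Add (Scale c s) (Scale c t)) \<in> lie_cong R"
| scale_assoc: "(Scale (c * d) t, Scale c (Scale d t)) \<in> lie_cong R"
| scale_one: "(Scale 1 t, t) \<in> lie_cong R"
| brk_add_left: "(Brk (Add s t) w, Add (Brk s w) (Brk t w)) \<in> lie_cong R"
| brk_add_right: "(Brk s (Add t w), Add (Brk s t) (Brk s w)) \<in> lie_cong R"
| brk_scale_left: "(Brk (Scale c s) t, Scale c (Brk s t)) \<in> lie_cong R"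
| brk_scale_right: "(Brk s (Scale c t), Scale c (Brk s t)) \<in> lie_cong R"
| brk_self: "(Brk t t, Zero) \<in> lie_cong R"
| brk_jacobi: "(Add (Add (Brk s (Brk t w)) (Brk t (Brk w s))) (Brk w (Brk s t)), Zero) \<in> lie_cong R"

definition lie_class :: "('x lie_term \<times> 'x lie_term) set \<Rightarrow> 'x lie_term \<Rightarrow> 'x lie_term set" where
  "lie_class R t = lie_cong R `` {t}"

definition presented_lie :: "('x lie_term \<times> 'x lie_term) set \<Rightarrow> 'x lie_term set lie_alg" where
  "presented_lie R = \<lparr>
     carrier = UNIV // lie_cong R,
     monoid.mult = undefined,
     monoid.one = undefined,
     ring.zero = lie_class R Zero,
     ring.add = (\<lambda>C D. \<Union>s\<in>C. \<Union>t\<in>D. lie_class R (Add s t)),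
     module.smult = (\<lambda>c C. \<Union>t\<in>C. lie_class R (Scale c t)),
     bracket = (\<lambda>C D. \<Union>s\<in>C. \<Union>t\<in>D. lie_class R (Brk s t))\<rparr>"

definition presented_by ::
    "'a lie_alg \<Rightarrow> ('x \<Rightarrow> 'a) \<Rightarrow> ('x lie_term \<times> 'x lie_term) set \<Rightarrow> bool" where
  "presented_by L u R \<longleftrightarrow>
    (\<exists>\<phi> \<in> lie_iso (presented_lie R) L. \<forall>x. \<phi> (lie_class R (Gen x)) = u x)"

subsection \<open>The presented Lie algebra is a Lie algebra with the universal property\<close>

lemma equiv_lie_cong: "equiv UNIV (lie_cong R)"
  by (intro equivI refl_onI symI transI) (auto intro: lie_cong.refl lie_cong.sym lie_cong.trans)

lemma lie_class_eq_iff: "lie_class R s = lie_class R t \<longleftrightarrow> (s, t) \<in> lie_cong R"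
  unfolding lie_class_def using eq_equiv_class_iff[OF equiv_lie_cong] by blast

lemma carrier_presented_lie: "carrier (presented_lie R) = range (lie_class R)"
  by (auto simp: presented_lie_def quotient_def lie_class_def)

lemma mem_lie_class: "s \<in> lie_class R t \<longleftrightarrow> (t, s) \<in> lie_cong R"
  by (simp add: lie_class_def)

lemma zero_presented_lie: "\<zero>\<^bsub>presented_lie R\<^esub> = lie_class R Zero"
  by (simp add: presented_lie_def)

lemma add_presented_lie:
  "lie_class R s \<oplus>\<^bsub>presented_lie R\<^esub> lie_class R t = lie_class R (Add s t)"
proof -
  have "congruent2 (lie_cong R) (lie_cong R) (\<lambda>s t. lie_class R (Add s t))"
    by (rule congruent2I') (simp add: lie_class_eq_iff lie_cong.cong_Add)
  from UN_equiv_class2[OF equiv_lie_cong equiv_lie_cong this UNIV_I UNIV_I] show ?thesis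
    by (simp add: presented_lie_def lie_class_def)
qed

lemma bracket_presented_lie:
  "bracket (presented_lie R) (lie_class R s) (lie_class R t) = lie_class R (Brk s t)"
proof -
  have "congruent2 (lie_cong R) (lie_cong R) (\<lambda>s t. lie_class R (Brk s t))"
    by (rule congruent2I') (simp add: lie_class_eq_iff lie_cong.cong_Brk)
  from UN_equiv_class2[OF equiv_lie_cong equiv_lie_cong this UNIV_I UNIV_I] show ?thesis
    by (simp add: presented_lie_def lie_class_def)
qed

lemma smult_presented_lie:
  "c \<odot>\<^bsub>presented_lie R\<^esub> lie_class R t = lie_class R (Scale c t)"
proof -
  have "congruent (lie_cong R) (\<lambda>t. lie_class R (Scale c t))"
    by (rule congruentI) (simp add: lie_class_eq_iff lie_cong.cong_Scale)
  from UN_equiv_class[OF equiv_lie_cong this UNIV_I] show ?thesis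
    by (simp add: presented_lie_def lie_class_def)
qed

lemma lie_class_in_carrier: "lie_class R t \<in> carrier (presented_lie R)"
  by (simp add: carrier_presented_lie)

lemma presented_lie_cases:
  assumes "x \<in> carrier (presented_lie R)"
  obtains t where "x = lie_class R t"
  using assms unfolding carrier_presented_lie by blast

lemmas presented_lie_simps =
  lie_class_in_carrier zero_presented_lie add_presented_lie bracket_presented_lie smult_presented_lie

lemma lie_algebra_presented_lie: "lie_algebra (presented_lie R)"
proof -
  have ag: "abelian_group (presented_lie R)"
  proof (rule abelian_groupI)
    fix x y z
    assume "x \<in> carrier (presented_lie R)" "y \<in> carrier (presented_lie R)"
      "z \<in> carrier (presented_lie R)"
    then show "x \<oplus>\<^bsub>presented_lie R\<^esub> y \<oplus>\<^bsub>presented_lie R\<^esub> z =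
        x \<oplus>\<^bsub>presented_lie R\<^esub> (y \<oplus>\<^bsub>presented_lie R\<^esub> z)"
      by (clarsimp elim!: presented_lie_cases simp: presented_lie_simps lie_class_eq_iff lie_cong.add_assoc)
  next
    fix x assume "x \<in> carrier (presented_lie R)"
    then obtain t where "x = lie_class R t"
      by (rule presented_lie_cases)
    then have "lie_class R (Scale (-1) t) \<oplus>\<^bsub>presented_lie R\<^esub> x = \<zero>\<^bsub>presented_lie R\<^esub>"
      by (simp add: presented_lie_simps lie_class_eq_iff lie_cong.add_inverse)
    moreover have "lie_class R (Scale (-1) t) \<in> carrier (presented_lie R)"
      by (simp add: presented_lie_simps)
    ultimately show "\<exists>y\<in>carrier (presented_lie R). y \<oplus>\<^bsub>presented_lie R\<^esub> x = \<zero>\<^bsub>presented_lie R\<^esub>"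
      by (rule bexI)
  qed (clarsimp elim!: presented_lie_cases simp: presented_lie_simps lie_class_eq_iff lie_cong.add_commute lie_cong.add_zero)+
  have "module complex_field (presented_lie R)"
  proof (rule moduleI)
    show "cring complex_field"
      by (rule cring_from_type_algebra)
  qed (rule ag, (clarsimp elim!: presented_lie_cases simp: presented_lie_simps lie_class_eq_iff ring_of_type_algebra_def
      lie_cong.scale_left lie_cong.scale_right lie_cong.scale_assoc lie_cong.scale_one)+)
  then show ?thesis
    by (intro lie_algebra.intro lie_algebra_axioms.intro, assumption)
      (clarsimp elim!: presented_lie_cases simp: presented_lie_simps lie_class_eq_iff
        lie_cong.brk_add_left lie_cong.brk_add_right lie_cong.brk_scale_left
        lie_cong.brk_scale_right lie_cong.brk_self lie_cong.brk_jacobi)+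
qed

primrec lie_eval :: "'a lie_alg \<Rightarrow> ('x \<Rightarrow> 'a) \<Rightarrow> 'x lie_term \<Rightarrow> 'a" where
  "lie_eval L u (Gen x) = u x"
| "lie_eval L u Zero = \<zero>\<^bsub>L\<^esub>"
| "lie_eval L u (Add s t) = lie_eval L u s \<oplus>\<^bsub>L\<^esub> lie_eval L u t"
| "lie_eval L u (Scale c t) = c \<odot>\<^bsub>L\<^esub> lie_eval L u t"
| "lie_eval L u (Brk s t) = bracket L (lie_eval L u s) (lie_eval L u t)"

context lie_algebra
begin

lemma smult_closed' [simp, intro]: "x \<in> carrier L \<Longrightarrow> c \<odot> x \<in> carrier L"
  using smult_closed[of c x] by (simp add: ring_of_type_algebra_def)

lemma lie_eval_closed:
  assumes "range u \<subseteq> carrier L"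
  shows "lie_eval L u t \<in> carrier L"
  using assms by (induction t) auto

lemma lie_eval_cong:
  assumes u: "range u \<subseteq> carrier L"
    and R: "\<And>s t. (s, t) \<in> R \<Longrightarrow> lie_eval L u s = lie_eval L u t"
    and st: "(s, t) \<in> lie_cong R"
  shows "lie_eval L u s = lie_eval L u t"
proof -
  note closed = lie_eval_closed[OF u]
  have dl: "(c + d) \<odot> x = c \<odot> x \<oplus> d \<odot> x" if "x \<in> carrier L" for c d :: complex and x
    using smult_l_distr[of c d x] that by (simp add: ring_of_type_algebra_def)
  have dr: "c \<odot> (x \<oplus> y) = c \<odot> x \<oplus> c \<odot> y" if "x \<in> carrier L" "y \<in> carrier L" for c x y
    using smult_r_distr[of c x y] that by (simp add: ring_of_type_algebra_def)
  have as: "(c * d) \<odot> x = c \<odot> (d \<odot> x)" if "x \<in> carrier L" for c d :: complex and x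
    using smult_assoc1[of c d x] that by (simp add: ring_of_type_algebra_def)
  have one: "1 \<odot> x = x" if "x \<in> carrier L" for x
    using smult_one[of x] that by (simp add: ring_of_type_algebra_def)
  have z: "0 \<odot> x = \<zero>" if "x \<in> carrier L" for x
    using smult_l_null[of x] that by (simp add: ring_of_type_algebra_def)
  have inv: "(-1) \<odot> x \<oplus> x = \<zero>" if "x \<in> carrier L" for x
    using dl[of x "-1" 1] z[of x] one[of x] that by simp
  show ?thesis
    using st
  proof induction
    case (relation s t)
    then show ?case
      by (rule R)
  next
    case (add_commute s t)
    show ?case
      by (simp add: closed M.add.m_comm)
  next
    case (brk_jacobi s t w)
    show ?case
      using jacobi[of "lie_eval L u s" "lie_eval L u t" "lie_eval L u w"] by (simp add: closed)
  qed (simp_all add: closed dl dr as one inv bracket_add_left bracket_add_right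
        bracket_smult_left bracket_smult_right bracket_self M.add.m_assoc inv)
qed

lemma presented_lie_universal:
  assumes u: "range u \<subseteq> carrier L"
    and R: "\<And>s t. (s, t) \<in> R \<Longrightarrow> lie_eval L u s = lie_eval L u t"
  shows "\<exists>\<phi> \<in> lie_hom (presented_lie R) L. \<forall>x. \<phi> (lie_class R (Gen x)) = u x"
proof -
  define \<phi> where "\<phi> = (\<lambda>C. lie_eval L u (SOME t. t \<in> C))"
  have \<phi>: "\<phi> (lie_class R t) = lie_eval L u t" for t
  proof -
    have "t \<in> lie_class R t"
      by (simp add: mem_lie_class lie_cong.refl)
    then have "(SOME t'. t' \<in> lie_class R t) \<in> lie_class R t"
      by (rule someI)
    then have "(t, SOME t'. t' \<in> lie_class R t) \<in> lie_cong R"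
      by (simp only: mem_lie_class)
    from lie_eval_cong[OF u R this] show ?thesis
      by (simp only: \<phi>_def)
  qed
  have "\<phi> \<in> lie_hom (presented_lie R) L"
    unfolding lie_hom_def linear_hom_def
    by (auto elim!: presented_lie_cases simp: presented_lie_simps \<phi> lie_eval_closed[OF u])
  then show ?thesis
    by (rule bexI[rotated]) (simp add: \<phi>)
qed

end


section \<open>The Kac-Moody algebra of a generalized Cartan matrix\<close>

definition generalized_cartan_matrix :: "('i \<Rightarrow> 'i \<Rightarrow> int) \<Rightarrow> bool" where
  "generalized_cartan_matrix A \<longleftrightarrow>
    (\<forall>i. A i i = 2) \<and>
    (\<forall>i j. i \<noteq> j \<longrightarrow> A i j \<le> 0) \<and>
    (\<forall>i j. A i j = 0 \<longleftrightarrow> A j i = 0)"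

datatype 'i chevalley = E 'i | F 'i

abbreviation te :: "'i \<Rightarrow> 'i chevalley lie_term" where "te i \<equiv> Gen (E i)"
abbreviation tf :: "'i \<Rightarrow> 'i chevalley lie_term" where "tf i \<equiv> Gen (F i)"
abbreviation th :: "'i \<Rightarrow> 'i chevalley lie_term" where "th i \<equiv> Brk (te i) (tf i)"

text \<open>
  The exponent \<^term>\<open>nat (1 - A i j)\<close> is not truncated, since \<^term>\<open>A i j \<le> 0\<close> for \<^term>\<open>i \<noteq> j\<close>.
  The case \<open>i = j\<close> of \<open>[e\<^sub>i, f\<^sub>j] = \<delta>\<^sub>i\<^sub>j h\<^sub>i\<close> is the definition of \<open>h\<^sub>i\<close>, so only \<open>i \<noteq> j\<close> is imposed.
\<close>

definition kac_moody_relations ::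
    "('i \<Rightarrow> 'i \<Rightarrow> int) \<Rightarrow> ('i chevalley lie_term \<times> 'i chevalley lie_term) set" where
  "kac_moody_relations A =
     {(Brk (th i) (th j), Zero) | i j. True} \<union>
     {(Brk (te i) (tf j), Zero) | i j. i \<noteq> j} \<union>
     {(Brk (th i) (te j), Scale (of_int (A i j)) (te j)) | i j. True} \<union>
     {(Brk (th i) (tf j), Scale (- of_int (A i j)) (tf j)) | i j. True} \<union>
     {((Brk (te i) ^^ nat (1 - A i j)) (te j), Zero) | i j. i \<noteq> j} \<union>
     {((Brk (tf i) ^^ nat (1 - A i j)) (tf j), Zero) | i j. i \<noteq> j}"

definition kac_moody :: "('i \<Rightarrow> 'i \<Rightarrow> int) \<Rightarrow> 'i chevalley lie_term set lie_alg" where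
  "kac_moody A = presented_lie (kac_moody_relations A)"

definition km_e :: "('i \<Rightarrow> 'i \<Rightarrow> int) \<Rightarrow> 'i \<Rightarrow> 'i chevalley lie_term set" where
  "km_e A i = lie_class (kac_moody_relations A) (te i)"

definition km_f :: "('i \<Rightarrow> 'i \<Rightarrow> int) \<Rightarrow> 'i \<Rightarrow> 'i chevalley lie_term set" where
  "km_f A i = lie_class (kac_moody_relations A) (tf i)"

definition km_n :: "('i \<Rightarrow> 'i \<Rightarrow> int) \<Rightarrow> 'i chevalley lie_term set lie_alg" where
  "km_n A = subalgebra_generated (kac_moody A) (range (km_e A))"


section \<open>The deformed subalgebra\<close>

definition km_u :: "('i \<Rightarrow> 'i \<Rightarrow> int) \<Rightarrow> ('i \<Rightarrow> complex) \<Rightarrow> 'i \<Rightarrow> 'i chevalley lie_term set" where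
  "km_u A a i =
    km_e A i
      \<oplus>\<^bsub>kac_moody A\<^esub> a i \<odot>\<^bsub>kac_moody A\<^esub> bracket (kac_moody A) (km_e A i) (km_f A i)
      \<ominus>\<^bsub>kac_moody A\<^esub> (a i)\<^sup>2 \<odot>\<^bsub>kac_moody A\<^esub> km_f A i"

definition km_deformed ::
    "('i \<Rightarrow> 'i \<Rightarrow> int) \<Rightarrow> ('i \<Rightarrow> complex) \<Rightarrow> 'i chevalley lie_term set lie_alg" where
  "km_deformed A a = subalgebra_generated (kac_moody A) (range (km_u A a))"

definition deformed_serre_relations ::
    "('i \<Rightarrow> 'i \<Rightarrow> int) \<Rightarrow> ('i \<Rightarrow> complex) \<Rightarrow> ('i lie_term \<times> 'i lie_term) set" where
  "deformed_serre_relations A a =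
    {((Brk (Gen i) ^^ nat (1 - A i j)) (Gen j),
      Scale (- 2 * (if A i j = - 1 then 1 else 0) * of_int (A j i) * a i * a j) (Gen i))
     | i j. i \<noteq> j}"


section \<open>Natural filtrations\<close>

text \<open>\<open>(n, x)\<close> belongs to this set iff \<open>x\<close> is an iterated bracket, in any bracketing, of \<open>n\<close> elements of \<open>S\<close>.\<close>

inductive_set iterated_brackets :: "'a lie_alg \<Rightarrow> 'a set \<Rightarrow> (nat \<times> 'a) set"
  for L :: "'a lie_alg" and S :: "'a set" where
  generator: "x \<in> S \<Longrightarrow> (1, x) \<in> iterated_brackets L S"
| bracket: "(m, x) \<in> iterated_brackets L S \<Longrightarrow> (n, y) \<in> iterated_brackets L S \<Longrightarrow>
    (m + n, bracket L x y) \<in> iterated_brackets L S"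

definition natural_filtration :: "'a lie_alg \<Rightarrow> 'a set \<Rightarrow> nat \<Rightarrow> 'a set" where
  "natural_filtration L S k = lie_span L {x. \<exists>n\<le>k. (n, x) \<in> iterated_brackets L S}"

definition filtered_iso ::
    "'a lie_alg \<Rightarrow> (nat \<Rightarrow> 'a set) \<Rightarrow> 'b lie_alg \<Rightarrow> (nat \<Rightarrow> 'b set) \<Rightarrow> ('a \<Rightarrow> 'b) set" where
  "filtered_iso L P M Q = {\<phi> \<in> linear_hom L M.
    bij_betw \<phi> (carrier L) (carrier M) \<and> (\<forall>k. \<phi> ` P k = Q k)}"

end

theory Submission
  imports Defs
begin

text \<open>
  Write \<open>P a\<close> for the Lie algebra presented by the deformed Serre relations; \<open>P 0\<close> is presented by
  the Serre relations. The \<open>u\<^sub>i\<close> satisfy the deformed relations because \<open>u\<^sub>i\<close> is the image of \<open>e\<^sub>i\<close>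
  under \<open>exp (-a\<^sub>i ad f\<^sub>i)\<close>, hence nilpotent on the strings through \<open>e\<^sub>j\<close> and \<open>f\<^sub>j\<close>, and its action on
  \<open>h\<^sub>j\<close> is explicit. So \<open>P a\<close> maps onto the deformed subalgebra.

  Let the Kac-Moody algebra act on the quotient of its lowest weight Verma module of weight 0, with
  basis the words in \<open>I\<close>, by the two-sided ideal of the Serre elements, and let \<open>v\<close> be the lowest
  weight vector. If \<open>p\<close> is a Lie polynomial of degree at most \<open>k\<close>, the leading part of \<open>p(u) v\<close> is
  \<open>p\<^sub>k v\<close>. On words, right-normed bracketing into \<open>P 0\<close> annihilates the Serre ideal and sends the
  homogeneous Lie polynomial \<open>p\<^sub>k\<close> to \<open>k p\<^sub>k\<close>. Hence \<open>p(u) v = 0\<close> forces \<open>p\<^sub>k = 0\<close> in \<open>P 0\<close>. Since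
  deforming the Serre relations only adds terms of lower degree, \<open>p\<close> then has degree at most \<open>k - 1\<close>
  in \<open>P a\<close>, and by descent \<open>p = 0\<close> in \<open>P a\<close>. This gives the presentation, and shows that the deformed
  subalgebra, as well as \<open>n\<close> (the case \<open>a = 0\<close>), meets the annihilator of \<open>v\<close> trivially. That
  annihilator contains the negative Borel subalgebra, and the projection along it is the filtered
  isomorphism.
\<close>

section \<open>Linear algebra in a Lie algebra\<close>

text \<open>The obstacle is that nothing is known in advance about the size of these algebras. A
  presentation bounds the deformed subalgebra from above; a lower bound needs a module on which
  nonzero elements act visibly. Weight 0 is chosen because all \<open>f_i\<close> and
  \<open>h_i\<close> then kill v, so the annihilator of v both detects elements and contains the
  complement along which one projects. Functionals replace the module: dividing by the Serre ideal
  becomes passing to a subspace of functions on words, at the price that operators compose in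
  reverse order. Every linear functional on \<open>P 0\<close>, composed with right-normed
  bracketing, is such a function, and there are enough of them to separate the elements of
  \<open>P 0\<close>. The other difficulty is that a derivation of p_k = 0 in \<open>P 0\<close> may
  pass through inhomogeneous terms. Multiplying all generators by a number c makes degrees visible
  as powers of c, and the coefficient of c^k is the part that matters.\<close>

definition dual :: "'a lie_alg \<Rightarrow> ('a \<Rightarrow> complex) set" where
  "dual L = {\<psi>. (\<forall>x\<in>carrier L. \<forall>y\<in>carrier L. \<psi> (x \<oplus>\<^bsub>L\<^esub> y) = \<psi> x + \<psi> y) \<and>
    (\<forall>c. \<forall>x\<in>carrier L. \<psi> (c \<odot>\<^bsub>L\<^esub> x) = c * \<psi> x)}"

lemma dual_add [simp]:
  "\<psi> \<in> dual L \<Longrightarrow> x \<in> carrier L \<Longrightarrow> y \<in> carrier L \<Longrightarrow> \<psi> (x \<oplus>\<^bsub>L\<^esub> y) = \<psi> x + \<psi> y"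
  by (simp add: dual_def)

lemma dual_smult [simp]:
  "\<psi> \<in> dual L \<Longrightarrow> x \<in> carrier L \<Longrightarrow> \<psi> (c \<odot>\<^bsub>L\<^esub> x) = c * \<psi> x"
  by (simp add: dual_def)

context lie_algebra
begin

lemma smult_add_left: "x \<in> carrier L \<Longrightarrow> (c + d) \<odot> x = c \<odot> x \<oplus> d \<odot> x"
  using smult_l_distr[of c d x] by (simp add: ring_of_type_algebra_def)

lemma smult_add_right: "x \<in> carrier L \<Longrightarrow> y \<in> carrier L \<Longrightarrow> c \<odot> (x \<oplus> y) = c \<odot> x \<oplus> c \<odot> y"
  using smult_r_distr[of c x y] by (simp add: ring_of_type_algebra_def)

lemma smult_smult: "x \<in> carrier L \<Longrightarrow> c \<odot> (d \<odot> x) = (c * d) \<odot> x"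
  using smult_assoc1[of c d x] by (simp add: ring_of_type_algebra_def)

lemma one_smult [simp]: "x \<in> carrier L \<Longrightarrow> 1 \<odot> x = x"
  using smult_one[of x] by (simp add: ring_of_type_algebra_def)

lemma zero_smult [simp]: "x \<in> carrier L \<Longrightarrow> 0 \<odot> x = \<zero>"
  using smult_l_null[of x] by (simp add: ring_of_type_algebra_def)

lemma smult_zero [simp]: "c \<odot> \<zero> = \<zero>"
  using smult_r_null[of c] by (simp add: ring_of_type_algebra_def)

lemma uminus_eq_smult:
  assumes "x \<in> carrier L" shows "\<ominus> x = (-1) \<odot> x"
proof -
  have "(-1) \<odot> x \<oplus> x = \<zero>"
    using assms smult_add_left[of x "-1" 1] by simp
  then show ?thesis
    using assms by (metis M.minus_equality smult_closed')
qed

lemma minus_eq_smult: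
  "x \<in> carrier L \<Longrightarrow> y \<in> carrier L \<Longrightarrow> x \<ominus> y = x \<oplus> (-1) \<odot> y"
  by (simp add: M.minus_eq uminus_eq_smult)

lemma dual_zero [simp]: "\<psi> \<in> dual L \<Longrightarrow> \<psi> \<zero> = 0"
  using dual_smult[of \<psi> L \<zero> 0] by simp

lemma dual_minus [simp]:
  "\<psi> \<in> dual L \<Longrightarrow> x \<in> carrier L \<Longrightarrow> y \<in> carrier L \<Longrightarrow> \<psi> (x \<ominus> y) = \<psi> x - \<psi> y"
  by (simp add: minus_eq_smult)

lemma bracket_zero_left [simp]: "x \<in> carrier L \<Longrightarrow> bracket L \<zero> x = \<zero>"
  using bracket_smult_left[of \<zero> x 0] by simp

lemma bracket_zero_right [simp]: "x \<in> carrier L \<Longrightarrow> bracket L x \<zero> = \<zero>"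
  using bracket_smult_right[of x \<zero> 0] by simp

lemma submodule_iff:
  "submodule H complex_field L \<longleftrightarrow> H \<subseteq> carrier L \<and> \<zero> \<in> H \<and>
    (\<forall>x\<in>H. \<forall>y\<in>H. x \<oplus> y \<in> H) \<and> (\<forall>c. \<forall>x\<in>H. c \<odot> x \<in> H)"
proof
  assume H: "submodule H complex_field L"
  note E = submoduleE[OF H]
  have sm: "c \<odot> x \<in> H" if "x \<in> H" for c x
    using E(4)[of c x] that by (simp add: ring_of_type_algebra_def)
  obtain x where "x \<in> H"
    using E(2) by blast
  then have "\<zero> \<in> H"
    using sm[of x 0] E(1) by auto
  then show "H \<subseteq> carrier L \<and> \<zero> \<in> H \<and> (\<forall>x\<in>H. \<forall>y\<in>H. x \<oplus> y \<in> H) \<and> (\<forall>c. \<forall>x\<in>H. c \<odot> x \<in> H)"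
    using E(1,5) sm by blast
next
  assume H: "H \<subseteq> carrier L \<and> \<zero> \<in> H \<and> (\<forall>x\<in>H. \<forall>y\<in>H. x \<oplus> y \<in> H) \<and> (\<forall>c. \<forall>x\<in>H. c \<odot> x \<in> H)"
  show "submodule H complex_field L"
    by (rule submoduleI) (use H uminus_eq_smult in auto)
qed

lemma submodule_in_carrier: "submodule H complex_field L \<Longrightarrow> x \<in> H \<Longrightarrow> x \<in> carrier L"
  by (auto simp: submodule_iff)

lemma submodule_add: "submodule H complex_field L \<Longrightarrow> x \<in> H \<Longrightarrow> y \<in> H \<Longrightarrow> x \<oplus> y \<in> H"
  by (simp add: submodule_iff)

lemma submodule_smult: "submodule H complex_field L \<Longrightarrow> x \<in> H \<Longrightarrow> c \<odot> x \<in> H"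
  by (simp add: submodule_iff)

lemma submodule_zero_mem: "submodule H complex_field L \<Longrightarrow> \<zero> \<in> H"
  by (simp add: submodule_iff)

lemma submodule_minus:
  assumes "submodule H complex_field L" "x \<in> H" "y \<in> H"
  shows "x \<ominus> y \<in> H"
proof -
  have "x \<in> carrier L" "y \<in> carrier L"
    using assms by (auto simp: submodule_iff)
  then show ?thesis
    using assms by (simp add: minus_eq_smult submodule_iff)
qed

lemma submodule_zero: "submodule {\<zero>} complex_field L"
  unfolding submodule_iff by auto

lemma submodule_carrier: "submodule (carrier L) complex_field L"
  unfolding submodule_iff by auto

lemma submodule_Inter:
  assumes "\<And>H. H \<in> \<H> \<Longrightarrow> submodule H complex_field L" "\<H> \<noteq> {}"
  shows "submodule (\<Inter>\<H>) complex_field L"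
  unfolding submodule_iff
proof (intro conjI)
  show "\<Inter>\<H> \<subseteq> carrier L"
    using assms unfolding submodule_iff by blast
qed (use assms(1) in \<open>auto simp: submodule_iff\<close>)

lemma submodule_add_span:
  assumes M: "submodule M complex_field L" and y: "y \<in> carrier L"
  shows "submodule {m \<oplus> d \<odot> y | m d. m \<in> M} complex_field L"
proof -
  have MC: "m \<in> carrier L" if "m \<in> M" for m
    using submodule_in_carrier[OF M] that .
  show ?thesis
    unfolding submodule_iff
  proof (intro conjI ballI allI)
    show "{m \<oplus> d \<odot> y |m d. m \<in> M} \<subseteq> carrier L"
      using MC y by auto
    show "\<zero> \<in> {m \<oplus> d \<odot> y |m d. m \<in> M}"
      using M y unfolding submodule_iff by (auto intro!: exI[of _ "\<zero>"] exI[of _ "0::complex"])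
  next
    fix p q assume "p \<in> {m \<oplus> d \<odot> y |m d. m \<in> M}" "q \<in> {m \<oplus> d \<odot> y |m d. m \<in> M}"
    then obtain m d n e where "p = m \<oplus> d \<odot> y" "q = n \<oplus> e \<odot> y" "m \<in> M" "n \<in> M"
      by blast
    moreover from this have "p \<oplus> q = (m \<oplus> n) \<oplus> (d + e) \<odot> y"
      using y by (simp add: MC smult_add_left M.a_ac)
    ultimately show "p \<oplus> q \<in> {m \<oplus> d \<odot> y |m d. m \<in> M}"
      using M unfolding submodule_iff by blast
  next
    fix c p assume "p \<in> {m \<oplus> d \<odot> y |m d. m \<in> M}"
    then obtain m d where "p = m \<oplus> d \<odot> y" "m \<in> M"
      by blast
    moreover from this have "c \<odot> p = c \<odot> m \<oplus> (c * d) \<odot> y"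
      using y by (simp add: MC smult_add_right smult_smult)
    ultimately show "c \<odot> p \<in> {m \<oplus> d \<odot> y |m d. m \<in> M}"
      using M unfolding submodule_iff by blast
  qed
qed

text \<open>Zorn's lemma gives a subspace \<open>M\<close> maximal among those that contain
  \<open>H\<close> and avoid \<open>x\<close>. Maximality makes \<open>M\<close> a complement of the
  line through \<open>x\<close>, and \<open>\<psi>\<close> is the coordinate along
  \<open>x\<close>.\<close>

lemma separating_functional:
  assumes H: "submodule H complex_field L" and x: "x \<in> carrier L" "x \<notin> H"
  obtains \<psi> where "\<psi> \<in> dual L" "\<And>y. y \<in> H \<Longrightarrow> \<psi> y = 0" "\<psi> x = 1"
proof -
  define \<A> where "\<A> = {M. submodule M complex_field L \<and> H \<subseteq> M \<and> x \<notin> M}"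
  have "\<exists>M\<in>\<A>. \<forall>N\<in>\<A>. M \<subseteq> N \<longrightarrow> N = M"
  proof (rule subset_Zorn_nonempty)
    show "\<A> \<noteq> {}"
      using H x by (auto simp: \<A>_def)
  next
    fix \<C> assume ne: "\<C> \<noteq> {}" and ch: "subset.chain \<A> \<C>"
    have mem: "submodule M complex_field L" "H \<subseteq> M" "x \<notin> M" if "M \<in> \<C>" for M
      using ch that by (auto simp: subset_chain_def \<A>_def)
    have dir: "M \<subseteq> N \<or> N \<subseteq> M" if "M \<in> \<C>" "N \<in> \<C>" for M N
      using ch that by (auto simp: subset_chain_def)
    have "submodule (\<Union>\<C>) complex_field L"
      unfolding submodule_iff
    proof (intro conjI ballI allI)
      fix p q assume "p \<in> \<Union>\<C>" "q \<in> \<Union>\<C>"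
      then obtain M N where MN: "M \<in> \<C>" "N \<in> \<C>" "p \<in> M" "q \<in> N" by blast
      with dir consider "p \<in> N" | "q \<in> M" by blast
      then show "p \<oplus> q \<in> \<Union>\<C>"
        using MN mem(1) unfolding submodule_iff by cases blast+
    qed (use ne mem(1) in \<open>unfold submodule_iff, blast+\<close>)
    then show "\<Union>\<C> \<in> \<A>"
      using ne mem unfolding \<A>_def by blast
  qed
  then obtain M where "M \<in> \<A>" and mx: "\<forall>N\<in>\<A>. M \<subseteq> N \<longrightarrow> N = M" ..
  then have M: "submodule M complex_field L" "H \<subseteq> M" "x \<notin> M"
    by (simp_all add: \<A>_def)
  have max: "N = M" if "submodule N complex_field L" "x \<notin> N" "M \<subseteq> N" for N
  proof -
    have "N \<in> \<A>"
      using that M(2) by (auto simp: \<A>_def)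
    then show ?thesis
      using mx that(3) by simp
  qed
  have MC: "m \<in> carrier L" if "m \<in> M" for m
    using M(1) that by (auto simp: submodule_iff)
  have M0: "\<zero> \<in> M" and Madd: "\<And>p q. p \<in> M \<Longrightarrow> q \<in> M \<Longrightarrow> p \<oplus> q \<in> M"
    and Msm: "\<And>c p. p \<in> M \<Longrightarrow> c \<odot> p \<in> M"
    using M(1) by (simp_all add: submodule_iff)
  have ex: "\<exists>c. y \<oplus> c \<odot> x \<in> M" if y: "y \<in> carrier L" for y
  proof (cases "y \<in> M")
    case True
    then show ?thesis
      using x y by (intro exI[of _ 0]) simp
  next
    case False
    \<comment> \<open>Enlarging \<open>M\<close> by \<open>y\<close> must capture \<open>x\<close>.
      The equation \<open>x = m \<oplus> d \<odot> y\<close> can be solved for \<open>y\<close>,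
      since \<open>d = 0\<close> would put \<open>x\<close> into \<open>M\<close>.\<close>
    let ?X = "{m \<oplus> d \<odot> y | m d. m \<in> M}"
    have "y = \<zero> \<oplus> 1 \<odot> y"
      using y by simp
    then have "y \<in> ?X"
      using M0 by blast
    moreover have "m = m \<oplus> 0 \<odot> y" if "m \<in> M" for m
      using y MC[OF that] by simp
    then have "M \<subseteq> ?X"
      by blast
    ultimately have "x \<in> ?X"
      using max[OF submodule_add_span[OF M(1) y]] False by blast
    then obtain m d where md: "x = m \<oplus> d \<odot> y" "m \<in> M"
      by blast
    have "d \<noteq> 0"
      using md M(3) y MC by auto
    then have "y \<oplus> (-1/d) \<odot> x = y \<oplus> ((-1/d) \<odot> m \<oplus> (-1) \<odot> y)"
      using y MC[OF md(2)] by (simp add: md(1) smult_add_right smult_smult)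
    also have "\<dots> = (-1/d) \<odot> m \<oplus> (y \<oplus> (-1) \<odot> y)"
      using y MC[OF md(2)] by (simp add: M.a_ac)
    also have "y \<oplus> (-1) \<odot> y = \<zero>"
      using y by (simp add: uminus_eq_smult[symmetric] M.r_neg)
    finally have "y \<oplus> (-1/d) \<odot> x \<in> M"
      using Msm[OF md(2)] MC[OF md(2)] by simp
    then show ?thesis ..
  qed
  have uni: "c = d" if y: "y \<in> carrier L" and c: "y \<oplus> c \<odot> x \<in> M" and d: "y \<oplus> d \<odot> x \<in> M" for y c d
  proof (rule ccontr)
    assume "c \<noteq> d"
    have "(y \<oplus> c \<odot> x) \<oplus> (-1) \<odot> (y \<oplus> d \<odot> x) = (y \<oplus> (-1) \<odot> y) \<oplus> (c \<odot> x \<oplus> (- d) \<odot> x)"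
      using x y by (simp add: smult_add_right smult_smult M.a_ac)
    also have "y \<oplus> (-1) \<odot> y = \<zero>"
      using y by (simp add: uminus_eq_smult[symmetric] M.r_neg)
    also have "c \<odot> x \<oplus> (- d) \<odot> x = (c - d) \<odot> x"
      using smult_add_left[of x c "-d"] x by simp
    finally have "(c - d) \<odot> x \<in> M"
      using Madd[OF c Msm[OF d, of "-1"]] x by simp
    then have "(1 / (c - d)) \<odot> ((c - d) \<odot> x) \<in> M"
      by (rule Msm)
    then show False
      using \<open>c \<noteq> d\<close> x M(3) by (simp add: smult_smult)
  qed
  define \<psi> where "\<psi> y = - (THE c. y \<oplus> c \<odot> x \<in> M)" for y
  have \<psi>: "\<psi> y = - c" if "y \<in> carrier L" "y \<oplus> c \<odot> x \<in> M" for y c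
    unfolding \<psi>_def using uni that by (metis (mono_tags, lifting) the_equality)
  have "\<psi> \<in> dual L"
    unfolding dual_def
  proof (intro CollectI conjI ballI allI)
    fix y z assume yz: "y \<in> carrier L" "z \<in> carrier L"
    then obtain c d where cd: "y \<oplus> c \<odot> x \<in> M" "z \<oplus> d \<odot> x \<in> M"
      using ex by blast
    have "(y \<oplus> c \<odot> x) \<oplus> (z \<oplus> d \<odot> x) = (y \<oplus> z) \<oplus> (c + d) \<odot> x"
      using x yz by (simp add: smult_add_left M.a_ac)
    then show "\<psi> (y \<oplus> z) = \<psi> y + \<psi> z"
      using \<psi>[of "y \<oplus> z" "c + d"] \<psi>[of y c] \<psi>[of z d] Madd[OF cd] yz cd by simp
  next
    fix k y assume y: "y \<in> carrier L"
    then obtain c where c: "y \<oplus> c \<odot> x \<in> M"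
      using ex by blast
    have "k \<odot> (y \<oplus> c \<odot> x) = k \<odot> y \<oplus> (k * c) \<odot> x"
      using x y by (simp add: smult_add_right smult_smult)
    then show "\<psi> (k \<odot> y) = k * \<psi> y"
      using \<psi>[of "k \<odot> y" "k * c"] \<psi>[of y c] Msm[OF c, of k] y c by simp
  qed
  moreover have "\<psi> y = 0" if "y \<in> H" for y
    using \<psi>[of y 0] that M(2) MC x by auto
  moreover have "\<psi> x = 1"
    using \<psi>[of x "-1"] x M0 by (simp add: uminus_eq_smult[symmetric] M.r_neg)
  ultimately show thesis
    by (rule that)
qed

text \<open>The usual way of checking identities below: under \<open>\<psi>\<close> both sides
  become complex numbers, and \<open>algebra_simps\<close> settles what would otherwise be rewriting
  in a group with scalars.\<close>

lemma eq_by_dual: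
  assumes "x \<in> carrier L" "y \<in> carrier L" "\<And>\<psi>. \<psi> \<in> dual L \<Longrightarrow> \<psi> x = \<psi> y"
  shows "x = y"
proof (rule ccontr)
  assume "x \<noteq> y"
  have xy: "x \<ominus> y \<in> carrier L"
    using assms by simp
  have "x \<ominus> y \<noteq> \<zero>"
    using \<open>x \<noteq> y\<close> assms(1,2)
    by (metis M.add.inv_closed M.add.inv_equality M.add.inv_inv M.minus_eq)
  then have "x \<ominus> y \<notin> {\<zero>}"
    by simp
  then obtain \<psi> where "\<psi> \<in> dual L" "\<psi> (x \<ominus> y) = 1"
    using separating_functional[OF submodule_zero xy] by metis
  then show False
    using assms(1,2) assms(3)[of \<psi>] by simp
qed

lemma minus_zero_eq:
  assumes "x \<in> carrier L" "y \<in> carrier L" "x \<ominus> y = \<zero>" shows "x = y"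
proof (rule eq_by_dual)
  fix \<psi> assume "\<psi> \<in> dual L"
  then show "\<psi> x = \<psi> y"
    using dual_minus[of \<psi> x y] assms by simp
qed (use assms in auto)

lemma bracket_antisym:
  assumes "x \<in> carrier L" "y \<in> carrier L"
  shows "bracket L y x = (-1) \<odot> bracket L x y"
proof (rule eq_by_dual)
  fix \<psi> assume \<psi>: "\<psi> \<in> dual L"
  have "\<psi> (bracket L (x \<oplus> y) (x \<oplus> y)) = 0"
    using assms \<psi> bracket_self[of "x \<oplus> y"] by simp
  then have "\<psi> (bracket L y x) + \<psi> (bracket L x y) = 0"
    using assms \<psi> bracket_self[OF assms(1)] bracket_self[OF assms(2)]
    by (simp add: bracket_add_left bracket_add_right add.commute)
  then show "\<psi> (bracket L y x) = \<psi> ((-1) \<odot> bracket L x y)"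
    using assms \<psi> by (simp add: eq_neg_iff_add_eq_0)
qed (use assms in auto)

lemma jacobi_left:
  assumes "x \<in> carrier L" "y \<in> carrier L" "z \<in> carrier L"
  shows "bracket L x (bracket L y z) =
    bracket L (bracket L x y) z \<oplus> bracket L y (bracket L x z)"
proof (rule eq_by_dual)
  fix \<psi> assume \<psi>: "\<psi> \<in> dual L"
  have "\<psi> (bracket L x (bracket L y z) \<oplus> bracket L y (bracket L z x) \<oplus> bracket L z (bracket L x y)) = 0"
    using \<psi> assms by (simp add: jacobi)
  moreover have "bracket L y (bracket L z x) = (-1) \<odot> bracket L y (bracket L x z)"
    using assms bracket_antisym[of x z] by (simp add: bracket_smult_right)
  moreover have "bracket L z (bracket L x y) = (-1) \<odot> bracket L (bracket L x y) z"
    using assms bracket_antisym[of "bracket L x y" z] by simp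
  ultimately show "\<psi> (bracket L x (bracket L y z)) =
      \<psi> (bracket L (bracket L x y) z \<oplus> bracket L y (bracket L x z))"
    using assms \<psi> by (simp add: algebra_simps)
qed (use assms in auto)

lemma ad_pow_closed [simp, intro]:
  "x \<in> carrier L \<Longrightarrow> y \<in> carrier L \<Longrightarrow> (bracket L x ^^ n) y \<in> carrier L"
  by (induction n) auto

lemma lie_eval_ad_pow:
  "lie_eval L u ((Brk s ^^ n) t) = (bracket L (lie_eval L u s) ^^ n) (lie_eval L u t)"
  by (induction n) auto

section \<open>Subalgebras, linear spans and induction over a span\<close>

lemma lie_algebra_subalgebra:
  assumes "lie_subalgebra H L"
  shows "lie_algebra (L\<lparr>carrier := H\<rparr>)"
proof -
  have H: "submodule H complex_field L" "\<And>x y. x \<in> H \<Longrightarrow> y \<in> H \<Longrightarrow> bracket L x y \<in> H"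
    using assms unfolding lie_subalgebra_def by auto
  have HC: "x \<in> carrier L" if "x \<in> H" for x
    using submodule_in_carrier[OF H(1)] that .
  have "module complex_field (L\<lparr>carrier := H\<rparr>)"
    by (rule submodule.submodule_is_module[OF H(1)]) (rule module_axioms)
  moreover have "lie_algebra_axioms (L\<lparr>carrier := H\<rparr>)"
    apply (rule lie_algebra_axioms.intro)
          apply simp_all
     apply (rule H; assumption)
    apply (rule bracket_add_left bracket_add_right bracket_smult_left bracket_smult_right
        bracket_self jacobi; rule HC; assumption)+
    done
  ultimately show ?thesis
    by (rule lie_algebra.intro)
qed

lemma lie_subalgebra_carrier: "lie_subalgebra (carrier L) L"
  unfolding lie_subalgebra_def using submodule_carrier by simp

lemma lie_subalgebra_hull:
  assumes "S \<subseteq> carrier L"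
  shows "lie_subalgebra ((\<lambda>H. lie_subalgebra H L) hull S) L"
proof -
  have "submodule (\<Inter>{t. lie_subalgebra t L \<and> S \<subseteq> t}) complex_field L"
    by (rule submodule_Inter) (use assms lie_subalgebra_carrier in \<open>auto simp: lie_subalgebra_def\<close>)
  then show ?thesis
    unfolding hull_def lie_subalgebra_def by (auto simp: lie_subalgebra_def)
qed

lemma lie_algebra_subalgebra_generated:
  "S \<subseteq> carrier L \<Longrightarrow> lie_algebra (subalgebra_generated L S)"
  unfolding subalgebra_generated_def
  by (rule lie_algebra_subalgebra) (rule lie_subalgebra_hull)

lemma submodule_lie_span:
  assumes "S \<subseteq> carrier L"
  shows "submodule (lie_span L S) complex_field L"
  unfolding lie_span_def hull_def
  by (rule submodule_Inter) (use assms submodule_carrier in auto)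

lemma lie_span_superset: "S \<subseteq> lie_span L S"
  unfolding lie_span_def by (rule hull_subset)

lemma lie_span_induct [consumes 2, case_names base zero add smult]:
  assumes "x \<in> lie_span L S" "S \<subseteq> carrier L"
    and "\<And>x. x \<in> S \<Longrightarrow> P x" "P \<zero>"
    and "\<And>x y. x \<in> lie_span L S \<Longrightarrow> y \<in> lie_span L S \<Longrightarrow> P x \<Longrightarrow> P y \<Longrightarrow> P (x \<oplus> y)"
    and "\<And>c x. x \<in> lie_span L S \<Longrightarrow> P x \<Longrightarrow> P (c \<odot> x)"
  shows "P x"
proof -
  have "lie_span L S \<subseteq> {x \<in> lie_span L S. P x}"
    unfolding lie_span_def
  proof (rule hull_minimal, fold lie_span_def)
    show "submodule {x \<in> lie_span L S. P x} complex_field L"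
      using submodule_lie_span[OF assms(2)] assms(3-) unfolding submodule_iff by auto
  qed (use assms(3) lie_span_superset in auto)
  then show ?thesis
    using assms(1) by blast
qed

lemma lie_span_minimal: "S \<subseteq> H \<Longrightarrow> submodule H complex_field L \<Longrightarrow> lie_span L S \<subseteq> H"
  unfolding lie_span_def by (rule hull_minimal)

end

section \<open>Homogeneous terms and the natural filtration\<close>

inductive homog :: "nat \<Rightarrow> 'x lie_term \<Rightarrow> bool" where
  Gen: "homog 1 (Gen x)"
| Zero: "homog n Zero"
| Add: "homog n s \<Longrightarrow> homog n t \<Longrightarrow> homog n (Add s t)"
| Scale: "homog n t \<Longrightarrow> homog n (Scale c t)"
| Brk: "homog m s \<Longrightarrow> homog n t \<Longrightarrow> homog (m + n) (Brk s t)"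

lemma homog_ad_pow: "homog (Suc n) ((Brk (Gen x) ^^ n) (Gen y))"
proof (induction n)
  case 0
  show ?case using homog.Gen[of y] by simp
next
  case (Suc n)
  show ?case using homog.Brk[OF homog.Gen Suc, of x] by simp
qed

context lie_algebra
begin

lemma lie_eval_closed' [simp, intro]:
  "(\<And>i. u i \<in> carrier L) \<Longrightarrow> lie_eval L u t \<in> carrier L"
  by (rule lie_eval_closed) auto

lemma iterated_brackets_closed:
  "(n, x) \<in> iterated_brackets L S \<Longrightarrow> S \<subseteq> carrier L \<Longrightarrow> x \<in> carrier L"
  by (induction rule: iterated_brackets.induct) auto

lemma iterated_brackets_pos: "(n, x) \<in> iterated_brackets L S \<Longrightarrow> 0 < n"
  by (induction rule: iterated_brackets.induct) auto

lemma iterated_brackets_homog: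
  "(n, x) \<in> iterated_brackets L (range u) \<Longrightarrow> \<exists>p. homog n p \<and> lie_eval L u p = x"
proof (induction rule: iterated_brackets.induct)
  case (generator x)
  then obtain i where "x = u i" by blast
  then show ?case
    using homog.Gen[of i] by (intro exI[of _ "Gen i"]) simp
next
  case (bracket m x n y)
  from bracket.IH obtain p q
    where "homog m p" "lie_eval L u p = x" "homog n q" "lie_eval L u q = y"
    by blast
  then show ?case
    using homog.Brk[of m p n q] by (intro exI[of _ "Brk p q"]) simp
qed

context
  fixes S assumes S: "S \<subseteq> carrier L"
begin

lemma iterated_set_subset: "{x. \<exists>n\<le>k. (n, x) \<in> iterated_brackets L S} \<subseteq> carrier L"
  using iterated_brackets_closed S by blast

lemma submodule_natural_filtration: "submodule (natural_filtration L S k) complex_field L"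
  unfolding natural_filtration_def by (rule submodule_lie_span) (rule iterated_set_subset)

lemma natural_filtration_closed: "x \<in> natural_filtration L S k \<Longrightarrow> x \<in> carrier L"
  by (rule submodule_in_carrier[OF submodule_natural_filtration])

lemma natural_filtration_add:
  "x \<in> natural_filtration L S k \<Longrightarrow> y \<in> natural_filtration L S k \<Longrightarrow> x \<oplus> y \<in> natural_filtration L S k"
  by (rule submodule_add[OF submodule_natural_filtration])

lemma natural_filtration_smult:
  "x \<in> natural_filtration L S k \<Longrightarrow> c \<odot> x \<in> natural_filtration L S k"
  by (rule submodule_smult[OF submodule_natural_filtration])

lemma natural_filtration_zero: "\<zero> \<in> natural_filtration L S k"
  by (rule submodule_zero_mem[OF submodule_natural_filtration])

lemma natural_filtration_mono: "j \<le> k \<Longrightarrow> natural_filtration L S j \<subseteq> natural_filtration L S k"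
  unfolding natural_filtration_def lie_span_def by (rule hull_mono) (auto intro: order_trans)

lemma iterated_brackets_filtration:
  "(n, x) \<in> iterated_brackets L S \<Longrightarrow> n \<le> k \<Longrightarrow> x \<in> natural_filtration L S k"
  unfolding natural_filtration_def by (rule subsetD[OF lie_span_superset]) auto

lemma natural_filtration_induct [consumes 1, case_names base zero add smult]:
  assumes "x \<in> natural_filtration L S k"
    and "\<And>n x. (n, x) \<in> iterated_brackets L S \<Longrightarrow> n \<le> k \<Longrightarrow> P x" "P \<zero>"
    and "\<And>x y. x \<in> natural_filtration L S k \<Longrightarrow> y \<in> natural_filtration L S k \<Longrightarrow> P x \<Longrightarrow> P y \<Longrightarrow> P (x \<oplus> y)"
    and "\<And>c x. x \<in> natural_filtration L S k \<Longrightarrow> P x \<Longrightarrow> P (c \<odot> x)"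
  shows "P x"
  using assms(1)[unfolded natural_filtration_def] iterated_set_subset
proof (induction rule: lie_span_induct)
  case (base x)
  then show ?case
    using assms(2) by blast
next
  case zero
  show ?case by (rule assms(3))
next
  case (add x y)
  then show ?case
    using assms(4)[of x y] by (simp add: natural_filtration_def)
next
  case (smult c x)
  then show ?case
    using assms(5)[of x c] by (simp add: natural_filtration_def)
qed

text \<open>An iterated bracket has at least one entry, so only the empty combination is left. This
  is where descent on the filtration ends.\<close>

lemma natural_filtration_0: "natural_filtration L S 0 = {\<zero>}"
proof -
  have "{x. \<exists>n\<le>0. (n, x) \<in> iterated_brackets L S} = {}"
    using iterated_brackets_pos by fastforce
  then have "natural_filtration L S 0 \<subseteq> {\<zero>}"
    unfolding natural_filtration_def by (intro lie_span_minimal submodule_zero) auto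
  then show ?thesis
    using natural_filtration_zero by blast
qed

lemma natural_filtration_bracket:
  assumes x: "x \<in> natural_filtration L S i" and y: "y \<in> natural_filtration L S j"
  shows "bracket L x y \<in> natural_filtration L S (i + j)"
  using x
proof (induction rule: natural_filtration_induct)
  case (base m x)
  have xC: "x \<in> carrier L"
    using base iterated_brackets_closed S by blast
  show ?case
    using y
  proof (induction rule: natural_filtration_induct)
    case (base n y)
    show ?case
      using iterated_brackets_filtration[OF iterated_brackets.bracket[OF \<open>(m, x) \<in> _\<close> base(1)]]
        \<open>m \<le> i\<close> base by simp
  qed (simp_all add: xC natural_filtration_zero natural_filtration_closed bracket_add_right
      bracket_smult_right natural_filtration_add natural_filtration_smult)
next
  case zero
  show ?case
    using natural_filtration_closed[OF y] natural_filtration_zero by simp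
next
  case (add x x')
  then show ?case
    using natural_filtration_closed[OF y] natural_filtration_closed[OF add.hyps(1)]
      natural_filtration_closed[OF add.hyps(2)] natural_filtration_add[OF add.IH]
    by (simp add: bracket_add_left)
next
  case (smult c x)
  then show ?case
    using natural_filtration_closed[OF y] natural_filtration_closed[OF smult.hyps]
      natural_filtration_smult[OF smult.IH, of c]
    by (simp add: bracket_smult_left)
qed

text \<open>Brackets add filtration degrees, so the union is a subalgebra. This makes induction on
  the filtration degree available for every element of a generated subalgebra.\<close>

lemma Union_natural_filtration:
  "(\<lambda>H. lie_subalgebra H L) hull S = (\<Union>k. natural_filtration L S k)" (is "?H = ?U")
proof
  show "?H \<subseteq> ?U"
  proof (rule hull_minimal)
    show "S \<subseteq> ?U"
    proof
      fix x assume "x \<in> S"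
      then have "x \<in> natural_filtration L S 1"
        using iterated_brackets_filtration[OF iterated_brackets.generator, of x 1] by simp
      then show "x \<in> ?U" by blast
    qed
    show "lie_subalgebra ?U L"
      unfolding lie_subalgebra_def submodule_iff
    proof (intro conjI ballI allI)
      fix x y assume "x \<in> ?U" "y \<in> ?U"
      then obtain i j where ij: "x \<in> natural_filtration L S i" "y \<in> natural_filtration L S j"
        by blast
      then have "x \<in> natural_filtration L S (max i j)" "y \<in> natural_filtration L S (max i j)"
        using natural_filtration_mono by (metis max.cobounded1 max.cobounded2 subsetD)+
      then show "x \<oplus> y \<in> ?U"
        using natural_filtration_add by auto
      show "bracket L x y \<in> ?U"
        using natural_filtration_bracket[OF ij] by auto
    next
      show "?U \<subseteq> carrier L"
        using natural_filtration_closed by auto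
      show "\<zero> \<in> ?U"
        using natural_filtration_zero by auto
      show "c \<odot> x \<in> ?U" if "x \<in> ?U" for c x
        using natural_filtration_smult that by auto
    qed
  qed
next
  have sub: "lie_subalgebra ?H L"
    by (rule lie_subalgebra_hull[OF S])
  have "x \<in> ?H" if "(n, x) \<in> iterated_brackets L S" for n x
    using that
  proof (induction rule: iterated_brackets.induct)
    case (generator x)
    then show ?case by (rule hull_inc)
  qed (use sub in \<open>auto simp: lie_subalgebra_def\<close>)
  then show "?U \<subseteq> ?H"
    using sub unfolding natural_filtration_def lie_subalgebra_def
    by (intro UN_least lie_span_minimal) auto
qed

text \<open>Reconciles the filtration formed inside the generated subalgebra, which the theorem
  speaks of, with the one formed in the ambient algebra, which the proof uses.\<close>

lemma natural_filtration_subalgebra_generated: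
  "natural_filtration (subalgebra_generated L S) S k = natural_filtration L S k"
proof -
  let ?H = "(\<lambda>H. lie_subalgebra H L) hull S"
  let ?L = "subalgebra_generated L S"
  interpret G: lie_algebra ?L
    by (rule lie_algebra_subalgebra_generated[OF S])
  have it: "iterated_brackets ?L S = iterated_brackets L S"
  proof -
    have "(n, x) \<in> iterated_brackets ?L S \<longleftrightarrow> (n, x) \<in> iterated_brackets L S" for n x
    proof
      show "(n, x) \<in> iterated_brackets ?L S \<Longrightarrow> (n, x) \<in> iterated_brackets L S"
      proof (induction rule: iterated_brackets.induct)
        case (bracket m x n y)
        then show ?case
          using iterated_brackets.bracket[OF bracket.IH] by (simp add: subalgebra_generated_def)
      qed (rule iterated_brackets.generator)
    next
      show "(n, x) \<in> iterated_brackets L S \<Longrightarrow> (n, x) \<in> iterated_brackets ?L S"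
      proof (induction rule: iterated_brackets.induct)
        case (bracket m x n y)
        then show ?case
          using iterated_brackets.bracket[OF bracket.IH] by (simp add: subalgebra_generated_def)
      qed (rule iterated_brackets.generator)
    qed
    then show ?thesis by auto
  qed
  have HS: "submodule ?H complex_field L"
    using lie_subalgebra_hull[OF S] by (simp add: lie_subalgebra_def)
  have sub: "submodule T complex_field ?L \<longleftrightarrow> submodule T complex_field L \<and> T \<subseteq> ?H" for T
  proof -
    have "?H \<subseteq> carrier L"
      using submodule_in_carrier[OF HS] by blast
    then show ?thesis
      by (subst G.submodule_iff, subst submodule_iff) (auto simp: subalgebra_generated_def)
  qed
  let ?X = "{x. \<exists>n\<le>k. (n, x) \<in> iterated_brackets L S}"
  have X: "?X \<subseteq> ?H"
    using Union_natural_filtration iterated_brackets_filtration by blast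
  have "lie_span ?L ?X = lie_span L ?X"
  proof
    have "lie_span L ?X \<subseteq> ?H"
      by (rule lie_span_minimal[OF X HS])
    then show "lie_span ?L ?X \<subseteq> lie_span L ?X"
      using submodule_lie_span[OF iterated_set_subset] lie_span_superset
      by (intro G.lie_span_minimal) (auto simp: sub)
    have "?X \<subseteq> carrier ?L"
      using X by (simp add: subalgebra_generated_def)
    then have "submodule (lie_span ?L ?X) complex_field ?L"
      by (rule G.submodule_lie_span)
    then show "lie_span L ?X \<subseteq> lie_span ?L ?X"
      using G.lie_span_superset by (intro lie_span_minimal) (auto simp: sub)
  qed
  then show ?thesis
    by (simp add: natural_filtration_def it)
qed

end

lemma homog_eval_0:
  assumes u: "\<And>i. u i \<in> carrier L" and "homog 0 p"
  shows "lie_eval L u p = \<zero>"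
proof -
  have "homog n p \<Longrightarrow> n = 0 \<Longrightarrow> lie_eval L u p = \<zero>" for n
    by (induction rule: homog.induct) (auto simp: u)
  then show ?thesis using assms by blast
qed

lemma homog_eval_filtration:
  assumes u: "\<And>i. u i \<in> carrier L" and p: "homog n p"
  shows "lie_eval L u p \<in> natural_filtration L (range u) n"
proof -
  have S: "range u \<subseteq> carrier L" using u by auto
  show ?thesis
    using p
  proof (induction rule: homog.induct)
    case (Gen x)
    show ?case
      using iterated_brackets_filtration[OF S iterated_brackets.generator, of "u x"] by simp
  qed (simp_all add: natural_filtration_zero[OF S] natural_filtration_add[OF S]
      natural_filtration_smult[OF S] natural_filtration_bracket[OF S])
qed

text \<open>Splits off a leading term as a formal expression. Neither \<open>p\<close> nor
  \<open>y\<close> is unique; the arguments below work with any choice.\<close>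

lemma natural_filtration_Suc_decomp:
  assumes u: "\<And>i. u i \<in> carrier L" and x: "x \<in> natural_filtration L (range u) (Suc k)"
  obtains p y where "homog (Suc k) p" "y \<in> natural_filtration L (range u) k"
    "x = lie_eval L u p \<oplus> y"
proof -
  have S: "range u \<subseteq> carrier L" using u by auto
  note cl = natural_filtration_closed[OF S]
  have "\<exists>p y. homog (Suc k) p \<and> y \<in> natural_filtration L (range u) k \<and> x = lie_eval L u p \<oplus> y"
    using x
  proof (induction rule: natural_filtration_induct[OF S, consumes 1, case_names base zero add smult])
    case (base n x)
    obtain p where p: "homog n p" "lie_eval L u p = x"
      using iterated_brackets_homog[OF base(1)] by blast
    show ?case
    proof (cases "n = Suc k")
      case True
      then show ?thesis
        using p u natural_filtration_zero[OF S] by (intro exI[of _ p] exI[of _ \<zero>]) auto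
    next
      case False
      then have "x \<in> natural_filtration L (range u) k"
        using base iterated_brackets_filtration[OF S] by simp
      then show ?thesis
        using homog.Zero cl by (intro exI[of _ Zero] exI[of _ x]) auto
    qed
  next
    case zero
    show ?case
      using homog.Zero natural_filtration_zero[OF S] by (intro exI[of _ Zero] exI[of _ \<zero>]) auto
  next
    case (add x y)
    from add.IH obtain p a q b where *: "homog (Suc k) p" "homog (Suc k) q"
      "a \<in> natural_filtration L (range u) k" "b \<in> natural_filtration L (range u) k"
      "x = lie_eval L u p \<oplus> a" "y = lie_eval L u q \<oplus> b"
      by blast
    show ?case
      using * u homog.Add[OF *(1,2)] natural_filtration_add[OF S *(3,4)]
      by (intro exI[of _ "Add p q"] exI[of _ "a \<oplus> b"]) (simp add: cl M.a_ac)
  next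
    case (smult c x)
    from smult.IH obtain p a where *: "homog (Suc k) p"
      "a \<in> natural_filtration L (range u) k" "x = lie_eval L u p \<oplus> a"
      by blast
    show ?case
      using * u homog.Scale[OF *(1)] natural_filtration_smult[OF S *(2)]
      by (intro exI[of _ "Scale c p"] exI[of _ "c \<odot> a"]) (simp add: cl smult_add_right)
  qed
  then show thesis
    using that by blast
qed

end

section \<open>Strings of weight vectors\<close>

context lie_algebra
begin

lemma smult_collect: "x \<in> carrier L \<Longrightarrow> c \<odot> x \<oplus> d \<odot> x = (c + d) \<odot> x"
  by (simp add: smult_add_left)

lemma ad_pow_zero: "x \<in> carrier L \<Longrightarrow> (bracket L x ^^ n) \<zero> = \<zero>"
  by (induction n) auto

lemma ad_pow_add:
  "x \<in> carrier L \<Longrightarrow> y \<in> carrier L \<Longrightarrow> z \<in> carrier L \<Longrightarrow>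
    (bracket L x ^^ n) (y \<oplus> z) = (bracket L x ^^ n) y \<oplus> (bracket L x ^^ n) z"
  by (induction n) (auto simp: bracket_add_right)

lemma ad_pow_smult:
  "x \<in> carrier L \<Longrightarrow> y \<in> carrier L \<Longrightarrow> (bracket L x ^^ n) (c \<odot> y) = c \<odot> (bracket L x ^^ n) y"
  by (induction n) (auto simp: bracket_smult_right)

lemma ad_smult_pow:
  "x \<in> carrier L \<Longrightarrow> y \<in> carrier L \<Longrightarrow> (bracket L (c \<odot> x) ^^ n) y = c ^ n \<odot> (bracket L x ^^ n) y"
  by (induction n) (auto simp: bracket_smult_right bracket_smult_left smult_smult mult.commute)

lemma ad_pow_commute:
  assumes "x \<in> carrier L" "y \<in> carrier L" "z \<in> carrier L" "bracket L x y = \<zero>"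
  shows "bracket L x ((bracket L y ^^ n) z) = (bracket L y ^^ n) (bracket L x z)"
proof (induction n)
  case (Suc n)
  then show ?case
    using assms jacobi_left[of x y "(bracket L y ^^ n) z"] by simp
qed simp

lemma bracket_lie_span:
  assumes "z \<in> carrier L" "S \<subseteq> carrier L" "submodule H complex_field L"
    and S: "\<And>x. x \<in> S \<Longrightarrow> bracket L z x \<in> H" and x: "x \<in> lie_span L S"
  shows "bracket L z x \<in> H"
  using x assms(2)
proof (induction rule: lie_span_induct)
  case (base x)
  then show ?case by (rule S)
next
  case zero
  show ?case using assms(1) submodule_zero_mem[OF assms(3)] by simp
next
  case (add x y)
  then show ?case
    using submodule_in_carrier[OF submodule_lie_span[OF assms(2)]] assms(1)
      submodule_add[OF assms(3)] by (simp add: bracket_add_right)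
next
  case (smult c x)
  then show ?case
    using submodule_in_carrier[OF submodule_lie_span[OF assms(2)]] assms(1)
      submodule_smult[OF assms(3)] by (simp add: bracket_smult_right)
qed

lemma weight_string:
  assumes C: "e \<in> carrier L" "h \<in> carrier L" "v \<in> carrier L"
    and he: "bracket L h e = b \<odot> e" and hv: "bracket L h v = c \<odot> v"
  shows "bracket L h ((bracket L e ^^ k) v) = (c + of_nat k * b) \<odot> (bracket L e ^^ k) v"
proof (induction k)
  case (Suc k)
  let ?x = "(bracket L e ^^ k) v"
  have "bracket L h (bracket L e ?x) = b \<odot> bracket L e ?x \<oplus> (c + of_nat k * b) \<odot> bracket L e ?x"
    using C jacobi_left[of h e ?x] by (simp add: he Suc bracket_smult_left bracket_smult_right)
  then show ?case
    using C by (simp add: smult_collect algebra_simps)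
qed (simp add: hv)

text \<open>The classical sl2 formula on a lowest weight vector of weight \<open>c\<close>: moving
  \<open>f\<close> past the factors \<open>e\<close> collects \<open>- c\<close>,
  \<open>- (c + 2)\<close>, ..., \<open>- (c + 2k)\<close>, with sum
  \<open>- (k + 1)(c + k)\<close>. For \<open>c = - k\<close> the coefficient vanishes.\<close>

lemma sl2_string:
  assumes C: "e \<in> carrier L" "f \<in> carrier L" "h \<in> carrier L" "v \<in> carrier L"
    and fe: "bracket L f e = (-1) \<odot> h" and he: "bracket L h e = 2 \<odot> e"
    and fv: "bracket L f v = \<zero>" and hv: "bracket L h v = c \<odot> v"
  shows "bracket L f ((bracket L e ^^ Suc k) v) =
    (- (of_nat k + 1) * (c + of_nat k)) \<odot> (bracket L e ^^ k) v"
proof (induction k)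
  case 0
  show ?case
    using C jacobi_left[of f e v] by (simp add: fe fv hv bracket_smult_left smult_smult)
next
  case (Suc k)
  let ?x = "(bracket L e ^^ Suc k) v"
  have x: "?x \<in> carrier L"
    using C(1,4) by (rule ad_pow_closed)
  have "bracket L f (bracket L e ?x) = bracket L (bracket L f e) ?x \<oplus> bracket L e (bracket L f ?x)"
    using C x by (intro jacobi_left)
  also have "bracket L e (bracket L f ?x) = (- (of_nat k + 1) * (c + of_nat k)) \<odot> ?x"
    using C by (simp add: Suc bracket_smult_right del: funpow.simps(2)) simp
  also have "bracket L (bracket L f e) ?x = (- (c + of_nat (Suc k) * 2)) \<odot> ?x"
    using C weight_string[OF C(1,3,4) he hv, of "Suc k"] x
    by (simp add: fe bracket_smult_left smult_smult del: funpow.simps(2) of_nat_Suc)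
  also have "(- (c + of_nat (Suc k) * 2)) \<odot> ?x \<oplus> (- (of_nat k + 1) * (c + of_nat k)) \<odot> ?x =
      (- (c + of_nat (Suc k) * 2) + - (of_nat k + 1) * (c + of_nat k)) \<odot> ?x"
    by (rule smult_collect[OF x])
  also have "- (c + of_nat (Suc k) * 2) + - (of_nat k + 1) * (c + of_nat k) =
      - (of_nat (Suc k) + 1) * (c + of_nat (Suc k))"
    by (simp add: algebra_simps)
  finally show ?case
    by simp
qed

text \<open>
  The triple \<open>(u, h - 2af, f)\<close> is the image of \<open>(e, h, f)\<close> under the automorphism \<open>exp (-a ad f)\<close>,
  and \<open>v\<close> is still a lowest weight vector for it. So \<open>(ad u)\<^bsup>m+1\<^esup> v\<close> is killed by \<open>f\<close> and has
  \<open>h\<close>-weight \<open>m + 2\<close>, which does not occur in the span of the \<open>(ad e)\<^bsup>k\<^esup> v\<close>.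
\<close>

lemma sl2_nilpotent:
  assumes C: "e \<in> carrier L" "f \<in> carrier L" "h \<in> carrier L" "v \<in> carrier L"
    and ef: "bracket L e f = h" and he: "bracket L h e = 2 \<odot> e" and hf: "bracket L h f = (-2) \<odot> f"
    and fv: "bracket L f v = \<zero>" and hv: "bracket L h v = (- of_nat m) \<odot> v"
    and nil: "(bracket L e ^^ Suc m) v = \<zero>"
    and u: "u = e \<oplus> a \<odot> h \<oplus> (- a\<^sup>2) \<odot> f"
  shows "(bracket L u ^^ Suc m) v = \<zero>"
proof -
  have fe: "bracket L f e = (-1) \<odot> h"
    using bracket_antisym[OF C(1,2)] by (simp add: ef)
  have fh: "bracket L f h = 2 \<odot> f"
    using bracket_antisym[OF C(3,2)] C by (simp add: hf smult_smult)
  define V where "V k = (bracket L e ^^ k) v" for k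
  have VC: "V k \<in> carrier L" for k
    unfolding V_def using C by simp
  have hV: "bracket L h (V k) = (2 * of_nat k - of_nat m) \<odot> V k" for k
    unfolding V_def using weight_string[OF C(1,3,4) he hv, of k] by (simp add: algebra_simps)
  have fV: "bracket L f (V (Suc k)) = (- (of_nat k + 1) * (- of_nat m + of_nat k)) \<odot> V k" for k
    unfolding V_def by (rule sl2_string[OF C fe he fv hv])
  \<comment> \<open>The span of the first \<open>l\<close> string vectors. \<open>W (Suc m)\<close>
    is stable under \<open>h\<close>, \<open>f\<close> and, thanks to \<open>nil\<close>, under
    \<open>e\<close>, hence under \<open>u\<close>; \<open>W 0\<close> is zero.\<close>
  define W where "W l = lie_span L (V ` {..<l})" for l :: nat
  have VS: "V ` T \<subseteq> carrier L" for T
    using VC by auto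
  have W: "submodule (W l) complex_field L" for l
    unfolding W_def by (rule submodule_lie_span[OF VS])
  have VW: "V k \<in> W l" if "k < l" for k l
    unfolding W_def by (rule subsetD[OF lie_span_superset]) (use that in simp)
  have hW: "bracket L h x \<in> W (Suc m)" if "x \<in> W (Suc m)" for x
    by (rule bracket_lie_span[OF C(3) VS W _ that[unfolded W_def]])
      (auto simp: hV intro!: submodule_smult[OF W] VW)
  have eW: "bracket L e x \<in> W (Suc m)" if "x \<in> W (Suc m)" for x
  proof (rule bracket_lie_span[OF C(1) VS W _ that[unfolded W_def]])
    fix x assume "x \<in> V ` {..<Suc m}"
    then obtain k where k: "x = V k" "k < Suc m" by blast
    have eV: "bracket L e (V k) = V (Suc k)"
      by (simp add: V_def)
    show "bracket L e x \<in> W (Suc m)"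
    proof (cases "k = m")
      case True
      then show ?thesis
        using nil submodule_zero_mem[OF W] by (simp add: k V_def)
    next
      case False
      then show ?thesis
        using VW[of "Suc k"] k eV by simp
    qed
  qed
  have fW: "bracket L f x \<in> W (Suc m)" if "x \<in> W (Suc m)" for x
  proof (rule bracket_lie_span[OF C(2) VS W _ that[unfolded W_def]])
    fix x assume "x \<in> V ` {..<Suc m}"
    then obtain k where k: "x = V k" "k < Suc m" by blast
    show "bracket L f x \<in> W (Suc m)"
    proof (cases k)
      case 0
      then show ?thesis
        using fv submodule_zero_mem[OF W] by (simp add: k V_def)
    next
      case (Suc l)
      then show ?thesis
        using fV[of l] k VW submodule_smult[OF W] by simp
    qed
  qed
  have uC: "u \<in> carrier L"
    using C by (simp add: u)
  have WC: "x \<in> carrier L" if "x \<in> W l" for x l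
    using submodule_in_carrier[OF W that] .
  have uW: "bracket L u x \<in> W (Suc m)" if "x \<in> W (Suc m)" for x
    using C WC[OF that] hW[OF that] eW[OF that] fW[OF that]
    by (simp add: u bracket_add_left bracket_smult_left submodule_add[OF W] submodule_smult[OF W])
  define z where "z = (bracket L u ^^ Suc m) v"
  have zC: "z \<in> carrier L"
    unfolding z_def by (rule ad_pow_closed[OF uC C(4)])
  have "(bracket L u ^^ k) v \<in> W (Suc m)" for k
  proof (induction k)
    case 0
    show ?case using VW[of 0 "Suc m"] by (simp add: V_def)
  qed (simp add: uW)
  then have zW: "z \<in> W (Suc m)"
    unfolding z_def .
  define h' where "h' = h \<oplus> (- 2 * a) \<odot> f"
  have h'C: "h' \<in> carrier L"
    using C by (simp add: h'_def)
  have fu: "bracket L f u = (-1) \<odot> h'"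
  proof (rule eq_by_dual)
    fix \<psi> assume "\<psi> \<in> dual L"
    then show "\<psi> (bracket L f u) = \<psi> ((-1) \<odot> h')"
      using C by (simp add: u h'_def bracket_add_right bracket_smult_right fe fh bracket_self)
  qed (use C uC h'C in auto)
  have h'u: "bracket L h' u = 2 \<odot> u"
  proof (rule eq_by_dual)
    fix \<psi> assume "\<psi> \<in> dual L"
    then show "\<psi> (bracket L h' u) = \<psi> (2 \<odot> u)"
      using C by (simp add: u h'_def bracket_add_right bracket_smult_right bracket_add_left
          bracket_smult_left fe fh he hf bracket_self power2_eq_square algebra_simps)
  qed (use C uC h'C in auto)
  have h'v: "bracket L h' v = (- of_nat m) \<odot> v"
    using C by (simp add: h'_def bracket_add_left bracket_smult_left fv hv)
  \<comment> \<open>Lowest weight \<open>- m\<close> at position \<open>m\<close>: the coefficient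
    \<open>- (m + 1)(- m + m)\<close> is zero.\<close>
  have fz: "bracket L f z = \<zero>"
    unfolding z_def using sl2_string[OF uC C(2) h'C C(4) fu h'u fv h'v, of m] uC C by simp
  have "bracket L h' z = (of_nat m + 2) \<odot> z"
    unfolding z_def using weight_string[OF uC h'C C(4) h'u h'v, of "Suc m"]
    by (simp add: algebra_simps del: funpow.simps(2))
  then have hz: "bracket L h z = (of_nat m + 2) \<odot> z"
    using C zC by (simp add: h'_def bracket_add_left bracket_smult_left fz)
  \<comment> \<open>Subtracting from \<open>h\<close> its eigenvalue \<open>2l - m\<close> on
    \<open>V l\<close> gives an operator that maps \<open>W (Suc l)\<close> into \<open>W l\<close>.
    On \<open>z\<close> it is multiplication by \<open>(m + 2) - (2l - m) = 2(m + 1 - l)\<close>,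
    which is nonzero for \<open>l \<le> m\<close>, so \<open>z\<close> drops one level.\<close>
  have descend: "z \<in> W l" if "z \<in> W (Suc l)" "l \<le> m" for l
  proof -
    have "bracket L h x \<ominus> (2 * of_nat l - of_nat m) \<odot> x \<in> W l" if "x \<in> W (Suc l)" for x
      using that[unfolded W_def] VS
    proof (induction rule: lie_span_induct)
      case (base x)
      then obtain k where k: "x = V k" "k < Suc l" by blast
      have "bracket L h x \<ominus> (2 * of_nat l - of_nat m) \<odot> x = (2 * of_nat k - 2 * of_nat l) \<odot> x"
        using VC by (simp add: k(1) hV minus_eq_smult smult_smult smult_collect)
      moreover have "(2 * of_nat k - 2 * of_nat l) \<odot> x \<in> W l"
      proof (cases "k = l")
        case True
        then show ?thesis
          using submodule_zero_mem[OF W] VC k by simp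
      next
        case False
        then show ?thesis
          using submodule_smult[OF W VW] k by simp
      qed
      ultimately show ?case by simp
    next
      case zero
      show ?case using C submodule_zero_mem[OF W] by (simp add: minus_eq_smult)
    next
      case (add x y)
      let ?c = "2 * of_nat l - of_nat m :: complex"
      have xy: "x \<in> carrier L" "y \<in> carrier L"
        using add.hyps submodule_in_carrier[OF submodule_lie_span[OF VS]] by auto
      have "bracket L h (x \<oplus> y) \<ominus> ?c \<odot> (x \<oplus> y) =
          (bracket L h x \<ominus> ?c \<odot> x) \<oplus> (bracket L h y \<ominus> ?c \<odot> y)"
        by (rule eq_by_dual) (use C xy in \<open>auto simp: bracket_add_right algebra_simps\<close>)
      then show ?case
        using submodule_add[OF W add.IH] by simp
    next
      case (smult d x)
      let ?c = "2 * of_nat l - of_nat m :: complex"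
      have x: "x \<in> carrier L"
        using smult.hyps submodule_in_carrier[OF submodule_lie_span[OF VS]] by auto
      have "bracket L h (d \<odot> x) \<ominus> ?c \<odot> (d \<odot> x) = d \<odot> (bracket L h x \<ominus> ?c \<odot> x)"
        by (rule eq_by_dual) (use C x in \<open>auto simp: bracket_smult_right algebra_simps\<close>)
      then show ?case
        using submodule_smult[OF W smult.IH] by simp
    qed
    from this[OF that(1)] have "(2 * of_nat (Suc m - l)) \<odot> z \<in> W l"
      using zC that(2) by (simp add: hz minus_eq_smult smult_smult smult_collect of_nat_diff algebra_simps)
    then have "(1 / (2 * of_nat (Suc m - l))) \<odot> ((2 * of_nat (Suc m - l)) \<odot> z) \<in> W l"
      by (rule submodule_smult[OF W])
    moreover have "of_nat (Suc m - l) \<noteq> (0 :: complex)"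
      using that(2) by (metis Suc_diff_le of_nat_neq_0)
    ultimately show ?thesis
      using zC by (simp add: smult_smult del: of_nat_diff)
  qed
  have "z \<in> W (Suc m - k)" if "k \<le> Suc m" for k
    using that
  proof (induction k)
    case 0
    then show ?case using zW by simp
  next
    case (Suc k)
    then show ?case
      using descend[of "m - k"] by (simp add: Suc_diff_le)
  qed
  from this[of "Suc m"] have "z \<in> W 0" by simp
  moreover have "W 0 \<subseteq> {\<zero>}"
    unfolding W_def by (rule lie_span_minimal[OF _ submodule_zero]) simp
  ultimately show ?thesis
    unfolding z_def by blast
qed

end

section \<open>Chevalley generators\<close>

text \<open>These relations stop short of the Serre relations. They therefore hold for the operators
  on the full Verma module too, where the Serre elements need not vanish, and facts about Serre
  elements proved here apply there.\<close>

locale chevalley = lie_algebra L for L :: "'a lie_alg" (structure) +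
  fixes A :: "'i \<Rightarrow> 'i \<Rightarrow> int" and e f :: "'i \<Rightarrow> 'a"
  assumes gcm: "generalized_cartan_matrix A"
    and e_closed [simp, intro]: "e i \<in> carrier L" and f_closed [simp, intro]: "f i \<in> carrier L"
    and ef: "i \<noteq> j \<Longrightarrow> bracket L (e i) (f j) = \<zero>"
    and he: "bracket L (bracket L (e i) (f i)) (e j) = of_int (A i j) \<odot> e j"
    and hf: "bracket L (bracket L (e i) (f i)) (f j) = (- of_int (A i j)) \<odot> f j"
begin

abbreviation h :: "'i \<Rightarrow> 'a" where "h i \<equiv> bracket L (e i) (f i)"

lemma A_diag [simp]: "A i i = 2"
  using gcm by (simp add: generalized_cartan_matrix_def)

lemma A_zero: "A i j = 0 \<Longrightarrow> A j i = 0"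
  using gcm by (simp add: generalized_cartan_matrix_def)

lemma A_nonpos: "i \<noteq> j \<Longrightarrow> A i j \<le> 0"
  using gcm by (simp add: generalized_cartan_matrix_def)

lemma serre_exponent: "i \<noteq> j \<Longrightarrow> nat (1 - A i j) = Suc (nat (- A i j))"
  using A_nonpos[of i j] by simp

lemma of_nat_A: "i \<noteq> j \<Longrightarrow> of_nat (nat (- A i j)) = (- of_int (A i j) :: complex)"
  using A_nonpos[of i j] by (metis neg_0_le_iff_le of_int_minus of_int_of_nat_eq nat_0_le)

lemma fe: "bracket L (f i) (e j) = (if i = j then (-1) \<odot> h i else \<zero>)"
  using bracket_antisym[of "e j" "f i"] ef[of j i] by auto

lemma eh: "bracket L (e j) (h i) = (- of_int (A i j)) \<odot> e j"
  using bracket_antisym[of "h i" "e j"] by (simp add: he smult_smult)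

lemma h_serre:
  "bracket L (h k) ((bracket L (e i) ^^ n) (e j)) =
    (of_int (A k j) + of_nat n * of_int (A k i)) \<odot> (bracket L (e i) ^^ n) (e j)"
  by (rule weight_string) (auto simp: he)

text \<open>For \<open>k = i\<close> the string through \<open>e j\<close> has lowest weight
  \<open>A i j = - m\<close>, and the sl2 coefficient vanishes at step \<open>m\<close>. For
  \<open>k = j\<close> the bracket of \<open>f j\<close> with \<open>e j\<close> gives
  \<open>- h j\<close>, which \<open>ad (e i)\<close> turns into a multiple of \<open>e i\<close>
  and then kills. For all other \<open>k\<close>, \<open>f k\<close> commutes with both
  \<open>e i\<close> and \<open>e j\<close>.\<close>

lemma f_serre:
  assumes ij: "i \<noteq> j"
  shows "bracket L (f k) ((bracket L (e i) ^^ nat (1 - A i j)) (e j)) = \<zero>"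
proof -
  define m where "m = nat (- A i j)"
  have n: "nat (1 - A i j) = Suc m"
    unfolding m_def by (rule serre_exponent[OF ij])
  have m: "of_nat m = (- of_int (A i j) :: complex)"
    unfolding m_def by (rule of_nat_A[OF ij])
  show ?thesis
  proof (cases "k = i")
    case True
    have "bracket L (f i) ((bracket L (e i) ^^ Suc m) (e j)) =
        (- (of_nat m + 1) * (of_int (A i j) + of_nat m)) \<odot> (bracket L (e i) ^^ m) (e j)"
      by (rule sl2_string[where h = "h i"]) (use ij in \<open>auto simp: fe he\<close>)
    then show ?thesis
      by (simp add: True n m del: funpow.simps)
  next
    case False
    have "bracket L (f k) ((bracket L (e i) ^^ Suc m) (e j)) =
        (bracket L (e i) ^^ Suc m) (bracket L (f k) (e j))"
      by (rule ad_pow_commute) (use False in \<open>auto simp: fe\<close>)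
    also have "\<dots> = \<zero>"
    proof (cases "k = j")
      case True
      have "(bracket L (e i) ^^ Suc m) (h j) = (bracket L (e i) ^^ m) ((- of_int (A j i)) \<odot> e i)"
        by (simp only: funpow_Suc_right o_apply eh)
      also have "\<dots> = (- of_int (A j i)) \<odot> (bracket L (e i) ^^ m) (e i)"
        by (simp add: ad_pow_smult)
      also have "\<dots> = \<zero>"
      \<comment> \<open>With \<open>m = 0\<close> no further \<open>ad (e i)\<close> is left to kill
        \<open>e i\<close>; the factor \<open>A j i\<close> is zero instead, by the symmetric zero
        pattern of \<open>A\<close>.\<close>
      proof (cases m)
        case 0
        then have "A i j = 0"
          using m by simp
        then show ?thesis
          by (simp add: A_zero)
      next
        case (Suc l)
        then show ?thesis
          by (simp only: funpow_Suc_right o_apply bracket_self[OF e_closed] ad_pow_zero[OF e_closed] smult_zero)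
      qed
      finally show ?thesis
        by (simp add: fe True ad_pow_smult del: funpow.simps)
    qed (simp add: fe ad_pow_zero del: funpow.simps)
    finally show ?thesis
      by (simp only: n)
  qed
qed

text \<open>The Chevalley involution: exchanging \<open>e\<close> and \<open>f\<close> turns each
  \<open>h i\<close> into its negative and keeps \<open>A\<close>. It carries facts about Serre
  elements in the \<open>e i\<close> over to those in the \<open>f i\<close>.\<close>

lemma opposite: "chevalley L A f e"
proof
  have h: "bracket L (f i) (e i) = (-1) \<odot> h i" for i
    by (simp add: fe)
  show "bracket L (bracket L (f i) (e i)) (f j) = of_int (A i j) \<odot> f j" for i j
    by (simp add: h bracket_smult_left hf smult_smult)
  show "bracket L (bracket L (f i) (e i)) (e j) = (- of_int (A i j)) \<odot> e j" for i j
    by (simp add: h bracket_smult_left he smult_smult)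
qed (auto simp: gcm fe)

lemma e_serre:
  "i \<noteq> j \<Longrightarrow> bracket L (e k) ((bracket L (f i) ^^ nat (1 - A i j)) (f j)) = \<zero>"
  by (rule chevalley.f_serre[OF opposite])

end

locale kac_moody_like = chevalley +
  assumes hh: "bracket L (h i) (h j) = \<zero>"
    and serre_e: "i \<noteq> j \<Longrightarrow> (bracket L (e i) ^^ nat (1 - A i j)) (e j) = \<zero>"
    and serre_f: "i \<noteq> j \<Longrightarrow> (bracket L (f i) ^^ nat (1 - A i j)) (f j) = \<zero>"
begin

text \<open>\<open>u j\<close> is split into its parts along \<open>e j\<close>, \<open>h j\<close>
  and \<open>f j\<close>. The power of \<open>ad (u i)\<close> vanishes on the two outer parts by
  \<open>sl2_nilpotent\<close>, so the right-hand side, with its factor \<open>a j\<close>, stems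
  from \<open>a j \<odot> h j\<close> alone.\<close>

lemma deformed_serre:
  fixes a :: "'b \<Rightarrow> complex"
  defines "u \<equiv> \<lambda>i. e i \<oplus> a i \<odot> h i \<oplus> (- (a i)\<^sup>2) \<odot> f i"
  assumes ij: "i \<noteq> j"
  shows "(bracket L (u i) ^^ nat (1 - A i j)) (u j) =
    (- 2 * (if A i j = - 1 then 1 else 0) * of_int (A j i) * a i * a j) \<odot> u i"
proof -
  define m where "m = nat (- A i j)"
  have n: "nat (1 - A i j) = Suc m"
    unfolding m_def by (rule serre_exponent[OF ij])
  have m: "of_nat m = (- of_int (A i j) :: complex)"
    unfolding m_def by (rule of_nat_A[OF ij])
  have uC: "u i \<in> carrier L" for i
    by (simp add: u_def)
  have on_e: "(bracket L (u i) ^^ Suc m) (e j) = \<zero>"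
    by (rule sl2_nilpotent[of "e i" "f i" "h i" "e j" m "u i" "a i"])
      (use ij serre_e[OF ij] in \<open>simp_all add: he hf fe m n u_def del: funpow.simps\<close>)
  have on_f: "(bracket L (u i) ^^ Suc m) (f j) = \<zero>"
  proof (cases "a i = 0")
    case True
    have "bracket L (u i) (f j) = \<zero>"
      using ij by (simp add: True u_def ef)
    then show ?thesis
      by (simp add: funpow_Suc_right ad_pow_zero uC del: funpow.simps)
  next
    case False
    \<comment> \<open>Dividing \<open>u i\<close> by \<open>- (a i)^2\<close> gives an element of
      the same shape for the opposite triple \<open>(f i, - h i, e i)\<close> with parameter
      \<open>1 / a i\<close>, so \<open>sl2_nilpotent\<close> applies to \<open>f j\<close> as
      well.\<close>
    define w where "w = f i \<oplus> (1 / a i) \<odot> ((-1) \<odot> h i) \<oplus> (- (1 / a i)\<^sup>2) \<odot> e i"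
    have wC: "w \<in> carrier L"
      by (simp add: w_def)
    have "(bracket L w ^^ Suc m) (f j) = \<zero>"
      by (rule sl2_nilpotent[of "f i" "e i" "(-1) \<odot> h i" "f j" m w "1 / a i"])
        (use ij serre_f[OF ij] in \<open>simp_all add: he hf fe ef m n w_def bracket_smult_left smult_smult
          del: funpow.simps\<close>)
    moreover have "u i = (- (a i)\<^sup>2) \<odot> w"
      by (rule eq_by_dual) (use False in \<open>auto simp: u_def w_def field_simps power2_eq_square\<close>)
    ultimately show ?thesis
      by (simp add: ad_smult_pow wC del: funpow.simps)
  qed
  have uh: "bracket L (u i) (h j) = (- of_int (A j i)) \<odot> (e i \<oplus> (a i)\<^sup>2 \<odot> f i)"
  proof (rule eq_by_dual)
    fix \<psi> assume "\<psi> \<in> dual L"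
    moreover have "bracket L (f i) (h j) = of_int (A j i) \<odot> f i"
      using bracket_antisym[of "h j" "f i"] by (simp add: hf smult_smult)
    ultimately show "\<psi> (bracket L (u i) (h j)) = \<psi> ((- of_int (A j i)) \<odot> (e i \<oplus> (a i)\<^sup>2 \<odot> f i))"
      by (simp add: u_def bracket_add_left bracket_smult_left eh hh algebra_simps)
  qed (auto simp: uC)
  have uuh: "bracket L (u i) (bracket L (u i) (h j)) = (- 2 * of_int (A j i) * a i) \<odot> u i"
    unfolding uh
  proof (rule eq_by_dual)
    fix \<psi> assume "\<psi> \<in> dual L"
    then show "\<psi> (bracket L (u i) ((- of_int (A j i)) \<odot> (e i \<oplus> (a i)\<^sup>2 \<odot> f i))) =
        \<psi> ((- 2 * of_int (A j i) * a i) \<odot> u i)"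
      by (simp add: u_def bracket_add_left bracket_smult_left bracket_add_right bracket_smult_right
          he hf fe bracket_self algebra_simps power2_eq_square)
  qed (auto simp: uC)
  have on_h: "(bracket L (u i) ^^ Suc m) (h j) =
      (- 2 * (if A i j = - 1 then 1 else 0) * of_int (A j i) * a i) \<odot> u i"
  proof -
    \<comment> \<open>\<open>ad (u i)\<close> sends \<open>h j\<close> to a multiple of
      \<open>e i \<oplus> (a i)\<^sup>2 \<odot> f i\<close>, this to a multiple of
      \<open>u i\<close>, and that to zero. Hence the power \<open>m + 1\<close> can survive only
      for \<open>m \<le> 1\<close>, and for \<open>m = 0\<close> the factor \<open>A j i\<close> is
      zero.\<close>
    consider "m = 0" | "m = 1" | l where "m = Suc (Suc l)"
      by (metis One_nat_def not0_implies_Suc)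
    then show ?thesis
    proof cases
      case 1
      then have "A i j = 0" using m by simp
      then show ?thesis
        using uC by (simp add: 1 uh A_zero)
    next
      case 2
      then have "A i j = - 1" using m_def by simp
      then show ?thesis
        using uC by (simp add: 2 uuh)
    next
      case 3
      then have "A i j \<noteq> - 1" using m_def by auto
      moreover have "(bracket L (u i) ^^ Suc m) (h j) =
          (bracket L (u i) ^^ l) (bracket L (u i) (bracket L (u i) (bracket L (u i) (h j))))"
        by (simp only: 3 funpow_Suc_right o_apply)
      ultimately show ?thesis
        using uC by (simp add: uuh bracket_smult_right bracket_self ad_pow_zero)
    qed
  qed
  have uj: "u j = e j \<oplus> a j \<odot> h j \<oplus> (- (a j)\<^sup>2) \<odot> f j"
    by (simp add: u_def)
  have "(bracket L (u i) ^^ Suc m) (u j) =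
      (bracket L (u i) ^^ Suc m) (e j) \<oplus> a j \<odot> (bracket L (u i) ^^ Suc m) (h j)
        \<oplus> (- (a j)\<^sup>2) \<odot> (bracket L (u i) ^^ Suc m) (f j)"
    unfolding uj by (simp add: ad_pow_add ad_pow_smult uC del: funpow.simps)
  then show ?thesis
    using uC by (simp add: n on_e on_f on_h smult_smult algebra_simps del: funpow.simps)
qed

end

section \<open>Lie algebras of operators\<close>

text \<open>
  Operators act on functionals, so the bracket is the opposite of the commutator: \<open>op_lie\<close> consists
  of the transposes of operators on the predual. Operators are normalised to vanish outside \<open>V\<close>.
\<close>

definition op_lie :: "('w \<Rightarrow> complex) set \<Rightarrow> (('w \<Rightarrow> complex) \<Rightarrow> 'w \<Rightarrow> complex) lie_alg" where
  "op_lie V = \<lparr>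
     carrier = {T. (\<forall>\<phi>. \<phi> \<notin> V \<longrightarrow> T \<phi> = (\<lambda>_. 0)) \<and> (\<forall>\<phi>\<in>V. T \<phi> \<in> V) \<and>
       (\<forall>\<phi>\<in>V. \<forall>\<chi>\<in>V. T (\<lambda>w. \<phi> w + \<chi> w) = (\<lambda>w. T \<phi> w + T \<chi> w)) \<and>
       (\<forall>c. \<forall>\<phi>\<in>V. T (\<lambda>w. c * \<phi> w) = (\<lambda>w. c * T \<phi> w))},
     monoid.mult = undefined,
     monoid.one = undefined,
     ring.zero = (\<lambda>_ _. 0),
     ring.add = (\<lambda>S T \<phi> w. S \<phi> w + T \<phi> w),
     module.smult = (\<lambda>c T \<phi> w. c * T \<phi> w),
     bracket = (\<lambda>S T \<phi> w. T (S \<phi>) w - S (T \<phi>) w)\<rparr>"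

lemma op_lie_simps [simp]:
  "\<zero>\<^bsub>op_lie V\<^esub> = (\<lambda>_ _. 0)"
  "S \<oplus>\<^bsub>op_lie V\<^esub> T = (\<lambda>\<phi> w. S \<phi> w + T \<phi> w)"
  "c \<odot>\<^bsub>op_lie V\<^esub> T = (\<lambda>\<phi> w. c * T \<phi> w)"
  "bracket (op_lie V) S T = (\<lambda>\<phi> w. T (S \<phi>) w - S (T \<phi>) w)"
  by (simp_all add: op_lie_def)

locale function_space =
  fixes V :: "('w \<Rightarrow> complex) set"
  assumes zero_mem: "(\<lambda>_. 0) \<in> V"
    and add_mem: "\<phi> \<in> V \<Longrightarrow> \<chi> \<in> V \<Longrightarrow> (\<lambda>w. \<phi> w + \<chi> w) \<in> V"
    and smult_mem: "\<phi> \<in> V \<Longrightarrow> (\<lambda>w. c * \<phi> w) \<in> V"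
begin

lemma op_outside: "T \<in> carrier (op_lie V) \<Longrightarrow> \<phi> \<notin> V \<Longrightarrow> T \<phi> = (\<lambda>_. 0)"
  by (simp add: op_lie_def)

lemma op_mem: "T \<in> carrier (op_lie V) \<Longrightarrow> \<phi> \<in> V \<Longrightarrow> T \<phi> \<in> V"
  by (simp add: op_lie_def)

lemma op_add: "T \<in> carrier (op_lie V) \<Longrightarrow> \<phi> \<in> V \<Longrightarrow> \<chi> \<in> V \<Longrightarrow>
    T (\<lambda>w. \<phi> w + \<chi> w) = (\<lambda>w. T \<phi> w + T \<chi> w)"
  by (simp add: op_lie_def)

lemma op_smult: "T \<in> carrier (op_lie V) \<Longrightarrow> \<phi> \<in> V \<Longrightarrow> T (\<lambda>w. c * \<phi> w) = (\<lambda>w. c * T \<phi> w)"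
  by (simp add: op_lie_def)

lemma op_zero: "T \<in> carrier (op_lie V) \<Longrightarrow> T (\<lambda>_. 0) = (\<lambda>_. 0)"
  using op_smult[of T "\<lambda>_. 0" 0] zero_mem by simp

lemma diff_mem: "\<phi> \<in> V \<Longrightarrow> \<chi> \<in> V \<Longrightarrow> (\<lambda>w. \<phi> w - \<chi> w) \<in> V"
  using add_mem[of \<phi> "\<lambda>w. (-1) * \<chi> w"] smult_mem[of \<chi> "-1"] by simp

lemma op_diff:
  assumes "T \<in> carrier (op_lie V)" "\<phi> \<in> V" "\<chi> \<in> V"
  shows "T (\<lambda>w. \<phi> w - \<chi> w) = (\<lambda>w. T \<phi> w - T \<chi> w)"
  using op_add[OF assms(1,2) smult_mem[OF assms(3)], of "-1"] op_smult[OF assms(1,3), of "-1"] by simp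

lemma op_carrierI:
  assumes "\<And>\<phi>. \<phi> \<notin> V \<Longrightarrow> T \<phi> = (\<lambda>_. 0)" "\<And>\<phi>. \<phi> \<in> V \<Longrightarrow> T \<phi> \<in> V"
    and "\<And>\<phi> \<chi>. \<phi> \<in> V \<Longrightarrow> \<chi> \<in> V \<Longrightarrow> T (\<lambda>w. \<phi> w + \<chi> w) = (\<lambda>w. T \<phi> w + T \<chi> w)"
    and "\<And>c \<phi>. \<phi> \<in> V \<Longrightarrow> T (\<lambda>w. c * \<phi> w) = (\<lambda>w. c * T \<phi> w)"
  shows "T \<in> carrier (op_lie V)"
  using assms by (simp add: op_lie_def)

lemma op_add_closed:
  assumes "S \<in> carrier (op_lie V)" "T \<in> carrier (op_lie V)"
  shows "(\<lambda>\<phi> w. S \<phi> w + T \<phi> w) \<in> carrier (op_lie V)"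
  by (rule op_carrierI)
    (use assms in \<open>simp_all add: op_outside op_mem op_add op_smult add_mem algebra_simps\<close>)

lemma op_smult_closed:
  assumes "T \<in> carrier (op_lie V)"
  shows "(\<lambda>\<phi> w. c * T \<phi> w) \<in> carrier (op_lie V)"
  by (rule op_carrierI)
    (use assms in \<open>simp_all add: op_outside op_mem op_add op_smult smult_mem algebra_simps\<close>)

lemma op_bracket_closed:
  assumes "S \<in> carrier (op_lie V)" "T \<in> carrier (op_lie V)"
  shows "(\<lambda>\<phi> w. T (S \<phi>) w - S (T \<phi>) w) \<in> carrier (op_lie V)"
  by (rule op_carrierI)
    (use assms in \<open>simp_all add: op_outside op_zero op_mem op_add op_smult diff_mem algebra_simps\<close>)

lemma lie_algebra_op_lie: "lie_algebra (op_lie V)"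
proof -
  have ag: "abelian_group (op_lie V)"
  proof (rule abelian_groupI)
    fix T assume T: "T \<in> carrier (op_lie V)"
    show "\<exists>S\<in>carrier (op_lie V). S \<oplus>\<^bsub>op_lie V\<^esub> T = \<zero>\<^bsub>op_lie V\<^esub>"
      by (rule bexI[OF _ op_smult_closed[OF T, of "-1"]]) simp
    show "\<zero>\<^bsub>op_lie V\<^esub> \<oplus>\<^bsub>op_lie V\<^esub> T = T"
      by simp
  next
    show "\<zero>\<^bsub>op_lie V\<^esub> \<in> carrier (op_lie V)"
      by (rule op_carrierI) (simp_all add: zero_mem)
  qed (simp_all add: op_add_closed algebra_simps)
  have "module complex_field (op_lie V)"
  proof (rule moduleI)
    show "cring complex_field"
      by (rule cring_from_type_algebra)
  qed (rule ag, simp_all add: op_smult_closed ring_of_type_algebra_def algebra_simps)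
  moreover have "lie_algebra_axioms (op_lie V)"
  proof
    fix S T R assume c: "S \<in> carrier (op_lie V)" "T \<in> carrier (op_lie V)" "R \<in> carrier (op_lie V)"
    have "bracket (op_lie V) S (bracket (op_lie V) T R) \<phi> w +
        bracket (op_lie V) T (bracket (op_lie V) R S) \<phi> w +
        bracket (op_lie V) R (bracket (op_lie V) S T) \<phi> w = 0" for \<phi> w
      by (cases "\<phi> \<in> V") (simp_all add: c op_mem op_diff op_outside op_zero)
    then show "bracket (op_lie V) S (bracket (op_lie V) T R) \<oplus>\<^bsub>op_lie V\<^esub>
        bracket (op_lie V) T (bracket (op_lie V) R S) \<oplus>\<^bsub>op_lie V\<^esub>
        bracket (op_lie V) R (bracket (op_lie V) S T) = \<zero>\<^bsub>op_lie V\<^esub>"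
      by (intro ext) (simp only: op_lie_simps)
    show "bracket (op_lie V) (S \<oplus>\<^bsub>op_lie V\<^esub> T) R =
        bracket (op_lie V) S R \<oplus>\<^bsub>op_lie V\<^esub> bracket (op_lie V) T R"
    proof (intro ext)
      fix \<phi> w
      show "bracket (op_lie V) (S \<oplus>\<^bsub>op_lie V\<^esub> T) R \<phi> w =
          (bracket (op_lie V) S R \<oplus>\<^bsub>op_lie V\<^esub> bracket (op_lie V) T R) \<phi> w"
        by (cases "\<phi> \<in> V") (simp_all add: c op_mem op_add op_outside op_zero)
    qed
    show "bracket (op_lie V) S (T \<oplus>\<^bsub>op_lie V\<^esub> R) =
        bracket (op_lie V) S T \<oplus>\<^bsub>op_lie V\<^esub> bracket (op_lie V) S R"
    proof (intro ext)
      fix \<phi> w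
      show "bracket (op_lie V) S (T \<oplus>\<^bsub>op_lie V\<^esub> R) \<phi> w =
          (bracket (op_lie V) S T \<oplus>\<^bsub>op_lie V\<^esub> bracket (op_lie V) S R) \<phi> w"
        by (cases "\<phi> \<in> V") (simp_all add: c op_mem op_add op_outside op_zero)
    qed
  next
    fix S T c assume c: "S \<in> carrier (op_lie V)" "T \<in> carrier (op_lie V)"
    show "bracket (op_lie V) (c \<odot>\<^bsub>op_lie V\<^esub> S) T = c \<odot>\<^bsub>op_lie V\<^esub> bracket (op_lie V) S T"
    proof (intro ext)
      fix \<phi> w
      show "bracket (op_lie V) (c \<odot>\<^bsub>op_lie V\<^esub> S) T \<phi> w = (c \<odot>\<^bsub>op_lie V\<^esub> bracket (op_lie V) S T) \<phi> w"
        by (cases "\<phi> \<in> V") (simp_all add: c op_mem op_smult op_outside op_zero algebra_simps)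
    qed
    show "bracket (op_lie V) S (c \<odot>\<^bsub>op_lie V\<^esub> T) = c \<odot>\<^bsub>op_lie V\<^esub> bracket (op_lie V) S T"
    proof (intro ext)
      fix \<phi> w
      show "bracket (op_lie V) S (c \<odot>\<^bsub>op_lie V\<^esub> T) \<phi> w = (c \<odot>\<^bsub>op_lie V\<^esub> bracket (op_lie V) S T) \<phi> w"
        by (cases "\<phi> \<in> V") (simp_all add: c op_mem op_smult op_outside op_zero algebra_simps)
    qed
  qed (simp_all add: op_bracket_closed)
  ultimately show ?thesis
    by (rule lie_algebra.intro)
qed

end

abbreviation op :: "(('w \<Rightarrow> complex) \<Rightarrow> 'w \<Rightarrow> complex) lie_alg" where "op \<equiv> op_lie UNIV"

interpretation all_functions: function_space UNIV
  by unfold_locales auto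

interpretation op: lie_algebra op
  by (rule all_functions.lie_algebra_op_lie)

text \<open>The value zero outside \<open>V\<close> is the normalisation that membership in
  \<open>op_lie V\<close> demands; with it, operators that agree on \<open>V\<close> are equal as
  functions.\<close>

definition op_restrict :: "('w \<Rightarrow> complex) set \<Rightarrow> (('w \<Rightarrow> complex) \<Rightarrow> 'w \<Rightarrow> complex) \<Rightarrow>
    ('w \<Rightarrow> complex) \<Rightarrow> 'w \<Rightarrow> complex" where
  "op_restrict V T \<phi> = (if \<phi> \<in> V then T \<phi> else (\<lambda>_. 0))"

context function_space
begin

lemma op_restrict_closed:
  assumes "T \<in> carrier op" "\<And>\<phi>. \<phi> \<in> V \<Longrightarrow> T \<phi> \<in> V"
  shows "op_restrict V T \<in> carrier (op_lie V)"
  by (rule op_carrierI)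
    (simp_all add: op_restrict_def assms(2) add_mem smult_mem all_functions.op_add[OF assms(1)]
      all_functions.op_smult[OF assms(1)])

lemma lie_eval_preserves:
  assumes "\<And>i \<phi>. \<phi> \<in> V \<Longrightarrow> u i \<phi> \<in> V"
  shows "\<phi> \<in> V \<Longrightarrow> lie_eval op u t \<phi> \<in> V"
  by (induction t arbitrary: \<phi>) (simp_all add: assms zero_mem add_mem smult_mem diff_mem)

lemma lie_eval_op_restrict:
  assumes "\<And>i. u i \<in> carrier op" "\<And>i \<phi>. \<phi> \<in> V \<Longrightarrow> u i \<phi> \<in> V"
  shows "lie_eval (op_lie V) (\<lambda>i. op_restrict V (u i)) t = op_restrict V (lie_eval op u t)"
proof (induction t)
  case (Brk s t)
  have z: "lie_eval op u t (\<lambda>_. 0) = (\<lambda>_. 0)" for t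
    using all_functions.op_zero op.lie_eval_closed'[OF assms(1)] .
  show ?case
    unfolding lie_eval.simps Brk op_lie_simps
    by (intro ext) (simp add: op_restrict_def lie_eval_preserves[OF assms(2)] z)
qed (auto simp: op_restrict_def fun_eq_iff)

end

section \<open>The transposed Verma module\<close>

text \<open>
  A word \<open>j\<^sub>1 \<dots> j\<^sub>k\<close> stands for the vector \<open>e\<^sub>j\<^sub>1 \<dots> e\<^sub>j\<^sub>k v\<close> of the lowest weight module with
  \<open>f\<^sub>i v = h\<^sub>i v = 0\<close>, and functions on words are the functionals on this module.
\<close>

definition raise :: "'i \<Rightarrow> ('i list \<Rightarrow> complex) \<Rightarrow> 'i list \<Rightarrow> complex" where
  "raise i \<phi> w = \<phi> (i # w)"

definition weight :: "('i \<Rightarrow> 'i \<Rightarrow> int) \<Rightarrow> 'i \<Rightarrow> 'i list \<Rightarrow> complex" where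
  "weight A i w = of_int (\<Sum>j\<leftarrow>w. A i j)"

text \<open>The transpose of \<open>f_i e_j x = e_j f_i x - \<delta>_ij h_i x\<close>: the recursion
  moves \<open>f_i\<close> to the right through the word until it meets the lowest weight vector and
  gives zero.\<close>

fun lower :: "('i \<Rightarrow> 'i \<Rightarrow> int) \<Rightarrow> 'i \<Rightarrow> ('i list \<Rightarrow> complex) \<Rightarrow> 'i list \<Rightarrow> complex" where
  "lower A i \<phi> [] = 0"
| "lower A i \<phi> (j # w) = lower A i (raise j \<phi>) w - (if i = j then weight A i w * \<phi> w else 0)"

lemma weight_simps [simp]:
  "weight A i [] = 0" "weight A i (j # w) = of_int (A i j) + weight A i w"
  by (simp_all add: weight_def)

lemma weight_append: "weight A i (v @ w) = weight A i v + weight A i w"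
  by (simp add: weight_def)

lemma raise_add: "raise i (\<lambda>w. \<phi> w + \<chi> w) = (\<lambda>w. raise i \<phi> w + raise i \<chi> w)"
  and raise_smult: "raise i (\<lambda>w. c * \<phi> w) = (\<lambda>w. c * raise i \<phi> w)"
  by (auto simp: raise_def)

lemma lower_add: "lower A i (\<lambda>w. \<phi> w + \<chi> w) w = lower A i \<phi> w + lower A i \<chi> w"
  by (induction w arbitrary: \<phi> \<chi>) (simp_all add: raise_add algebra_simps)

lemma lower_smult: "lower A i (\<lambda>w. c * \<phi> w) w = c * lower A i \<phi> w"
  by (induction w arbitrary: \<phi>) (simp_all add: raise_smult algebra_simps)

lemma lower_weight:
  "lower A j (\<lambda>w. weight A i w * \<phi> w) w = (weight A i w - of_int (A i j)) * lower A j \<phi> w"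
proof (induction w arbitrary: \<phi>)
  case (Cons k w)
  have "raise k (\<lambda>w. weight A i w * \<phi> w) =
      (\<lambda>w. of_int (A i k) * raise k \<phi> w + weight A i w * raise k \<phi> w)"
    by (auto simp: raise_def algebra_simps)
  then show ?case
    by (simp add: lower_add lower_smult Cons) (auto simp: algebra_simps)
qed simp

text \<open>\<open>f_i\<close> shortens a word by one letter. For this reason the
  \<open>lower\<close> part of a deformed generator drops out of leading terms.\<close>

lemma lower_vanish: "(\<And>v. length v < length w \<Longrightarrow> \<phi> v = 0) \<Longrightarrow> lower A i \<phi> w = 0"
  by (induction w arbitrary: \<phi>) (simp_all add: raise_def)

lemma raise_closed: "raise i \<in> carrier op"
  by (rule all_functions.op_carrierI) (simp_all add: raise_add raise_smult)

lemma lower_closed: "lower A i \<in> carrier op"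
  by (rule all_functions.op_carrierI) (auto simp: lower_add lower_smult)

lemma bracket_raise_lower:
  "bracket op (raise i) (lower A j) = (if i = j then (\<lambda>\<phi> w. weight A i w * \<phi> w) else (\<lambda>_ _. 0))"
  by (auto simp: fun_eq_iff raise_def)

lemma chevalley_op:
  assumes "generalized_cartan_matrix A"
  shows "chevalley op A raise (lower A)"
proof
  show "bracket op (bracket op (raise i) (lower A i)) (raise j) = of_int (A i j) \<odot>\<^bsub>op\<^esub> raise j" for i j
    unfolding bracket_raise_lower by (auto simp: fun_eq_iff raise_def algebra_simps)
  show "bracket op (bracket op (raise i) (lower A i)) (lower A j) =
      (- of_int (A i j)) \<odot>\<^bsub>op\<^esub> lower A j" for i j
    unfolding bracket_raise_lower by (simp add: fun_eq_iff lower_weight) (simp add: algebra_simps)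
  show "i \<noteq> j \<Longrightarrow> bracket op (raise i) (lower A j) = \<zero>\<^bsub>op\<^esub>" for i j
    unfolding bracket_raise_lower by simp
qed (simp_all add: assms raise_closed lower_closed)

text \<open>Kept as a term, so that one expression can be evaluated in the operators on words as
  well as in the algebra presented by the Serre relations.\<close>

definition serre_term :: "('i \<Rightarrow> 'i \<Rightarrow> int) \<Rightarrow> 'i \<Rightarrow> 'i \<Rightarrow> 'i lie_term" where
  "serre_term A i j = (Brk (Gen i) ^^ nat (1 - A i j)) (Gen j)"

abbreviation serre_op :: "('i \<Rightarrow> 'i \<Rightarrow> int) \<Rightarrow> 'i \<Rightarrow> 'i \<Rightarrow> ('i list \<Rightarrow> complex) \<Rightarrow> 'i list \<Rightarrow> complex" where
  "serre_op A i j \<equiv> lie_eval op raise (serre_term A i j)"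

text \<open>The functionals vanishing on the two-sided ideal generated by the Serre elements.\<close>

definition serre_dual :: "('i \<Rightarrow> 'i \<Rightarrow> int) \<Rightarrow> ('i list \<Rightarrow> complex) set" where
  "serre_dual A = {\<phi>. \<forall>v i j. i \<noteq> j \<longrightarrow> serre_op A i j (\<lambda>w. \<phi> (v @ w)) = (\<lambda>_. 0)}"

lemma serre_op_closed: "serre_op A i j \<in> carrier op"
  by (rule op.lie_eval_closed') (rule raise_closed)

interpretation serre_dual: function_space "serre_dual A"
  by unfold_locales
    (simp_all add: serre_dual_def all_functions.op_zero[OF serre_op_closed]
      all_functions.op_add[OF serre_op_closed] all_functions.op_smult[OF serre_op_closed])

text \<open>The left factor \<open>v\<close> in \<open>serre_dual\<close> absorbs the new letter
  \<open>k\<close>.\<close>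

lemma raise_serre_dual:
  assumes "\<phi> \<in> serre_dual A" shows "raise k \<phi> \<in> serre_dual A"
proof -
  have "serre_op A i j (\<lambda>w. \<phi> ((k # v) @ w)) = (\<lambda>_. 0)" if "i \<noteq> j" for i j v
    using assms that unfolding serre_dual_def by blast
  then show ?thesis
    by (simp add: serre_dual_def raise_def)
qed

section \<open>Invariance of the annihilator of the Serre ideal\<close>

locale cartan_matrix =
  fixes A :: "'i \<Rightarrow> 'i \<Rightarrow> int"
  assumes gcm: "generalized_cartan_matrix A"
begin

sublocale op_chevalley: chevalley op A raise "lower A"
  by (rule chevalley_op[OF gcm])

lemma serre_op_eq: "serre_op A i j = (bracket op (raise i) ^^ nat (1 - A i j)) (raise j)"
  by (simp add: serre_term_def op.lie_eval_ad_pow del: op_lie_simps)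

lemma serre_op_lower:
  assumes "i \<noteq> j" shows "serre_op A i j (lower A k \<phi>) = lower A k (serre_op A i j \<phi>)"
proof -
  have "bracket op (lower A k) (serre_op A i j) \<phi> w = 0" for w
    unfolding serre_op_eq op_chevalley.f_serre[OF assms] by simp
  then show ?thesis
    by (auto simp: fun_eq_iff)
qed

lemma serre_op_weight:
  obtains c where "\<And>\<phi>. serre_op A i j (\<lambda>w. weight A k w * \<phi> w) =
    (\<lambda>w. (weight A k w + c) * serre_op A i j \<phi> w)"
proof -
  define c :: complex where "c = of_int (A k j) + of_nat (nat (1 - A i j)) * of_int (A k i)"
  have "bracket op (\<lambda>\<phi> w. weight A k w * \<phi> w) (serre_op A i j) = c \<odot>\<^bsub>op\<^esub> serre_op A i j"
    using op_chevalley.h_serre[where n = "nat (1 - A i j)"]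
    unfolding serre_op_eq c_def bracket_raise_lower if_True by simp
  then have "bracket op (\<lambda>\<phi> w. weight A k w * \<phi> w) (serre_op A i j) \<phi> w =
      (c \<odot>\<^bsub>op\<^esub> serre_op A i j) \<phi> w" for \<phi> w
    by simp
  then show ?thesis
    by (intro that[of c]) (auto simp: fun_eq_iff algebra_simps)
qed

lemma weight_serre_dual:
  assumes "\<phi> \<in> serre_dual A"
  shows "(\<lambda>w. weight A k w * \<phi> w) \<in> serre_dual A"
proof -
  have "serre_op A i j (\<lambda>w. weight A k (v @ w) * \<phi> (v @ w)) = (\<lambda>_. 0)" if ij: "i \<noteq> j" for i j v
  proof -
    let ?\<chi> = "\<lambda>w. \<phi> (v @ w)"
    have 0: "serre_op A i j ?\<chi> = (\<lambda>_. 0)"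
      using assms ij by (simp add: serre_dual_def)
    obtain c where c: "\<And>\<phi>. serre_op A i j (\<lambda>w. weight A k w * \<phi> w) =
        (\<lambda>w. (weight A k w + c) * serre_op A i j \<phi> w)"
      using serre_op_weight[of i j k] by blast
    have "(\<lambda>w. weight A k (v @ w) * \<phi> (v @ w)) = (\<lambda>w. weight A k v * ?\<chi> w + weight A k w * ?\<chi> w)"
      by (simp add: weight_append algebra_simps)
    then show ?thesis
      using 0 by (simp add: all_functions.op_add[OF serre_op_closed]
          all_functions.op_smult[OF serre_op_closed] c)
  qed
  then show ?thesis
    by (simp add: serre_dual_def)
qed

text \<open>Induction on the left factor \<open>v\<close> of the ideal. With no letter left,
  \<open>f_k\<close> commutes with the Serre element. Passing a letter \<open>l\<close> costs, for
  \<open>k = l\<close> only, a weight factor, and \<open>weight_serre_dual\<close> controls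
  it.\<close>

lemma lower_serre_dual:
  assumes "\<phi> \<in> serre_dual A" shows "lower A k \<phi> \<in> serre_dual A"
proof -
  have "serre_op A i j (\<lambda>w. lower A k \<phi> (v @ w)) = (\<lambda>_. 0)"
    if ij: "i \<noteq> j" and "\<phi> \<in> serre_dual A" for i j v \<phi>
    using that(2)
  proof (induction v arbitrary: \<phi>)
    case Nil
    then have "serre_op A i j (\<lambda>w. \<phi> ([] @ w)) = (\<lambda>_. 0)"
      using ij unfolding serre_dual_def by blast
    then show ?case
      using all_functions.op_zero[OF lower_closed, of A k] by (simp add: serre_op_lower[OF ij])
  next
    case (Cons l v)
    let ?\<chi> = "\<lambda>w. weight A k w * \<phi> w"
    have "(\<lambda>w. lower A k \<phi> ((l # v) @ w)) =
        (\<lambda>w. lower A k (raise l \<phi>) (v @ w) - (if k = l then 1 else 0) * ?\<chi> (v @ w))"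
      by auto
    moreover have "serre_op A i j (\<lambda>w. ?\<chi> (v @ w)) = (\<lambda>_. 0)"
      using weight_serre_dual[OF Cons.prems, of k] ij by (simp add: serre_dual_def)
    ultimately show ?case
      using Cons.IH[OF raise_serre_dual[OF Cons.prems]]
      by (simp only: all_functions.op_diff[OF serre_op_closed UNIV_I UNIV_I]
          all_functions.op_smult[OF serre_op_closed UNIV_I]) simp
  qed
  then show ?thesis
    using assms by (simp add: serre_dual_def)
qed

text \<open>The Serre elements in the \<open>f_i\<close> act by zero already on the full Verma
  module: they commute with every \<open>e_k\<close> and kill the lowest weight vector, which
  generates the module under the \<open>e_k\<close>.\<close>

lemma serre_lower_vanish:
  assumes ij: "i \<noteq> j"
  shows "(bracket op (lower A i) ^^ nat (1 - A i j)) (lower A j) \<phi> w = 0"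
proof -
  let ?T = "\<lambda>n. (bracket op (lower A i) ^^ n) (lower A j)"
  have nil: "?T n \<phi> [] = 0" for n \<phi>
    by (induction n arbitrary: \<phi>) simp_all
  have "bracket op (raise k) (?T (nat (1 - A i j))) \<phi> w = 0" for k \<phi> w
    unfolding op_chevalley.e_serre[OF ij] by simp
  then have comm: "?T (nat (1 - A i j)) (raise k \<phi>) w = raise k (?T (nat (1 - A i j)) \<phi>) w" for k \<phi> w
    by simp
  show ?thesis
  proof (induction w arbitrary: \<phi>)
    case Nil
    show ?case by (rule nil)
  next
    case (Cons k w)
    then show ?case
      using comm[of k \<phi> w] by (simp add: raise_def del: op_lie_simps)
  qed
qed

section \<open>The representation of the Kac-Moody algebra on functionals\<close>

definition generator_op :: "'i chevalley \<Rightarrow> ('i list \<Rightarrow> complex) \<Rightarrow> 'i list \<Rightarrow> complex" where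
  "generator_op x = (case x of E i \<Rightarrow> raise i | F i \<Rightarrow> lower A i)"

lemma generator_op_simps [simp]: "generator_op (E i) = raise i" "generator_op (F i) = lower A i"
  by (simp_all add: generator_op_def)

lemma generator_op_closed: "generator_op x \<in> carrier op"
  by (cases x) (simp_all add: raise_closed lower_closed)

lemma generator_op_preserves: "\<phi> \<in> serre_dual A \<Longrightarrow> generator_op x \<phi> \<in> serre_dual A"
  by (cases x) (simp_all add: raise_serre_dual lower_serre_dual)

lemma generator_op_relations:
  assumes "(s, t) \<in> kac_moody_relations A" "\<phi> \<in> serre_dual A"
  shows "lie_eval op generator_op s \<phi> = lie_eval op generator_op t \<phi>"
proof -
  note h = bracket_raise_lower[of _ A]
  have hh: "bracket op (bracket op (raise i) (lower A i)) (bracket op (raise j) (lower A j)) \<phi> =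
      \<zero>\<^bsub>op\<^esub> \<phi>" for i j
    unfolding h by (simp add: fun_eq_iff)
  have ef: "bracket op (raise i) (lower A j) \<phi> = \<zero>\<^bsub>op\<^esub> \<phi>" if "i \<noteq> j" for i j
    by (simp only: op_chevalley.ef[OF that])
  have se: "(bracket op (raise i) ^^ nat (1 - A i j)) (raise j) \<phi> = \<zero>\<^bsub>op\<^esub> \<phi>" if "i \<noteq> j" for i j
  proof -
    have "serre_op A i j (\<lambda>w. \<phi> ([] @ w)) = (\<lambda>_. 0)"
      using assms(2) that unfolding serre_dual_def by blast
    then show ?thesis
      by (simp add: serre_op_eq del: op_lie_simps(4))
  qed
  have sf: "(bracket op (lower A i) ^^ nat (1 - A i j)) (lower A j) \<phi> = \<zero>\<^bsub>op\<^esub> \<phi>" if "i \<noteq> j" for i j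
    using serre_lower_vanish[OF that] by (simp add: fun_eq_iff del: op_lie_simps(4))
  show ?thesis
    using assms(1) unfolding kac_moody_relations_def
    by (auto simp only: Un_iff mem_Collect_eq prod.inject lie_eval.simps generator_op_simps
        op.lie_eval_ad_pow hh op_chevalley.he op_chevalley.hf intro: ef se sf)
qed

theorem kac_moody_representation:
  obtains \<Phi> where "\<Phi> \<in> lie_hom (kac_moody A) (op_lie (serre_dual A))"
    "\<And>i. \<Phi> (km_e A i) = op_restrict (serre_dual A) (raise i)"
    "\<And>i. \<Phi> (km_f A i) = op_restrict (serre_dual A) (lower A i)"
proof -
  interpret O: lie_algebra "op_lie (serre_dual A)"
    by (rule serre_dual.lie_algebra_op_lie)
  have "\<exists>\<Phi>\<in>lie_hom (presented_lie (kac_moody_relations A)) (op_lie (serre_dual A)).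
      \<forall>x. \<Phi> (lie_class (kac_moody_relations A) (Gen x)) = op_restrict (serre_dual A) (generator_op x)"
  proof (rule O.presented_lie_universal)
    show "range (\<lambda>x. op_restrict (serre_dual A) (generator_op x)) \<subseteq> carrier (op_lie (serre_dual A))"
      using serre_dual.op_restrict_closed[OF generator_op_closed generator_op_preserves] by blast
  next
    have eval: "lie_eval (op_lie (serre_dual A)) (\<lambda>x. op_restrict (serre_dual A) (generator_op x)) t =
        op_restrict (serre_dual A) (lie_eval op generator_op t)" for t
      by (rule serre_dual.lie_eval_op_restrict[OF generator_op_closed generator_op_preserves])
    fix s t assume "(s, t) \<in> kac_moody_relations A"
    then show "lie_eval (op_lie (serre_dual A)) (\<lambda>x. op_restrict (serre_dual A) (generator_op x)) s =
        lie_eval (op_lie (serre_dual A)) (\<lambda>x. op_restrict (serre_dual A) (generator_op x)) t"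
      unfolding eval op_restrict_def by (auto simp: fun_eq_iff generator_op_relations)
  qed
  then obtain \<Phi> where
    "\<Phi> \<in> lie_hom (presented_lie (kac_moody_relations A)) (op_lie (serre_dual A))"
    "\<forall>x. \<Phi> (lie_class (kac_moody_relations A) (Gen x)) = op_restrict (serre_dual A) (generator_op x)"
    by blast
  then show thesis
    by (intro that[of \<Phi>]) (simp_all add: kac_moody_def km_e_def km_f_def)
qed

end

section \<open>Evaluation of homogeneous terms on functionals\<close>

text \<open>A homogeneous term of degree \<open>d\<close> is a combination of products of
  \<open>d\<close> generators, each of which puts one letter in front of the word.\<close>

lemma lie_eval_raise_local:
  "homog d p \<Longrightarrow> (\<And>v. length v = length w + d \<Longrightarrow> \<phi> v = \<chi> v) \<Longrightarrow>
    lie_eval op raise p \<phi> w = lie_eval op raise p \<chi> w"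
proof (induction arbitrary: \<phi> \<chi> w rule: homog.induct)
  case (Brk m s n t)
  have "lie_eval op raise t (lie_eval op raise s \<phi>) w = lie_eval op raise t (lie_eval op raise s \<chi>) w"
    by (rule Brk.IH(2), rule Brk.IH(1), rule Brk.prems) simp
  moreover have "lie_eval op raise s (lie_eval op raise t \<phi>) w =
      lie_eval op raise s (lie_eval op raise t \<chi>) w"
    by (rule Brk.IH(1), rule Brk.IH(2), rule Brk.prems) simp
  ultimately show ?case
    by (simp only: lie_eval.simps op_lie_simps)
next
  case (Gen x)
  then show ?case by (simp add: raise_def)
next
  case (Zero n)
  show ?case by simp
next
  case (Add n s t)
  show ?case
    using Add.IH(1)[of w \<phi> \<chi>, OF Add.prems] Add.IH(2)[of w \<phi> \<chi>, OF Add.prems] by (simp only: lie_eval.simps op_lie_simps)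
next
  case (Scale n t c)
  show ?case
    using Scale.IH[of w \<phi> \<chi>, OF Scale.prems] by (simp only: lie_eval.simps op_lie_simps)
qed

text \<open>A Lie polynomial has no constant term. This matters because the formula for right-normed
  brackets holds on nonempty words only, while the value at the empty word is wanted.\<close>

lemma lie_eval_raise_nonempty:
  "(\<And>v. v \<noteq> [] \<Longrightarrow> \<phi> v = \<chi> v) \<Longrightarrow> lie_eval op raise p \<phi> w = lie_eval op raise p \<chi> w"
proof (induction p arbitrary: \<phi> \<chi> w)
  case (Brk s t)
  have "lie_eval op raise s \<phi> = lie_eval op raise s \<chi>"
    by (rule ext) (rule Brk.IH(1)[OF Brk.prems])
  moreover have "lie_eval op raise t \<phi> = lie_eval op raise t \<chi>"
    by (rule ext) (rule Brk.IH(2)[OF Brk.prems])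
  ultimately show ?case
    by (simp only: lie_eval.simps op_lie_simps)
next
  case (Gen x)
  then show ?case by (simp add: raise_def)
next
  case Zero
  show ?case by simp
next
  case (Add s t)
  have "lie_eval op raise s \<phi> w = lie_eval op raise s \<chi> w"
    by (rule Add.IH(1), rule Add.prems)
  moreover have "lie_eval op raise t \<phi> w = lie_eval op raise t \<chi> w"
    by (rule Add.IH(2), rule Add.prems)
  ultimately show ?case
    by (simp only: lie_eval.simps op_lie_simps)
next
  case (Scale c t)
  have "lie_eval op raise t \<phi> w = lie_eval op raise t \<chi> w"
    by (rule Scale.IH, rule Scale.prems)
  then show ?case
    by (simp only: lie_eval.simps op_lie_simps)
qed

lemma lie_eval_raise_zero: "lie_eval op raise p (\<lambda>_. 0) = (\<lambda>_. 0)"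
  by (rule all_functions.op_zero) (rule op.lie_eval_closed', rule raise_closed)

definition deformed_op :: "('i \<Rightarrow> 'i \<Rightarrow> int) \<Rightarrow> ('i \<Rightarrow> complex) \<Rightarrow> 'i \<Rightarrow>
    ('i list \<Rightarrow> complex) \<Rightarrow> 'i list \<Rightarrow> complex" where
  "deformed_op A a i \<phi> w = raise i \<phi> w + a i * (weight A i w * \<phi> w) - (a i)\<^sup>2 * lower A i \<phi> w"

text \<open>The leading-term principle. In \<open>deformed_op\<close> only \<open>raise\<close>
  lengthens words, so a product involving some \<open>h_i\<close> or \<open>f_i\<close> reads
  \<open>\<phi>\<close> on words shorter than \<open>length w + d \<le> k\<close>, where it is
  zero.\<close>

lemma lie_eval_deformed_op:
  "homog d p \<Longrightarrow> (\<And>v. length v < k \<Longrightarrow> \<phi> v = 0) \<Longrightarrow> length w + d \<le> k \<Longrightarrow>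
    lie_eval op (deformed_op A a) p \<phi> w = lie_eval op raise p \<phi> w"
proof (induction arbitrary: k \<phi> w rule: homog.induct)
  case (Gen x)
  then show ?case
    using lower_vanish[of w \<phi> A x] by (simp add: deformed_op_def)
next
  case (Brk m s n t)
  \<comment> \<open>Stated for either order of the factors, since a bracket is a difference of two
    compositions. After the inner factor of degree \<open>m\<close> the functional vanishes below
    length \<open>k - m\<close>, the bound passed on to the outer factor.\<close>
  have *: "lie_eval op (deformed_op A a) t (lie_eval op (deformed_op A a) s \<phi>) w =
      lie_eval op raise t (lie_eval op raise s \<phi>) w"
    if s: "homog m s" "\<And>k \<phi> w. (\<And>v. length v < k \<Longrightarrow> \<phi> v = 0) \<Longrightarrow> length w + m \<le> k \<Longrightarrow>
        lie_eval op (deformed_op A a) s \<phi> w = lie_eval op raise s \<phi> w"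
      and t: "homog n t" "\<And>k \<phi> w. (\<And>v. length v < k \<Longrightarrow> \<phi> v = 0) \<Longrightarrow> length w + n \<le> k \<Longrightarrow>
        lie_eval op (deformed_op A a) t \<phi> w = lie_eval op raise t \<phi> w"
      and mn: "length w + m + n \<le> k" for m n s t
  proof -
    have eq: "lie_eval op (deformed_op A a) s \<phi> v = lie_eval op raise s \<phi> v" if "length v + m \<le> k" for v
      using s(2)[of k \<phi> v] Brk.prems(1) that by blast
    have "lie_eval op (deformed_op A a) s \<phi> v = 0" if "length v < k - m" for v
    proof -
      have "lie_eval op raise s \<phi> v = lie_eval op raise s (\<lambda>_. 0) v"
        by (rule lie_eval_raise_local[OF s(1)], rule Brk.prems(1)) (use that in simp)
      then show ?thesis
        using eq[of v] that by (simp add: lie_eval_raise_zero)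
    qed
    then have "lie_eval op (deformed_op A a) t (lie_eval op (deformed_op A a) s \<phi>) w =
        lie_eval op raise t (lie_eval op (deformed_op A a) s \<phi>) w"
      by (rule t(2)[of "k - m"]) (use mn in linarith)+
    also have "\<dots> = lie_eval op raise t (lie_eval op raise s \<phi>) w"
      by (rule lie_eval_raise_local[OF t(1)], rule eq) (use mn in linarith)
    finally show ?thesis .
  qed
  have "lie_eval op (deformed_op A a) t (lie_eval op (deformed_op A a) s \<phi>) w =
      lie_eval op raise t (lie_eval op raise s \<phi>) w"
    by (rule *[OF Brk.hyps(1) Brk.IH(1) Brk.hyps(2) Brk.IH(2)]) (use Brk.prems(2) in simp_all)
  moreover have "lie_eval op (deformed_op A a) s (lie_eval op (deformed_op A a) t \<phi>) w =
      lie_eval op raise s (lie_eval op raise t \<phi>) w"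
    by (rule *[OF Brk.hyps(2) Brk.IH(2) Brk.hyps(1) Brk.IH(1)]) (use Brk.prems(2) in simp_all)
  ultimately show ?case
    by (simp only: lie_eval.simps op_lie_simps)
next
  case (Add n s t)
  show ?case
    using Add.IH(1)[of k \<phi> w, OF Add.prems] Add.IH(2)[of k \<phi> w, OF Add.prems]
    by (simp only: lie_eval.simps op_lie_simps)
next
  case (Scale n t c)
  show ?case
    using Scale.IH[of k \<phi> w, OF Scale.prems] by (simp only: lie_eval.simps op_lie_simps)
next
  case (Zero n)
  show ?case
    by (simp only: lie_eval.simps)
qed

section \<open>Right-normed bracketing of words\<close>

context lie_algebra
begin

text \<open>The map of the Dynkin-Specht-Wever theorem. Since the empty word goes to zero, its
  compatibility with the adjoint action is confined to nonempty words.\<close>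

primrec right_normed :: "('i \<Rightarrow> 'a) \<Rightarrow> 'i list \<Rightarrow> 'a" where
  "right_normed x [] = \<zero>"
| "right_normed x (j # w) = (if w = [] then x j else bracket L (x j) (right_normed x w))"

context
  fixes x :: "'i \<Rightarrow> 'a" assumes x [simp]: "\<And>i. x i \<in> carrier L"
begin

lemma right_normed_closed [simp]: "right_normed x w \<in> carrier L"
  by (induction w) auto

lemma dual_ad: "\<psi> \<in> dual L \<Longrightarrow> y \<in> carrier L \<Longrightarrow> (\<lambda>z. \<psi> (bracket L y z)) \<in> dual L"
  unfolding dual_def[of L, THEN eqset_imp_iff, of "\<lambda>z. \<psi> (bracket L y z)"]
  by (simp add: bracket_add_right bracket_smult_right)

text \<open>Right-normed bracketing turns left multiplication by a Lie polynomial into its adjoint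
  action; for \<open>Brk s t\<close> this is the Jacobi identity.\<close>

lemma lie_eval_right_normed:
  assumes "\<psi> \<in> dual L" "w \<noteq> []"
  shows "lie_eval op raise p (\<lambda>w. \<psi> (right_normed x w)) w =
    \<psi> (bracket L (lie_eval L x p) (right_normed x w))"
  using assms
proof (induction p arbitrary: \<psi> w)
  case (Gen i)
  then show ?case by (simp add: raise_def)
next
  case Zero
  then show ?case by simp
next
  case (Add s t)
  have c: "lie_eval L x s \<in> carrier L" "lie_eval L x t \<in> carrier L"
    by (rule lie_eval_closed', rule x)+
  show ?case
    unfolding lie_eval.simps op_lie_simps Add.IH(1)[OF Add.prems] Add.IH(2)[OF Add.prems]
    using Add.prems c by (simp add: bracket_add_left)
next
  case (Scale c t)
  have c: "lie_eval L x t \<in> carrier L"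
    by (rule lie_eval_closed', rule x)
  show ?case
    unfolding lie_eval.simps op_lie_simps Scale.IH[OF Scale.prems]
    using Scale.prems c by (simp add: bracket_smult_left)
next
  case (Brk s t)
  let ?s = "lie_eval L x s" and ?t = "lie_eval L x t" and ?r = "right_normed x w"
  have c: "?s \<in> carrier L" "?t \<in> carrier L" "?r \<in> carrier L"
    by (rule lie_eval_closed', rule x)+ (rule right_normed_closed)
  have "lie_eval op raise t (lie_eval op raise s (\<lambda>w. \<psi> (right_normed x w))) w =
      lie_eval op raise t (\<lambda>w. \<psi> (bracket L ?s (right_normed x w))) w"
    by (rule lie_eval_raise_nonempty) (rule Brk.IH(1)[OF Brk.prems(1)])
  moreover have "lie_eval op raise t (\<lambda>w. \<psi> (bracket L ?s (right_normed x w))) w =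
      \<psi> (bracket L ?s (bracket L ?t ?r))"
    by (rule Brk.IH(2)[OF dual_ad[OF Brk.prems(1) c(1)] Brk.prems(2)])
  moreover have "lie_eval op raise s (lie_eval op raise t (\<lambda>w. \<psi> (right_normed x w))) w =
      lie_eval op raise s (\<lambda>w. \<psi> (bracket L ?t (right_normed x w))) w"
    by (rule lie_eval_raise_nonempty) (rule Brk.IH(2)[OF Brk.prems(1)])
  moreover have "lie_eval op raise s (\<lambda>w. \<psi> (bracket L ?t (right_normed x w))) w =
      \<psi> (bracket L ?t (bracket L ?s ?r))"
    by (rule Brk.IH(1)[OF dual_ad[OF Brk.prems(1) c(2)] Brk.prems(2)])
  moreover have "\<psi> (bracket L ?s (bracket L ?t ?r)) =
      \<psi> (bracket L (bracket L ?s ?t) ?r) + \<psi> (bracket L ?t (bracket L ?s ?r))"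
    unfolding jacobi_left[OF c] using Brk.prems(1) c by simp
  ultimately show ?case
    by (simp only: lie_eval.simps op_lie_simps) simp
qed

text \<open>
  The factor \<open>d\<close> is the eigenvalue of the degree derivation; here characteristic 0 enters, and this
  replaces the Poincare-Birkhoff-Witt theorem.
\<close>

lemma lie_eval_right_normed_Nil:
  assumes "homog d p" "\<psi> \<in> dual L"
  shows "lie_eval op raise p (\<lambda>w. \<psi> (right_normed x w)) [] = of_nat d * \<psi> (lie_eval L x p)"
  using assms
proof (induction arbitrary: \<psi> rule: homog.induct)
  case (Gen i)
  then show ?case by (simp add: raise_def)
next
  case (Brk m s n t)
  let ?s = "lie_eval L x s" and ?t = "lie_eval L x t"
  have c: "?s \<in> carrier L" "?t \<in> carrier L"
    by (rule lie_eval_closed', rule x)+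
  have "lie_eval op raise t (lie_eval op raise s (\<lambda>w. \<psi> (right_normed x w))) [] =
      lie_eval op raise t (\<lambda>w. \<psi> (bracket L ?s (right_normed x w))) []"
    by (rule lie_eval_raise_nonempty) (rule lie_eval_right_normed[OF Brk.prems])
  moreover have "lie_eval op raise t (\<lambda>w. \<psi> (bracket L ?s (right_normed x w))) [] =
      of_nat n * \<psi> (bracket L ?s ?t)"
    by (rule Brk.IH(2)[OF dual_ad[OF Brk.prems c(1)]])
  moreover have "lie_eval op raise s (lie_eval op raise t (\<lambda>w. \<psi> (right_normed x w))) [] =
      lie_eval op raise s (\<lambda>w. \<psi> (bracket L ?t (right_normed x w))) []"
    by (rule lie_eval_raise_nonempty) (rule lie_eval_right_normed[OF Brk.prems])
  moreover have "lie_eval op raise s (\<lambda>w. \<psi> (bracket L ?t (right_normed x w))) [] =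
      of_nat m * \<psi> (bracket L ?t ?s)"
    by (rule Brk.IH(1)[OF dual_ad[OF Brk.prems c(2)]])
  \<comment> \<open>The two compositions thus give \<open>n * \<psi> [s, t] - m * \<psi> [t, s] = (m
    + n) * \<psi> [s, t]\<close>, the inductive step of the Dynkin-Specht-Wever identity.\<close>
  moreover have "\<psi> (bracket L ?t ?s) = - \<psi> (bracket L ?s ?t)"
    using Brk.prems c by (simp add: bracket_antisym[OF c])
  ultimately show ?case
    by (simp only: lie_eval.simps op_lie_simps) (simp add: algebra_simps)
next
  case (Zero n)
  then show ?case by simp
next
  case (Add n s t)
  have c: "lie_eval L x s \<in> carrier L" "lie_eval L x t \<in> carrier L"
    by (rule lie_eval_closed', rule x)+
  show ?case
    unfolding lie_eval.simps op_lie_simps Add.IH(1)[OF Add.prems] Add.IH(2)[OF Add.prems]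
    using Add.prems c by (simp add: algebra_simps)
next
  case (Scale n t c)
  have c: "lie_eval L x t \<in> carrier L"
    by (rule lie_eval_closed', rule x)+
  show ?case
    unfolding lie_eval.simps op_lie_simps Scale.IH[OF Scale.prems]
    using Scale.prems c by simp
qed

text \<open>The letters of \<open>v\<close> act by \<open>ad\<close> and can be moved into the
  functional, so left factors of the Serre ideal need no separate treatment.\<close>

lemma right_normed_append:
  assumes "\<psi> \<in> dual L"
  shows "\<exists>\<psi>'\<in>dual L. \<forall>w. w \<noteq> [] \<longrightarrow> \<psi> (right_normed x (v @ w)) = \<psi>' (right_normed x w)"
  using assms
proof (induction v arbitrary: \<psi>)
  case Nil
  then show ?case by (intro bexI[of _ \<psi>]) auto
next
  case (Cons j v)
  then show ?case
    using Cons.IH[OF dual_ad[OF Cons.prems x[of j]]] by simp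
qed

text \<open>Cutting off all lengths but \<open>k\<close> makes the functional vanish on shorter
  words, as \<open>lie_eval_deformed_op\<close> requires, and keeps it in \<open>serre_dual\<close>
  because the Serre elements are homogeneous.\<close>

definition truncated :: "('a \<Rightarrow> complex) \<Rightarrow> nat \<Rightarrow> 'i list \<Rightarrow> complex" where
  "truncated \<psi> k w = (if length w = k then \<psi> (right_normed x w) else 0)"

lemma truncated_Nil:
  assumes "homog k p" "\<psi> \<in> dual L"
  shows "lie_eval op raise p (truncated \<psi> k) [] = of_nat k * \<psi> (lie_eval L x p)"
  unfolding lie_eval_right_normed_Nil[OF assms, symmetric]
  by (rule lie_eval_raise_local[OF assms(1)]) (simp add: truncated_def)

text \<open>Under right-normed bracketing a Serre element with right factor \<open>w\<close> becomes
  the bracket of its value in \<open>L\<close> with the image of \<open>w\<close>, or a multiple of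
  that value if \<open>w\<close> is empty. The value is zero by \<open>serre\<close>.\<close>

lemma truncated_serre_dual:
  assumes serre: "\<And>i j. i \<noteq> j \<Longrightarrow> lie_eval L x (serre_term A i j) = \<zero>"
    and \<psi>: "\<psi> \<in> dual L"
  shows "truncated \<psi> k \<in> serre_dual A"
proof -
  have "serre_op A i j (\<lambda>w. truncated \<psi> k (v @ w)) w = 0" if ij: "i \<noteq> j" for i j v w
  proof -
    let ?n = "nat (1 - A i j)"
    have hom: "homog (Suc ?n) (serre_term A i j)"
      unfolding serre_term_def by (rule homog_ad_pow)
    show ?thesis
    proof (cases "length v + length w + Suc ?n = k")
      case False
      have "serre_op A i j (\<lambda>w. truncated \<psi> k (v @ w)) w = serre_op A i j (\<lambda>_. 0) w"
        by (rule lie_eval_raise_local[OF hom]) (use False in \<open>auto simp: truncated_def\<close>)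
      then show ?thesis
        by (simp add: lie_eval_raise_zero)
    next
      case True
      obtain \<psi>' where \<psi>': "\<psi>' \<in> dual L"
        "\<And>w. w \<noteq> [] \<Longrightarrow> \<psi> (right_normed x (v @ w)) = \<psi>' (right_normed x w)"
        using right_normed_append[OF \<psi>, of v] by blast
      have "serre_op A i j (\<lambda>w. truncated \<psi> k (v @ w)) w = serre_op A i j (\<lambda>w. \<psi>' (right_normed x w)) w"
      proof (rule lie_eval_raise_local[OF hom])
        fix u :: "'i list" assume u: "length u = length w + Suc ?n"
        then have "u \<noteq> []" by auto
        with u True show "truncated \<psi> k (v @ u) = \<psi>' (right_normed x u)"
          by (simp add: truncated_def \<psi>'(2))
      qed
      also have "\<dots> = 0"
      proof (cases "w = []")
        case True
        then show ?thesis
          using lie_eval_right_normed_Nil[OF hom \<psi>'(1)] \<psi>'(1) by (simp add: serre[OF ij])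
      next
        case False
        then show ?thesis
          using lie_eval_right_normed[OF \<psi>'(1)] \<psi>'(1) by (simp add: serre[OF ij])
      qed
      finally show ?thesis .
    qed
  qed
  then show ?thesis
    by (auto simp: serre_dual_def)
qed

end

end

section \<open>Comparison with the associated graded Lie algebra\<close>

context lie_algebra
begin

text \<open>Polynomials in \<open>c\<close> with coefficients in \<open>L\<close>, represented by
  their values. As the field is infinite, the values determine the coefficients.\<close>

inductive_set poly_maps :: "(nat \<Rightarrow> 'a set) \<Rightarrow> (complex \<Rightarrow> 'a) set" for G :: "nat \<Rightarrow> 'a set" where
  monomial: "x \<in> G m \<Longrightarrow> (\<lambda>c. c ^ m \<odot> x) \<in> poly_maps G"
| add: "\<delta> \<in> poly_maps G \<Longrightarrow> \<epsilon> \<in> poly_maps G \<Longrightarrow> (\<lambda>c. \<delta> c \<oplus> \<epsilon> c) \<in> poly_maps G"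

lemma poly_maps_closed:
  assumes "\<And>m. G m \<subseteq> carrier L" "\<delta> \<in> poly_maps G"
  shows "\<delta> c \<in> carrier L"
  using assms(2)
proof induction
  case (monomial x m)
  then show ?case using assms(1)[of m] by auto
qed simp

lemma poly_maps_zero:
  assumes "\<zero> \<in> G 0" shows "(\<lambda>_. \<zero>) \<in> poly_maps G"
  using poly_maps.monomial[of \<zero> G 0] assms by simp

lemma poly_maps_smult:
  assumes G: "\<And>m. submodule (G m) complex_field L" and \<delta>: "\<delta> \<in> poly_maps G"
  shows "(\<lambda>c. b \<odot> \<delta> c) \<in> poly_maps G"
  using \<delta>
proof induction
  case (monomial x m)
  have "(\<lambda>c. b \<odot> (c ^ m \<odot> x)) = (\<lambda>c. c ^ m \<odot> (b \<odot> x))"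
    using submodule_in_carrier[OF G monomial] by (simp add: smult_smult mult.commute)
  then show ?case
    using poly_maps.monomial[of "b \<odot> x" G m] submodule_smult[OF G monomial] by simp
next
  case (add \<delta> \<epsilon>)
  have GC: "G m \<subseteq> carrier L" for m
    using G by (simp add: submodule_iff)
  have "(\<lambda>c. b \<odot> (\<delta> c \<oplus> \<epsilon> c)) = (\<lambda>c. b \<odot> \<delta> c \<oplus> b \<odot> \<epsilon> c)"
    using poly_maps_closed[OF GC] add.hyps by (simp add: smult_add_right)
  then show ?case
    using poly_maps.add[OF add.IH] by simp
qed

lemma poly_maps_bracket:
  assumes G: "\<And>m. G m \<subseteq> carrier L" and H: "\<And>m. H m \<subseteq> carrier L"
    and GH: "\<And>m n x y. x \<in> G m \<Longrightarrow> y \<in> H n \<Longrightarrow> bracket L x y \<in> K (m + n)"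
    and \<delta>: "\<delta> \<in> poly_maps G" and \<epsilon>: "\<epsilon> \<in> poly_maps H"
  shows "(\<lambda>c. bracket L (\<delta> c) (\<epsilon> c)) \<in> poly_maps K"
  using \<delta>
proof induction
  case (monomial x m)
  have x: "x \<in> carrier L" using monomial G by blast
  show ?case
    using \<epsilon>
  proof induction
    case (monomial y n)
    have y: "y \<in> carrier L" using monomial H by blast
    have "(\<lambda>c. bracket L (c ^ m \<odot> x) (c ^ n \<odot> y)) = (\<lambda>c. c ^ (m + n) \<odot> bracket L x y)"
      using x y by (simp add: bracket_smult_left bracket_smult_right smult_smult power_add mult.commute)
    then show ?case
      using poly_maps.monomial[of "bracket L x y" K "m + n", OF GH[OF \<open>x \<in> G m\<close> monomial]] by simp
  next
    case (add \<delta> \<epsilon>)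
    have "(\<lambda>c. bracket L (c ^ m \<odot> x) (\<delta> c \<oplus> \<epsilon> c)) =
        (\<lambda>c. bracket L (c ^ m \<odot> x) (\<delta> c) \<oplus> bracket L (c ^ m \<odot> x) (\<epsilon> c))"
      using x poly_maps_closed[OF H] add.hyps by (simp add: bracket_add_right)
    then show ?case
      using poly_maps.add[OF add.IH] by simp
  qed
next
  case (add \<delta> \<delta>')
  have "(\<lambda>c. bracket L (\<delta> c \<oplus> \<delta>' c) (\<epsilon> c)) =
      (\<lambda>c. bracket L (\<delta> c) (\<epsilon> c) \<oplus> bracket L (\<delta>' c) (\<epsilon> c))"
    using poly_maps_closed[OF G] poly_maps_closed[OF H] add.hyps \<epsilon> by (simp add: bracket_add_left)
  then show ?case
    using poly_maps.add[OF add.IH] by simp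
qed

lemma poly_maps_dual:
  assumes G: "\<And>m. G m \<subseteq> carrier L" and \<psi>: "\<psi> \<in> dual L" "\<And>x. x \<in> G k \<Longrightarrow> \<psi> x = 0"
    and \<delta>: "\<delta> \<in> poly_maps G"
  shows "\<exists>q. (\<forall>c. \<psi> (\<delta> c) = poly q c) \<and> poly.coeff q k = 0"
  using \<delta>
proof induction
  case (monomial x m)
  have x: "x \<in> carrier L" using monomial G by blast
  show ?case
    using \<psi> x monomial
    by (intro exI[of _ "Polynomial.monom (\<psi> x) m"]) (auto simp: poly_monom mult.commute)
next
  case (add \<delta> \<epsilon>)
  from add.IH obtain q r where "\<And>c. \<psi> (\<delta> c) = poly q c" "poly.coeff q k = 0"
    "\<And>c. \<psi> (\<epsilon> c) = poly r c" "poly.coeff r k = 0"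
    by blast
  then show ?case
    using \<psi>(1) poly_maps_closed[OF G] add.hyps by (intro exI[of _ "q + r"]) simp
qed

text \<open>Otherwise a functional that vanishes on \<open>G k\<close> and is 1 at \<open>x\<close>
  would turn \<open>eq\<close> into an identity of complex polynomials whose coefficients at
  \<open>c ^ k\<close> are 1 and 0.\<close>

lemma poly_maps_coefficient:
  assumes G: "\<And>m. submodule (G m) complex_field L" and x: "x \<in> carrier L"
    and \<delta>: "\<delta> \<in> poly_maps G" and eq: "\<And>c. c ^ k \<odot> x = \<delta> c"
  shows "x \<in> G k"
proof (rule ccontr)
  assume "x \<notin> G k"
  with G x obtain \<psi> where \<psi>: "\<psi> \<in> dual L" "\<And>y. y \<in> G k \<Longrightarrow> \<psi> y = 0" "\<psi> x = 1"
    using separating_functional by metis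
  have GC: "G m \<subseteq> carrier L" for m
    using G by (simp add: submodule_iff)
  obtain q where q: "\<And>c. \<psi> (\<delta> c) = poly q c" "poly.coeff q k = 0"
    using poly_maps_dual[OF GC \<psi>(1,2) \<delta>] by blast
  have "poly (Polynomial.monom 1 k) c = poly q c" for c
    using \<psi>(1,3) x q(1)[of c] by (simp add: eq[symmetric] poly_monom)
  then have "Polynomial.monom 1 k = q"
    by (simp add: poly_eq_poly_eq_iff[symmetric] fun_eq_iff)
  then show False
    using q(2) by auto
qed

context
  fixes u :: "'x \<Rightarrow> 'a" assumes u: "\<And>i. u i \<in> carrier L"
begin

abbreviation filtration :: "nat \<Rightarrow> 'a set" where
  "filtration \<equiv> natural_filtration L (range u)"

lemma range_u: "range u \<subseteq> carrier L"
  using u by auto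

lemma filtration_subset: "filtration m \<subseteq> carrier L"
  using natural_filtration_closed[OF range_u] by auto

abbreviation scaled_eval :: "complex \<Rightarrow> 'x lie_term \<Rightarrow> 'a" where
  "scaled_eval c \<equiv> lie_eval L (\<lambda>i. c \<odot> u i)"

lemma scaled_u: "c \<odot> u i \<in> carrier L"
  using u by simp

lemma scaled_eval_homog: "homog d p \<Longrightarrow> scaled_eval c p = c ^ d \<odot> lie_eval L u p"
proof (induction rule: homog.induct)
  case (Brk m s n t)
  have "lie_eval L u s \<in> carrier L" "lie_eval L u t \<in> carrier L"
    by (rule lie_eval_closed', rule u)+
  then show ?case
    by (simp add: Brk bracket_smult_left bracket_smult_right smult_smult power_add mult.commute)
next
  case (Add n s t)
  have "lie_eval L u s \<in> carrier L" "lie_eval L u t \<in> carrier L"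
    by (rule lie_eval_closed', rule u)+
  then show ?case
    by (simp add: Add smult_add_right)
next
  case (Scale n t c)
  have "lie_eval L u t \<in> carrier L"
    by (rule lie_eval_closed', rule u)
  then show ?case
    by (simp add: Scale smult_smult mult.commute)
qed (simp_all add: u)

text \<open>\<open>t\<close> may be inhomogeneous; the powers of \<open>c\<close> keep the degrees
  of its parts apart.\<close>

lemma scaled_eval_poly: "(\<lambda>c. scaled_eval c t) \<in> poly_maps filtration"
proof (induction t)
  case (Gen i)
  have "u i \<in> filtration 1"
    using iterated_brackets_filtration[OF range_u iterated_brackets.generator, of "u i"] by simp
  then show ?case
    using poly_maps.monomial[of "u i" filtration 1] by simp
next
  case Zero
  show ?case
    using poly_maps_zero[of filtration] natural_filtration_zero[OF range_u] by simp
next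
  case (Add s t)
  then show ?case
    using poly_maps.add by simp
next
  case (Scale c t)
  then show ?case
    using poly_maps_smult[OF submodule_natural_filtration[OF range_u]] by simp
next
  case (Brk s t)
  then show ?case
    using poly_maps_bracket[where G = filtration and H = filtration and K = filtration,
        OF filtration_subset filtration_subset natural_filtration_bracket[OF range_u]] by simp
qed

text \<open>The subtraction is truncated: at \<open>m = 0\<close> this is
  \<open>filtration 0\<close>, which is zero, so the bracket rule holds there too.\<close>

abbreviation lower_filtration :: "nat \<Rightarrow> 'a set" where
  "lower_filtration m \<equiv> filtration (m - 1)"

lemma lower_filtration_bracket_right:
  assumes "x \<in> filtration m" "y \<in> lower_filtration n"
  shows "bracket L x y \<in> lower_filtration (m + n)"
proof (cases n)
  case 0
  then have "y = \<zero>"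
    using assms(2) natural_filtration_0[OF range_u] by simp
  then show ?thesis
    using natural_filtration_closed[OF range_u assms(1)] natural_filtration_zero[OF range_u] by simp
next
  case (Suc k)
  then show ?thesis
    using natural_filtration_bracket[OF range_u assms] by simp
qed

lemma lower_filtration_bracket_left:
  assumes "x \<in> lower_filtration m" "y \<in> filtration n"
  shows "bracket L x y \<in> lower_filtration (m + n)"
proof -
  have "bracket L x y = (-1) \<odot> bracket L y x"
    by (rule bracket_antisym) (use assms natural_filtration_closed[OF range_u] in auto)
  then show ?thesis
    using natural_filtration_smult[OF range_u lower_filtration_bracket_right[OF assms(2,1)]]
    by (simp add: add.commute)
qed

lemma lower_filtration_witness:
  "\<delta> \<in> poly_maps lower_filtration \<Longrightarrow> (\<And>c. scaled_eval c s = scaled_eval c t \<oplus> \<delta> c) \<Longrightarrow>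
    \<exists>\<delta>\<in>poly_maps lower_filtration. \<forall>c. scaled_eval c s = scaled_eval c t \<oplus> \<delta> c"
  by blast

text \<open>
  With \<open>c\<close> as a formal variable, \<open>poly_maps filtration\<close> is the Rees algebra and
  \<open>poly_maps lower_filtration\<close> its ideal generated by \<open>c\<close>; the quotient is the associated graded.
\<close>

lemma scaled_eval_cong:
  assumes R: "\<And>s t. (s, t) \<in> R \<Longrightarrow>
      \<exists>\<delta>\<in>poly_maps lower_filtration. \<forall>c. scaled_eval c s = scaled_eval c t \<oplus> \<delta> c"
    and st: "(s, t) \<in> lie_cong R"
  shows "\<exists>\<delta>\<in>poly_maps lower_filtration. \<forall>c. scaled_eval c s = scaled_eval c t \<oplus> \<delta> c"
proof -
  have cl: "scaled_eval c t \<in> carrier L" for c t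
    by (rule lie_eval_closed', rule scaled_u)
  have \<delta>C: "\<delta> c \<in> carrier L" if "\<delta> \<in> poly_maps lower_filtration" for \<delta> c
    by (rule poly_maps_closed[OF filtration_subset that])
  have zero: "(\<lambda>_. \<zero>) \<in> poly_maps lower_filtration"
    by (rule poly_maps_zero) (rule natural_filtration_zero[OF range_u])
  \<comment> \<open>Identities valid in every Lie algebra survive evaluation, so the axiom rules of
    the congruence have error zero.\<close>
  have exact: "\<exists>\<delta>\<in>poly_maps lower_filtration. \<forall>c. scaled_eval c s = scaled_eval c t \<oplus> \<delta> c"
    if "(s, t) \<in> lie_cong {}" for s t
  proof (rule bexI[OF _ zero], rule allI)
    fix c
    have "scaled_eval c s = scaled_eval c t"
      by (rule lie_eval_cong[OF _ _ that]) (use scaled_u in auto)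
    then show "scaled_eval c s = scaled_eval c t \<oplus> \<zero>"
      using cl by simp
  qed
  show ?thesis
    using st
  proof induction
    case (relation s t)
    then show ?case by (rule R)
  next
    case (refl t)
    show ?case
      by (rule exact) (rule lie_cong.refl)
  next
    case (sym s t)
    then obtain \<delta> where \<delta>: "\<delta> \<in> poly_maps lower_filtration"
      "\<And>c. scaled_eval c s = scaled_eval c t \<oplus> \<delta> c" by blast
    have eq: "scaled_eval c t = scaled_eval c s \<oplus> (-1) \<odot> \<delta> c" for c
      by (rule eq_by_dual) (use \<delta>C[OF \<delta>(1)] cl in \<open>auto simp: \<delta>(2)\<close>)
    show ?case
      by (rule lower_filtration_witness[OF
          poly_maps_smult[OF submodule_natural_filtration[OF range_u] \<delta>(1)] eq])
  next
    case (trans s t w)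
    then obtain \<delta> \<epsilon> where \<delta>: "\<delta> \<in> poly_maps lower_filtration"
      "\<And>c. scaled_eval c s = scaled_eval c t \<oplus> \<delta> c" "\<epsilon> \<in> poly_maps lower_filtration"
      "\<And>c. scaled_eval c t = scaled_eval c w \<oplus> \<epsilon> c" by blast
    have eq: "scaled_eval c s = scaled_eval c w \<oplus> (\<delta> c \<oplus> \<epsilon> c)" for c
      by (rule eq_by_dual) (use \<delta>C[OF \<delta>(1)] \<delta>C[OF \<delta>(3)] cl in \<open>auto simp: \<delta>(2,4)\<close>)
    show ?case
      by (rule lower_filtration_witness[OF poly_maps.add[OF \<delta>(1,3)] eq])
  next
    case (cong_Add s s' t t')
    then obtain \<delta> \<epsilon> where \<delta>: "\<delta> \<in> poly_maps lower_filtration"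
      "\<And>c. scaled_eval c s = scaled_eval c s' \<oplus> \<delta> c" "\<epsilon> \<in> poly_maps lower_filtration"
      "\<And>c. scaled_eval c t = scaled_eval c t' \<oplus> \<epsilon> c" by blast
    have eq: "scaled_eval c (Add s t) = scaled_eval c (Add s' t') \<oplus> (\<delta> c \<oplus> \<epsilon> c)" for c
      by (rule eq_by_dual) (use \<delta>C[OF \<delta>(1)] \<delta>C[OF \<delta>(3)] cl in \<open>auto simp: \<delta>(2,4)\<close>)
    show ?case
      by (rule lower_filtration_witness[OF poly_maps.add[OF \<delta>(1,3)] eq])
  next
    case (cong_Scale t t' b)
    then obtain \<delta> where \<delta>: "\<delta> \<in> poly_maps lower_filtration"
      "\<And>c. scaled_eval c t = scaled_eval c t' \<oplus> \<delta> c" by blast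
    have eq: "scaled_eval c (Scale b t) = scaled_eval c (Scale b t') \<oplus> b \<odot> \<delta> c" for c
      using \<delta>C[OF \<delta>(1)] cl by (simp add: \<delta>(2) smult_add_right)
    show ?case
      by (rule lower_filtration_witness[OF
          poly_maps_smult[OF submodule_natural_filtration[OF range_u] \<delta>(1)] eq])
  next
    case (cong_Brk s s' t t')
    then obtain \<delta> \<epsilon> where \<delta>: "\<delta> \<in> poly_maps lower_filtration"
      "\<And>c. scaled_eval c s = scaled_eval c s' \<oplus> \<delta> c" "\<epsilon> \<in> poly_maps lower_filtration"
      "\<And>c. scaled_eval c t = scaled_eval c t' \<oplus> \<epsilon> c" by blast
    \<comment> \<open>The difference of \<open>[s, t]\<close> and \<open>[s', t']\<close> telescopes
      into two brackets, each with one factor in the ideal.\<close>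
    let ?\<delta> = "\<lambda>c. bracket L (\<delta> c) (scaled_eval c t) \<oplus> bracket L (scaled_eval c s') (\<epsilon> c)"
    have eq: "scaled_eval c (Brk s t) = scaled_eval c (Brk s' t') \<oplus> ?\<delta> c" for c
      by (rule eq_by_dual) (use \<delta>C[OF \<delta>(1)] \<delta>C[OF \<delta>(3)] cl in
          \<open>auto simp: \<delta>(2,4) bracket_add_left bracket_add_right\<close>)
    have mem: "?\<delta> \<in> poly_maps lower_filtration"
    proof (rule poly_maps.add)
      show "(\<lambda>c. bracket L (\<delta> c) (scaled_eval c t)) \<in> poly_maps lower_filtration"
        by (rule poly_maps_bracket[where G = lower_filtration and H = filtration])
          (simp_all only: filtration_subset lower_filtration_bracket_left \<delta>(1) scaled_eval_poly)
      show "(\<lambda>c. bracket L (scaled_eval c s') (\<epsilon> c)) \<in> poly_maps lower_filtration"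
        by (rule poly_maps_bracket[where G = filtration and H = lower_filtration])
          (simp_all only: filtration_subset lower_filtration_bracket_right \<delta>(3) scaled_eval_poly)
    qed
    show ?case
      by (rule lower_filtration_witness[OF mem eq])
  qed (rule exact, rule lie_cong.add_assoc lie_cong.add_commute lie_cong.add_zero
      lie_cong.add_inverse lie_cong.scale_left lie_cong.scale_right lie_cong.scale_assoc
      lie_cong.scale_one lie_cong.brk_add_left lie_cong.brk_add_right lie_cong.brk_scale_left
      lie_cong.brk_scale_right lie_cong.brk_self lie_cong.brk_jacobi)+
qed

text \<open>Each Serre relation holds in \<open>L\<close> up to lower degree, hence so does each
  consequence of them, by \<open>scaled_eval_cong\<close>. Intermediate terms may mix degrees; the
  coefficient of \<open>c ^ k\<close> isolates what concerns \<open>p\<close>.\<close>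

lemma homog_relation_filtration:
  assumes gcm: "generalized_cartan_matrix A"
    and rel: "\<And>s t. (s, t) \<in> deformed_serre_relations A a \<Longrightarrow> lie_eval L u s = lie_eval L u t"
    and p: "homog k p" "(p, Zero) \<in> lie_cong (deformed_serre_relations A (\<lambda>_. 0))"
  shows "lie_eval L u p \<in> filtration (k - 1)"
proof -
  have "\<exists>\<delta>\<in>poly_maps lower_filtration. \<forall>c. scaled_eval c s = scaled_eval c t \<oplus> \<delta> c"
    if st_rel: "(s, t) \<in> deformed_serre_relations A (\<lambda>_. 0)" for s t
  proof -
    obtain i j where ij: "i \<noteq> j" and st: "s = serre_term A i j" "t = Scale 0 (Gen i)"
      using st_rel by (auto simp: deformed_serre_relations_def serre_term_def)
    let ?n = "nat (1 - A i j)"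
    obtain b where b: "lie_eval L u (serre_term A i j) = b \<odot> u i"
      using rel[of "serre_term A i j"] ij
      by (force simp: deformed_serre_relations_def serre_term_def)
    have "A i j \<le> 0"
      using gcm ij by (simp add: generalized_cartan_matrix_def)
    \<comment> \<open>The correction \<open>b \<odot> u i\<close> has degree 1, strictly below the
      degree \<open>?n + 1\<close> of the Serre element.\<close>
    then have n: "1 \<le> ?n" by simp
    have hom: "homog (Suc ?n) s"
      unfolding st serre_term_def by (rule homog_ad_pow)
    have "u i \<in> filtration ?n"
      by (rule iterated_brackets_filtration[OF range_u iterated_brackets.generator n]) simp
    then have "b \<odot> u i \<in> lower_filtration (Suc ?n)"
      using natural_filtration_smult[OF range_u] by simp
    then have mem: "(\<lambda>c. c ^ Suc ?n \<odot> (b \<odot> u i)) \<in> poly_maps lower_filtration"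
      by (rule poly_maps.monomial)
    have eq: "scaled_eval c s = scaled_eval c t \<oplus> c ^ Suc ?n \<odot> (b \<odot> u i)" for c
      using scaled_eval_homog[OF hom] u by (simp add: st b)
    show ?thesis
      by (rule lower_filtration_witness[OF mem eq])
  qed
  from scaled_eval_cong[OF this p(2)] obtain \<delta> where \<delta>: "\<delta> \<in> poly_maps lower_filtration"
    "\<And>c. scaled_eval c p = scaled_eval c Zero \<oplus> \<delta> c"
    by blast
  have \<delta>C: "\<delta> c \<in> carrier L" for c
    by (rule poly_maps_closed[OF filtration_subset \<delta>(1)])
  have eq: "c ^ k \<odot> lie_eval L u p = \<delta> c" for c
    using \<delta>(2)[of c] scaled_eval_homog[OF p(1)] \<delta>C by simp
  show ?thesis
    by (rule poly_maps_coefficient[OF submodule_natural_filtration[OF range_u] _ \<delta>(1) eq])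
      (rule lie_eval_closed', rule u)
qed

lemma hull_eq_range_lie_eval: "(\<lambda>H. lie_subalgebra H L) hull (range u) = range (lie_eval L u)"
proof
  have cl: "lie_eval L u t \<in> carrier L" for t
    by (rule lie_eval_closed', rule u)
  show "(\<lambda>H. lie_subalgebra H L) hull (range u) \<subseteq> range (lie_eval L u)"
  proof (rule hull_minimal)
    have "u i = lie_eval L u (Gen i)" for i by simp
    then show "range u \<subseteq> range (lie_eval L u)" by blast
    show "lie_subalgebra (range (lie_eval L u)) L"
      unfolding lie_subalgebra_def submodule_iff
    proof (intro conjI ballI allI)
      show "\<zero> \<in> range (lie_eval L u)"
        by (rule range_eqI[of _ _ Zero]) simp
    next
      fix x y assume "x \<in> range (lie_eval L u)" "y \<in> range (lie_eval L u)"
      then obtain s t where st: "x = lie_eval L u s" "y = lie_eval L u t" by blast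
      show "x \<oplus> y \<in> range (lie_eval L u)"
        by (rule range_eqI[of _ _ "Add s t"]) (simp add: st)
      show "bracket L x y \<in> range (lie_eval L u)"
        by (rule range_eqI[of _ _ "Brk s t"]) (simp add: st)
    next
      fix c x assume "x \<in> range (lie_eval L u)"
      then obtain t where t: "x = lie_eval L u t" by blast
      show "c \<odot> x \<in> range (lie_eval L u)"
        by (rule range_eqI[of _ _ "Scale c t"]) (simp add: t)
    qed (use cl in auto)
  qed
  have H: "lie_subalgebra ((\<lambda>H. lie_subalgebra H L) hull (range u)) L"
    by (rule lie_subalgebra_hull[OF range_u])
  have "lie_eval L u t \<in> (\<lambda>H. lie_subalgebra H L) hull (range u)" for t
  proof (induction t)
    case (Gen i)
    show ?case by (simp add: hull_inc)
  qed (use H in \<open>simp_all add: lie_subalgebra_def submodule_iff\<close>)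
  then show "range (lie_eval L u) \<subseteq> (\<lambda>H. lie_subalgebra H L) hull (range u)"
    by blast
qed

end

end

lemma lie_hom_zero:
  assumes "lie_algebra L" "lie_algebra M" "\<phi> \<in> lie_hom L M"
  shows "\<phi> \<zero>\<^bsub>L\<^esub> = \<zero>\<^bsub>M\<^esub>"
proof -
  interpret L: lie_algebra L by fact
  interpret M: lie_algebra M by fact
  have "\<phi> (0 \<odot>\<^bsub>L\<^esub> \<zero>\<^bsub>L\<^esub>) = 0 \<odot>\<^bsub>M\<^esub> \<phi> \<zero>\<^bsub>L\<^esub>" "\<phi> \<zero>\<^bsub>L\<^esub> \<in> carrier M"
    using assms(3) L.M.zero_closed unfolding lie_hom_def linear_hom_def by blast+
  then show ?thesis by simp
qed

lemma lie_hom_lie_eval: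
  assumes "lie_algebra L" "lie_algebra M" "\<phi> \<in> lie_hom L M" and u: "\<And>i. u i \<in> carrier L"
  shows "\<phi> (lie_eval L u t) = lie_eval M (\<lambda>i. \<phi> (u i)) t"
proof -
  interpret L: lie_algebra L by fact
  have cl: "lie_eval L u t \<in> carrier L" for t
    by (rule L.lie_eval_closed', rule u)
  have hom: "\<phi> (x \<oplus>\<^bsub>L\<^esub> y) = \<phi> x \<oplus>\<^bsub>M\<^esub> \<phi> y" "\<phi> (c \<odot>\<^bsub>L\<^esub> x) = c \<odot>\<^bsub>M\<^esub> \<phi> x"
    "\<phi> (bracket L x y) = bracket M (\<phi> x) (\<phi> y)"
    if "x \<in> carrier L" "y \<in> carrier L" for x y c
    using assms(3) that by (simp_all add: lie_hom_def linear_hom_def)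
  show ?thesis
    by (induction t) (simp_all add: hom[OF cl cl] hom(2)[OF cl cl] lie_hom_zero[OF assms(1-3)])
qed

lemma lie_eval_presented:
  "lie_eval (presented_lie R) (\<lambda>x. lie_class R (Gen x)) t = lie_class R t"
  by (induction t) (simp_all add: presented_lie_simps)

section \<open>The deformed subalgebras\<close>

lemma presented_lie_relation:
  "(s, t) \<in> R \<Longrightarrow> lie_eval (presented_lie R) (\<lambda>x. lie_class R (Gen x)) s =
    lie_eval (presented_lie R) (\<lambda>x. lie_class R (Gen x)) t"
  by (simp add: lie_eval_presented lie_class_eq_iff lie_cong.relation)

lemma lie_algebra_kac_moody: "lie_algebra (kac_moody A)"
  unfolding kac_moody_def by (rule lie_algebra_presented_lie)

lemma km_e_closed: "km_e A i \<in> carrier (kac_moody A)"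
  and km_f_closed: "km_f A i \<in> carrier (kac_moody A)"
  by (simp_all add: kac_moody_def km_e_def km_f_def lie_class_in_carrier)

lemma kac_moody_relation:
  assumes "(s, t) \<in> kac_moody_relations A"
  shows "lie_eval (kac_moody A) (\<lambda>x. lie_class (kac_moody_relations A) (Gen x)) s =
    lie_eval (kac_moody A) (\<lambda>x. lie_class (kac_moody_relations A) (Gen x)) t"
  unfolding kac_moody_def by (rule presented_lie_relation[OF assms])

lemma kac_moody_like_kac_moody:
  assumes "generalized_cartan_matrix A"
  shows "kac_moody_like (kac_moody A) A (km_e A) (km_f A)"
proof -
  interpret g: lie_algebra "kac_moody A"
    by (rule lie_algebra_kac_moody)
  note rel = kac_moody_relation[of _ _ A, unfolded kac_moody_relations_def[THEN eqset_imp_iff]]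
  let ?ev = "lie_eval (kac_moody A) (\<lambda>x. lie_class (kac_moody_relations A) (Gen x))"
  have gen: "?ev (te i) = km_e A i" "?ev (tf i) = km_f A i" for i
    by (simp_all add: km_e_def km_f_def)
  note ev = lie_eval.simps(2-5) gen g.lie_eval_ad_pow
  show ?thesis
  proof
    fix i j :: 'a
    have "?ev (Brk (th i) (th j)) = ?ev Zero"
      by (rule rel) blast
    then show "bracket (kac_moody A) (bracket (kac_moody A) (km_e A i) (km_f A i))
        (bracket (kac_moody A) (km_e A j) (km_f A j)) = \<zero>\<^bsub>kac_moody A\<^esub>"
      by (simp only: ev)
    have "?ev (Brk (th i) (te j)) = ?ev (Scale (of_int (A i j)) (te j))"
      by (rule rel) blast
    then show "bracket (kac_moody A) (bracket (kac_moody A) (km_e A i) (km_f A i)) (km_e A j) =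
        of_int (A i j) \<odot>\<^bsub>kac_moody A\<^esub> km_e A j"
      by (simp only: ev)
    have "?ev (Brk (th i) (tf j)) = ?ev (Scale (- of_int (A i j)) (tf j))"
      by (rule rel) blast
    then show "bracket (kac_moody A) (bracket (kac_moody A) (km_e A i) (km_f A i)) (km_f A j) =
        (- of_int (A i j)) \<odot>\<^bsub>kac_moody A\<^esub> km_f A j"
      by (simp only: ev)
    assume ij: "i \<noteq> j"
    have "?ev (Brk (te i) (tf j)) = ?ev Zero"
      by (rule rel) (use ij in blast)
    then show "bracket (kac_moody A) (km_e A i) (km_f A j) = \<zero>\<^bsub>kac_moody A\<^esub>"
      by (simp only: ev)
    have "?ev ((Brk (te i) ^^ nat (1 - A i j)) (te j)) = ?ev Zero"
      by (rule rel) (use ij in blast)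
    then show "(bracket (kac_moody A) (km_e A i) ^^ nat (1 - A i j)) (km_e A j) = \<zero>\<^bsub>kac_moody A\<^esub>"
      by (simp only: ev)
    have "?ev ((Brk (tf i) ^^ nat (1 - A i j)) (tf j)) = ?ev Zero"
      by (rule rel) (use ij in blast)
    then show "(bracket (kac_moody A) (km_f A i) ^^ nat (1 - A i j)) (km_f A j) = \<zero>\<^bsub>kac_moody A\<^esub>"
      by (simp only: ev)
  qed (simp_all add: assms km_e_closed km_f_closed)
qed

text \<open>\<open>\<Phi>\<close> is the transposed Verma module, restricted to the functionals that vanish on the Serre ideal.\<close>

locale kac_moody_module = cartan_matrix A for A :: "'i \<Rightarrow> 'i \<Rightarrow> int" +
  fixes \<Phi> :: "'i chevalley lie_term set \<Rightarrow> ('i list \<Rightarrow> complex) \<Rightarrow> 'i list \<Rightarrow> complex"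
  assumes hom: "\<Phi> \<in> lie_hom (kac_moody A) (op_lie (serre_dual A))"
    and \<Phi>_e: "\<Phi> (km_e A i) = op_restrict (serre_dual A) (raise i)"
    and \<Phi>_f: "\<Phi> (km_f A i) = op_restrict (serre_dual A) (lower A i)"
begin

abbreviation "g \<equiv> kac_moody A"

sublocale g: kac_moody_like "kac_moody A" A "km_e A" "km_f A"
  by (rule kac_moody_like_kac_moody[OF gcm])

lemma km_u_eq:
  "km_u A a i = km_e A i \<oplus>\<^bsub>g\<^esub> a i \<odot>\<^bsub>g\<^esub> g.h i \<oplus>\<^bsub>g\<^esub> (- (a i)\<^sup>2) \<odot>\<^bsub>g\<^esub> km_f A i"
  by (simp add: km_u_def g.minus_eq_smult g.smult_smult)

lemma km_u_closed: "km_u A a i \<in> carrier g"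
  by (simp add: km_u_eq)

lemma km_u_zero: "km_u A (\<lambda>_. 0) = km_e A"
  by (rule ext) (simp add: km_u_eq)

lemma \<Phi>_add: "x \<in> carrier g \<Longrightarrow> y \<in> carrier g \<Longrightarrow> \<Phi> (x \<oplus>\<^bsub>g\<^esub> y) \<phi> w = \<Phi> x \<phi> w + \<Phi> y \<phi> w"
  and \<Phi>_smult: "x \<in> carrier g \<Longrightarrow> \<Phi> (c \<odot>\<^bsub>g\<^esub> x) \<phi> w = c * \<Phi> x \<phi> w"
  and \<Phi>_bracket: "x \<in> carrier g \<Longrightarrow> y \<in> carrier g \<Longrightarrow>
    \<Phi> (bracket g x y) \<phi> w = \<Phi> y (\<Phi> x \<phi>) w - \<Phi> x (\<Phi> y \<phi>) w"
  using hom by (simp_all add: lie_hom_def linear_hom_def)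

lemmas \<Phi>_simps = \<Phi>_add \<Phi>_smult \<Phi>_bracket

lemma \<Phi>_zero: "\<Phi> \<zero>\<^bsub>g\<^esub> \<phi> w = 0"
  using lie_hom_zero[OF lie_algebra_kac_moody serre_dual.lie_algebra_op_lie hom] by simp

lemma \<Phi>_mem:
  assumes "x \<in> carrier g" "\<phi> \<in> serre_dual A" shows "\<Phi> x \<phi> \<in> serre_dual A"
proof -
  have "\<Phi> x \<in> carrier (op_lie (serre_dual A))"
    using hom assms(1) unfolding lie_hom_def linear_hom_def by blast
  then show ?thesis
    using assms(2) by (rule serre_dual.op_mem)
qed

lemma \<Phi>_h: "\<phi> \<in> serre_dual A \<Longrightarrow> \<Phi> (g.h i) \<phi> w = weight A i w * \<phi> w"
  using bracket_raise_lower[of i A i, THEN fun_cong, THEN fun_cong, of \<phi> w]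
  by (simp add: \<Phi>_simps \<Phi>_e \<Phi>_f op_restrict_def raise_serre_dual lower_serre_dual)

lemma deformed_op_closed: "deformed_op A a i \<in> carrier op"
proof -
  have "deformed_op A a i = raise i \<oplus>\<^bsub>op\<^esub> a i \<odot>\<^bsub>op\<^esub> bracket op (raise i) (lower A i)
      \<oplus>\<^bsub>op\<^esub> (- (a i)\<^sup>2) \<odot>\<^bsub>op\<^esub> lower A i"
    unfolding bracket_raise_lower by (auto simp: fun_eq_iff deformed_op_def)
  also have "\<dots> \<in> carrier op"
    by (intro op.M.add.m_closed op.smult_closed' op.bracket_closed raise_closed lower_closed)
  finally show ?thesis .
qed

lemma \<Phi>_u: "\<phi> \<in> serre_dual A \<Longrightarrow> \<Phi> (km_u A a i) \<phi> = deformed_op A a i \<phi>"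
  by (rule ext) (simp add: km_u_eq \<Phi>_add \<Phi>_smult \<Phi>_h \<Phi>_e \<Phi>_f op_restrict_def deformed_op_def)

lemma deformed_op_mem: "\<phi> \<in> serre_dual A \<Longrightarrow> deformed_op A a i \<phi> \<in> serre_dual A"
  using \<Phi>_mem[OF km_u_closed, of \<phi> a i] by (simp add: \<Phi>_u)

text \<open>Passes from \<open>\<Phi>\<close>, which acts on \<open>serre_dual A\<close>, to
  operators on all functions, where the leading-term computation takes place.\<close>

lemma \<Phi>_eval:
  assumes "\<phi> \<in> serre_dual A"
  shows "\<Phi> (lie_eval g (km_u A a) p) \<phi> = lie_eval op (deformed_op A a) p \<phi>"
proof -
  have "\<Phi> (km_u A a i) = op_restrict (serre_dual A) (deformed_op A a i)" for i
  proof (rule ext)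
    fix \<phi>
    have "\<Phi> (km_u A a i) \<in> carrier (op_lie (serre_dual A))"
      using hom km_u_closed unfolding lie_hom_def linear_hom_def by blast
    then show "\<Phi> (km_u A a i) \<phi> = op_restrict (serre_dual A) (deformed_op A a i) \<phi>"
      by (cases "\<phi> \<in> serre_dual A") (simp_all add: op_restrict_def \<Phi>_u serre_dual.op_outside)
  qed
  then have "\<Phi> (lie_eval g (km_u A a) p) =
      lie_eval (op_lie (serre_dual A)) (\<lambda>i. op_restrict (serre_dual A) (deformed_op A a i)) p"
    using lie_hom_lie_eval[where u = "km_u A a", OF lie_algebra_kac_moody
        serre_dual.lie_algebra_op_lie hom km_u_closed] by simp
  also have "\<dots> = op_restrict (serre_dual A) (lie_eval op (deformed_op A a) p)"
    by (rule serre_dual.lie_eval_op_restrict[OF deformed_op_closed deformed_op_mem])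
  finally show ?thesis
    using assms by (simp add: op_restrict_def)
qed

section \<open>The presented algebra and its action on the lowest weight vector\<close>

abbreviation rel :: "('i \<Rightarrow> complex) \<Rightarrow> ('i lie_term \<times> 'i lie_term) set" where
  "rel \<equiv> deformed_serre_relations A"

abbreviation gen :: "('i \<Rightarrow> complex) \<Rightarrow> 'i \<Rightarrow> 'i lie_term set" where
  "gen a i \<equiv> lie_class (rel a) (Gen i)"

lemma km_u_relation:
  assumes "(s, t) \<in> rel a" shows "lie_eval g (km_u A a) s = lie_eval g (km_u A a) t"
proof -
  obtain i j where ij: "i \<noteq> j" and st: "s = (Brk (Gen i) ^^ nat (1 - A i j)) (Gen j)"
    "t = Scale (- 2 * (if A i j = - 1 then 1 else 0) * of_int (A j i) * a i * a j) (Gen i)"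
    using assms unfolding deformed_serre_relations_def by blast
  show ?thesis
    using g.deformed_serre[OF ij, of a] unfolding st g.lie_eval_ad_pow lie_eval.simps km_u_eq .
qed

text \<open>\<open>\<Phi> x \<phi> []\<close> is the value of \<open>\<phi>\<close> at \<open>x v\<close>, so this says \<open>x v = 0\<close> for the lowest weight vector \<open>v\<close>.\<close>

definition annihilated :: "'i chevalley lie_term set \<Rightarrow> bool" where
  "annihilated x \<longleftrightarrow> (\<forall>\<phi>\<in>serre_dual A. \<Phi> x \<phi> [] = 0)"

lemma serre_eval_zero:
  assumes "i \<noteq> j"
  shows "lie_eval (presented_lie (rel (\<lambda>_. 0))) (gen (\<lambda>_. 0)) (serre_term A i j) =
    \<zero>\<^bsub>presented_lie (rel (\<lambda>_. 0))\<^esub>"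
proof -
  interpret N: lie_algebra "presented_lie (rel (\<lambda>_. 0))"
    by (rule lie_algebra_presented_lie)
  have "(serre_term A i j, Scale 0 (Gen i)) \<in> rel (\<lambda>_. 0)"
    using assms by (force simp: deformed_serre_relations_def serre_term_def)
  then have "lie_eval (presented_lie (rel (\<lambda>_. 0))) (gen (\<lambda>_. 0)) (serre_term A i j) =
      lie_eval (presented_lie (rel (\<lambda>_. 0))) (gen (\<lambda>_. 0)) (Scale 0 (Gen i))"
    by (rule presented_lie_relation)
  then show ?thesis
    by (simp add: lie_class_in_carrier)
qed

text \<open>The test functionals are \<open>truncated\<close> at length \<open>Suc k\<close>, one
  for each \<open>\<psi>\<close> in the dual of \<open>P 0\<close>. They do not see
  \<open>y\<close>, and on the leading term they give \<open>Suc k\<close> times the value of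
  \<open>\<psi>\<close> at \<open>p\<close>. Hence all \<open>\<psi>\<close> vanish at
  \<open>p\<close>.\<close>

lemma eval_annihilated_filtration:
  assumes p: "homog (Suc k) p" and y: "y \<in> natural_filtration g (range (km_u A a)) k"
    and ann: "annihilated (lie_eval g (km_u A a) p \<oplus>\<^bsub>g\<^esub> y)"
  shows "(p, Zero) \<in> lie_cong (rel (\<lambda>_. 0))"
proof -
  let ?N = "presented_lie (rel (\<lambda>_. 0))"
  interpret N: lie_algebra ?N
    by (rule lie_algebra_presented_lie)
  have uC: "range (km_u A a) \<subseteq> carrier g"
    using km_u_closed by auto
  have genC: "gen (\<lambda>_. 0) i \<in> carrier ?N" for i
    by (rule lie_class_in_carrier)
  have "lie_eval ?N (gen (\<lambda>_. 0)) p = \<zero>\<^bsub>?N\<^esub>"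
  proof (rule N.eq_by_dual)
    fix \<psi> assume \<psi>: "\<psi> \<in> dual ?N"
    let ?\<phi> = "N.truncated (gen (\<lambda>_. 0)) \<psi> (Suc k)"
    have \<phi>: "?\<phi> \<in> serre_dual A"
      by (rule N.truncated_serre_dual[OF genC serre_eval_zero \<psi>])
    have vanish: "?\<phi> v = 0" if "length v < Suc k" for v
      using that by (simp add: N.truncated_def[OF genC])
    have lead: "\<Phi> (lie_eval g (km_u A a) q) ?\<phi> [] = lie_eval op raise q ?\<phi> []"
      if "homog n q" "n \<le> Suc k" for q n
      unfolding \<Phi>_eval[OF \<phi>]
      by (rule lie_eval_deformed_op[OF that(1), of "Suc k"]) (use vanish that(2) in simp_all)
    have "\<Phi> y ?\<phi> [] = 0"
      using y
    proof (induction rule: g.natural_filtration_induct[OF uC, consumes 1, case_names base zero add smult])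
      case (base n z)
      obtain q where q: "homog n q" "lie_eval g (km_u A a) q = z"
        using g.iterated_brackets_homog[OF base(1)] by blast
      have "\<Phi> z ?\<phi> [] = lie_eval op raise q ?\<phi> []"
        using lead[OF q(1)] base(2) q(2) by simp
      \<comment> \<open>At the empty word a term of degree \<open>n\<close> reads only words of
        length \<open>n \<le> k\<close>, where the functional is zero.\<close>
      also have "\<dots> = lie_eval op raise q (\<lambda>_. 0) []"
        by (rule lie_eval_raise_local[OF q(1)]) (use vanish base(2) in simp)
      finally show ?case
        by (simp add: lie_eval_raise_zero)
    next
      case zero
      show ?case by (rule \<Phi>_zero)
    next
      case (add x y)
      then show ?case
        using g.natural_filtration_closed[OF uC] by (simp add: \<Phi>_simps)
    next
      case (smult c x)
      then show ?case
        using g.natural_filtration_closed[OF uC] by (simp add: \<Phi>_simps)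
    qed
    moreover have "\<Phi> (lie_eval g (km_u A a) p \<oplus>\<^bsub>g\<^esub> y) ?\<phi> [] =
        \<Phi> (lie_eval g (km_u A a) p) ?\<phi> [] + \<Phi> y ?\<phi> []"
      by (rule \<Phi>_add) (use km_u_closed g.natural_filtration_closed[OF uC y] in auto)
    ultimately have "lie_eval op raise p ?\<phi> [] = 0"
      using ann \<phi> lead[OF p] by (simp add: annihilated_def)
    then have "of_nat (Suc k) * \<psi> (lie_eval ?N (gen (\<lambda>_. 0)) p) = 0"
      using N.truncated_Nil[OF genC p \<psi>] by simp
    then show "\<psi> (lie_eval ?N (gen (\<lambda>_. 0)) p) = \<psi> \<zero>\<^bsub>?N\<^esub>"
      using \<psi> by (simp del: of_nat_Suc)
  qed (use genC in auto)
  then have "lie_class (rel (\<lambda>_. 0)) p = lie_class (rel (\<lambda>_. 0)) Zero"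
    by (simp add: lie_eval_presented zero_presented_lie)
  then show ?thesis
    by (simp add: lie_class_eq_iff)
qed

text \<open>Stronger than injectivity of \<open>\<Theta>\<close>, as the hypothesis concerns one
  vector only. This form yields the trivial intersection with the Borel subalgebra.\<close>

lemma presentation_faithful:
  assumes \<Theta>: "\<Theta> \<in> lie_hom (presented_lie (rel a)) g" "\<And>i. \<Theta> (gen a i) = km_u A a i"
    and x: "x \<in> carrier (presented_lie (rel a))" and ann: "annihilated (\<Theta> x)"
  shows "x = \<zero>\<^bsub>presented_lie (rel a)\<^esub>"
proof -
  let ?P = "presented_lie (rel a)"
  interpret P: lie_algebra ?P
    by (rule lie_algebra_presented_lie)
  have genC: "gen a i \<in> carrier ?P" for i
    by (rule lie_class_in_carrier)
  have S: "range (gen a) \<subseteq> carrier ?P"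
    using genC by auto
  have uC: "range (km_u A a) \<subseteq> carrier g"
    using km_u_closed by auto
  have \<Theta>_eval: "\<Theta> (lie_eval ?P (gen a) p) = lie_eval g (km_u A a) p" for p
    using lie_hom_lie_eval[OF lie_algebra_presented_lie lie_algebra_kac_moody \<Theta>(1) genC]
    by (simp add: \<Theta>(2))
  have \<Theta>_add: "\<Theta> (y \<oplus>\<^bsub>?P\<^esub> z) = \<Theta> y \<oplus>\<^bsub>g\<^esub> \<Theta> z" "\<Theta> (c \<odot>\<^bsub>?P\<^esub> y) = c \<odot>\<^bsub>g\<^esub> \<Theta> y"
    if "y \<in> carrier ?P" "z \<in> carrier ?P" for y z c
    using \<Theta>(1) that by (simp_all add: lie_hom_def linear_hom_def)
  have \<Theta>_zero: "\<Theta> \<zero>\<^bsub>?P\<^esub> = \<zero>\<^bsub>g\<^esub>"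
    by (rule lie_hom_zero[OF lie_algebra_presented_lie lie_algebra_kac_moody \<Theta>(1)])
  have \<Theta>_filtration: "\<Theta> y \<in> natural_filtration g (range (km_u A a)) k"
    if "y \<in> natural_filtration ?P (range (gen a)) k" for y k
    using that
  proof (induction rule: P.natural_filtration_induct[OF S, consumes 1, case_names base zero add smult])
    case (base n z)
    obtain q where q: "homog n q" "lie_eval ?P (gen a) q = z"
      using P.iterated_brackets_homog[OF base(1)] by blast
    have "\<Theta> z \<in> natural_filtration g (range (km_u A a)) n"
      using g.homog_eval_filtration[OF km_u_closed q(1)] \<Theta>_eval[of q] q(2) by simp
    then show ?case
      using g.natural_filtration_mono[OF uC base(2)] by blast
  next
    case zero
    show ?case
      unfolding \<Theta>_zero by (rule g.natural_filtration_zero[OF uC])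
  next
    case (add x y)
    then show ?case
      using P.natural_filtration_closed[OF S] g.natural_filtration_add[OF uC] by (simp add: \<Theta>_add)
  next
    case (smult c x)
    then show ?case
      using P.natural_filtration_closed[OF S] g.natural_filtration_smult[OF uC]
      by (simp add: \<Theta>_add(2)[OF _ P.M.zero_closed])
  qed
  have main: "y = \<zero>\<^bsub>?P\<^esub>"
    if "y \<in> natural_filtration ?P (range (gen a)) k" "annihilated (\<Theta> y)" for y k
    using that
  proof (induction k arbitrary: y)
    case 0
    then show ?case
      using P.natural_filtration_0[OF S] by simp
  next
    case (Suc k)
    obtain p z where pz: "homog (Suc k) p" "z \<in> natural_filtration ?P (range (gen a)) k"
      "y = lie_eval ?P (gen a) p \<oplus>\<^bsub>?P\<^esub> z"
      using P.natural_filtration_Suc_decomp[OF genC Suc.prems(1)] by blast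
    have "\<Theta> y = lie_eval g (km_u A a) p \<oplus>\<^bsub>g\<^esub> \<Theta> z"
      unfolding pz(3) \<Theta>_eval[symmetric]
      by (rule \<Theta>_add(1)) (use genC P.natural_filtration_closed[OF S pz(2)] in auto)
    then have "(p, Zero) \<in> lie_cong (rel (\<lambda>_. 0))"
      using eval_annihilated_filtration[OF pz(1) \<Theta>_filtration[OF pz(2)]] Suc.prems(2) by simp
    \<comment> \<open>The leading term falls into step \<open>Suc k - 1 = k\<close> of the
      filtration of \<open>?P\<close>, so \<open>y\<close> itself lies there and the induction
      hypothesis applies to the same \<open>y\<close>.\<close>
    from P.homog_relation_filtration[where u = "gen a" and a = a, OF genC gcm _ pz(1) this]
    have "lie_eval ?P (gen a) p \<in> natural_filtration ?P (range (gen a)) (Suc k - 1)"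
      using presented_lie_relation[of _ _ "rel a"] by blast
    then have "y \<in> natural_filtration ?P (range (gen a)) k"
      unfolding pz(3) using P.natural_filtration_add[OF S _ pz(2)] by simp
    then show ?case
      using Suc.IH Suc.prems(2) by blast
  qed
  obtain t where "x = lie_class (rel a) t"
    using x by (rule presented_lie_cases)
  then have "x \<in> range (lie_eval ?P (gen a))"
    by (auto simp: lie_eval_presented)
  then have "x \<in> (\<Union>k. natural_filtration ?P (range (gen a)) k)"
    by (simp only: P.hull_eq_range_lie_eval[OF genC, symmetric] P.Union_natural_filtration[OF S])
  then show ?thesis
    using main ann by blast
qed

lemma presentation_hom:
  obtains \<Theta> where "\<Theta> \<in> lie_hom (presented_lie (rel a)) g" "\<And>i. \<Theta> (gen a i) = km_u A a i"
proof -
  have "\<exists>\<Theta>\<in>lie_hom (presented_lie (rel a)) g. \<forall>i. \<Theta> (gen a i) = km_u A a i"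
    by (rule g.presented_lie_universal) (use km_u_closed km_u_relation in auto)
  then show thesis
    using that by blast
qed

lemma carrier_km_deformed: "carrier (km_deformed A a) = range (lie_eval g (km_u A a))"
  by (simp add: km_deformed_def subalgebra_generated_def g.hull_eq_range_lie_eval[OF km_u_closed])

lemma km_deformed_faithful:
  assumes "x \<in> carrier (km_deformed A a)" "annihilated x"
  shows "x = \<zero>\<^bsub>g\<^esub>"
proof -
  obtain \<Theta> where \<Theta>: "\<Theta> \<in> lie_hom (presented_lie (rel a)) g" "\<And>i. \<Theta> (gen a i) = km_u A a i"
    using presentation_hom[of a] by blast
  obtain p where p: "x = lie_eval g (km_u A a) p"
    using assms(1) by (auto simp: carrier_km_deformed)
  have "x = \<Theta> (lie_class (rel a) p)"
    using lie_hom_lie_eval[OF lie_algebra_presented_lie lie_algebra_kac_moody \<Theta>(1) lie_class_in_carrier,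
        of Gen p]
    by (simp add: \<Theta>(2) p lie_eval_presented)
  moreover from this have "lie_class (rel a) p = \<zero>\<^bsub>presented_lie (rel a)\<^esub>"
    using presentation_faithful[OF \<Theta> lie_class_in_carrier] assms(2) by simp
  ultimately show ?thesis
    using lie_hom_zero[OF lie_algebra_presented_lie lie_algebra_kac_moody \<Theta>(1)] by simp
qed

theorem km_deformed_presented: "presented_by (km_deformed A a) (km_u A a) (rel a)"
proof -
  let ?P = "presented_lie (rel a)"
  interpret P: lie_algebra ?P
    by (rule lie_algebra_presented_lie)
  obtain \<Theta> where \<Theta>: "\<Theta> \<in> lie_hom ?P g" "\<And>i. \<Theta> (gen a i) = km_u A a i"
    using presentation_hom[of a] by blast
  have eval: "\<Theta> (lie_class (rel a) p) = lie_eval g (km_u A a) p" for p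
    using lie_hom_lie_eval[OF lie_algebra_presented_lie lie_algebra_kac_moody \<Theta>(1) lie_class_in_carrier,
        of Gen p]
    by (simp add: \<Theta>(2) lie_eval_presented)
  have img: "\<Theta> ` carrier ?P = carrier (km_deformed A a)"
    by (simp add: carrier_presented_lie carrier_km_deformed image_image eval)
  have inj: "inj_on \<Theta> (carrier ?P)"
  proof (rule inj_onI)
    fix x y assume xy: "x \<in> carrier ?P" "y \<in> carrier ?P" "\<Theta> x = \<Theta> y"
    have \<Theta>y: "\<Theta> y \<in> carrier g"
      using \<Theta>(1) xy(2) unfolding lie_hom_def linear_hom_def by blast
    have "\<Theta> (x \<oplus>\<^bsub>?P\<^esub> (-1) \<odot>\<^bsub>?P\<^esub> y) = \<Theta> x \<oplus>\<^bsub>g\<^esub> (-1) \<odot>\<^bsub>g\<^esub> \<Theta> y"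
      using \<Theta>(1) xy(1,2) by (simp add: lie_hom_def linear_hom_def)
    also have "\<dots> = \<zero>\<^bsub>g\<^esub>"
      using \<Theta>y xy(3) g.smult_collect[of "\<Theta> y" 1 "-1"] by simp
    finally have "annihilated (\<Theta> (x \<oplus>\<^bsub>?P\<^esub> (-1) \<odot>\<^bsub>?P\<^esub> y))"
      by (simp add: annihilated_def \<Phi>_zero)
    then have "x \<oplus>\<^bsub>?P\<^esub> (-1) \<odot>\<^bsub>?P\<^esub> y = \<zero>\<^bsub>?P\<^esub>"
      using presentation_faithful[OF \<Theta>] xy(1,2) by simp
    then show "x = y"
      using xy(1,2) P.minus_zero_eq[of x y] by (simp add: P.minus_eq_smult)
  qed
  have "\<Theta> \<in> lie_hom ?P (km_deformed A a)"
    using \<Theta>(1) img by (auto simp: lie_hom_def linear_hom_def km_deformed_def subalgebra_generated_def)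
  then have "\<Theta> \<in> lie_iso ?P (km_deformed A a)"
    using img inj by (simp add: lie_iso_def bij_betw_def)
  then show ?thesis
    unfolding presented_by_def using \<Theta>(2) by blast
qed

end

section \<open>The projection along the negative Borel subalgebra\<close>

context lie_algebra
begin

definition sum_space :: "'a set \<Rightarrow> 'a set \<Rightarrow> 'a set" where
  "sum_space U V = {x \<oplus> y | x y. x \<in> U \<and> y \<in> V}"

lemma sum_spaceI: "x \<in> U \<Longrightarrow> y \<in> V \<Longrightarrow> x \<oplus> y \<in> sum_space U V"
  unfolding sum_space_def by blast

lemma sum_spaceE:
  assumes "z \<in> sum_space U V"
  obtains x y where "x \<in> U" "y \<in> V" "z = x \<oplus> y"
  using assms unfolding sum_space_def by blast

lemma sum_space_mono: "U \<subseteq> U' \<Longrightarrow> V \<subseteq> V' \<Longrightarrow> sum_space U V \<subseteq> sum_space U' V'"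
  unfolding sum_space_def by blast

context
  fixes U V assumes U: "submodule U complex_field L" and V: "submodule V complex_field L"
begin

lemma sum_space_left: "x \<in> U \<Longrightarrow> x \<in> sum_space U V"
  using sum_spaceI[of x U \<zero> V] submodule_in_carrier[OF U] submodule_zero_mem[OF V] by simp

lemma sum_space_right: "y \<in> V \<Longrightarrow> y \<in> sum_space U V"
  using sum_spaceI[of \<zero> U y V] submodule_in_carrier[OF V] submodule_zero_mem[OF U] by simp

lemma submodule_sum_space: "submodule (sum_space U V) complex_field L"
  unfolding submodule_iff
proof (intro conjI ballI allI)
  show "sum_space U V \<subseteq> carrier L"
    using submodule_in_carrier[OF U] submodule_in_carrier[OF V] by (auto elim!: sum_spaceE)
  show "\<zero> \<in> sum_space U V"
    by (rule sum_space_left) (rule submodule_zero_mem[OF U])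
next
  fix p q assume "p \<in> sum_space U V" "q \<in> sum_space U V"
  then obtain x y x' y' where *: "x \<in> U" "y \<in> V" "p = x \<oplus> y" "x' \<in> U" "y' \<in> V" "q = x' \<oplus> y'"
    by (elim sum_spaceE)
  have "p \<oplus> q = (x \<oplus> x') \<oplus> (y \<oplus> y')"
    using * submodule_in_carrier[OF U] submodule_in_carrier[OF V] by (simp add: M.a_ac)
  then show "p \<oplus> q \<in> sum_space U V"
    using sum_spaceI[OF submodule_add[OF U *(1,4)] submodule_add[OF V *(2,5)]] by simp
next
  fix c p assume "p \<in> sum_space U V"
  then obtain x y where *: "x \<in> U" "y \<in> V" "p = x \<oplus> y"
    by (rule sum_spaceE)
  then have "c \<odot> p = c \<odot> x \<oplus> c \<odot> y"
    using submodule_in_carrier[OF U] submodule_in_carrier[OF V] by (simp add: smult_add_right)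
  then show "c \<odot> p \<in> sum_space U V"
    using sum_spaceI[OF submodule_smult[OF U *(1)] submodule_smult[OF V *(2)]] by simp
qed

end

lemma bracket_natural_filtration:
  assumes "z \<in> carrier L" "S \<subseteq> carrier L" "submodule H complex_field L"
    and "\<And>n x. (n, x) \<in> iterated_brackets L S \<Longrightarrow> n \<le> k \<Longrightarrow> bracket L z x \<in> H"
    and "y \<in> natural_filtration L S k"
  shows "bracket L z y \<in> H"
  by (rule bracket_lie_span[OF assms(1) iterated_set_subset[OF assms(2)] assms(3) _
        assms(5)[unfolded natural_filtration_def]])
    (use assms(4) in blast)

end

section \<open>The negative Borel subalgebra and the filtration of n\<close>

context kac_moody_module
begin

abbreviation F :: "nat \<Rightarrow> 'i chevalley lie_term set set" where
  "F k \<equiv> natural_filtration g (range (km_e A)) k"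

definition borel :: "'i chevalley lie_term set set" where
  "borel = (\<lambda>H. lie_subalgebra H g) hull (range (km_f A) \<union> range g.h)"

text \<open>Since \<open>F 0\<close> is zero, \<open>Q 0\<close> is \<open>borel\<close>, and each
  \<open>u_i\<close> agrees with \<open>e_i\<close> modulo \<open>Q 0\<close>. The sets
  \<open>Q k\<close> form a filtration compatible with brackets, in which the \<open>u_i\<close> and
  the \<open>e_i\<close> can be compared.\<close>

abbreviation Q :: "nat \<Rightarrow> 'i chevalley lie_term set set" where
  "Q k \<equiv> g.sum_space (F k) borel"

lemma range_e: "range (km_e A) \<subseteq> carrier g"
  by auto

lemmas F_submodule = g.submodule_natural_filtration[OF range_e]
  and F_closed = g.natural_filtration_closed[OF range_e]
  and F_mono = g.natural_filtration_mono[OF range_e]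
  and F_bracket = g.natural_filtration_bracket[OF range_e]

lemma borel_subalgebra: "lie_subalgebra borel g"
  unfolding borel_def by (rule g.lie_subalgebra_hull) auto

lemma borel_submodule: "submodule borel complex_field g"
  and borel_bracket: "x \<in> borel \<Longrightarrow> y \<in> borel \<Longrightarrow> bracket g x y \<in> borel"
  using borel_subalgebra by (auto simp: lie_subalgebra_def)

lemma borel_closed: "x \<in> borel \<Longrightarrow> x \<in> carrier g"
  by (rule g.submodule_in_carrier[OF borel_submodule])

lemma f_borel: "km_f A i \<in> borel" and h_borel: "g.h i \<in> borel"
  unfolding borel_def by (rule hull_inc, blast)+

lemma Q_submodule: "submodule (Q k) complex_field g"
  by (rule g.submodule_sum_space[OF F_submodule borel_submodule])

lemma F_Q: "x \<in> F k \<Longrightarrow> x \<in> Q k"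
  by (rule g.sum_space_left[OF F_submodule borel_submodule])

lemma borel_Q: "x \<in> borel \<Longrightarrow> x \<in> Q k"
  by (rule g.sum_space_right[OF F_submodule borel_submodule])

lemma Q_mono: "j \<le> k \<Longrightarrow> Q j \<subseteq> Q k"
  by (intro g.sum_space_mono F_mono) auto

lemma h_iterated:
  "(n, x) \<in> iterated_brackets g (range (km_e A)) \<Longrightarrow> \<exists>c. bracket g (g.h j) x = c \<odot>\<^bsub>g\<^esub> x"
proof (induction rule: iterated_brackets.induct)
  case (generator x)
  then obtain i where "x = km_e A i" by blast
  then show ?case
    using g.he[of j i] by blast
next
  case (bracket m x n y)
  from bracket.IH obtain c d where cd: "bracket g (g.h j) x = c \<odot>\<^bsub>g\<^esub> x"
    "bracket g (g.h j) y = d \<odot>\<^bsub>g\<^esub> y"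
    by blast
  have C: "x \<in> carrier g" "y \<in> carrier g"
    using bracket.hyps g.iterated_brackets_closed[OF _ range_e] by auto
  have "bracket g (g.h j) (bracket g x y) = (c + d) \<odot>\<^bsub>g\<^esub> bracket g x y"
    using g.jacobi_left[of "g.h j" x y] C
    by (simp add: cd g.bracket_smult_left g.bracket_smult_right g.smult_collect)
  then show ?case ..
qed

lemma h_F:
  assumes "y \<in> F k" shows "bracket g (g.h j) y \<in> F k"
proof (rule g.bracket_natural_filtration[OF _ range_e F_submodule _ assms])
  fix n x assume nx: "(n, x) \<in> iterated_brackets g (range (km_e A))" "n \<le> k"
  obtain c where "bracket g (g.h j) x = c \<odot>\<^bsub>g\<^esub> x"
    using h_iterated[OF nx(1)] by blast
  then show "bracket g (g.h j) x \<in> F k"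
    using g.submodule_smult[OF F_submodule g.iterated_brackets_filtration[OF range_e nx]] by simp
qed simp

abbreviation cartan :: "'i chevalley lie_term set set" where
  "cartan \<equiv> lie_span g (range g.h)"

lemma range_h: "range g.h \<subseteq> carrier g"
  by auto

lemma cartan_submodule: "submodule cartan complex_field g"
  by (rule g.submodule_lie_span[OF range_h])

lemma cartan_closed: "z \<in> cartan \<Longrightarrow> z \<in> carrier g"
  by (rule g.submodule_in_carrier[OF cartan_submodule])

lemma F_cartan:
  assumes z: "z \<in> cartan" and y: "y \<in> F k"
  shows "bracket g y z \<in> F k" "bracket g z y \<in> F k"
proof -
  show *: "bracket g y z \<in> F k"
  proof (rule g.bracket_lie_span[OF F_closed[OF y] range_h F_submodule _ z])
    fix x assume "x \<in> range g.h"
    then obtain j where j: "x = g.h j" by blast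
    show "bracket g y x \<in> F k"
      unfolding j g.bracket_antisym[OF range_h[THEN subsetD, OF rangeI] F_closed[OF y]]
      by (rule g.submodule_smult[OF F_submodule h_F[OF y]])
  qed
  show "bracket g z y \<in> F k"
    unfolding g.bracket_antisym[OF F_closed[OF y] cartan_closed[OF z]]
    by (rule g.submodule_smult[OF F_submodule *])
qed

text \<open>The error is kept in \<open>cartan\<close>, a smaller space than \<open>borel\<close>,
  to make the induction work: \<open>cartan\<close> preserves every \<open>F k\<close>, so at a
  bracket both errors are absorbed into \<open>F (m + n)\<close>.\<close>

lemma f_iterated:
  "(n, x) \<in> iterated_brackets g (range (km_e A)) \<Longrightarrow>
    bracket g (km_f A j) x \<in> g.sum_space (F n) cartan"
proof (induction rule: iterated_brackets.induct)
  case (generator x)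
  then obtain i where x: "x = km_e A i" by blast
  have "g.h i \<in> cartan"
    by (rule subsetD[OF g.lie_span_superset]) simp
  then have "bracket g (km_f A j) x \<in> cartan"
    unfolding x g.fe using g.submodule_smult[OF cartan_submodule] g.submodule_zero_mem[OF cartan_submodule]
    by simp
  then show ?case
    by (rule g.sum_space_right[OF F_submodule cartan_submodule])
next
  case (bracket m x n y)
  have x: "x \<in> F m" and y: "y \<in> F n"
    using bracket.hyps g.iterated_brackets_filtration[OF range_e] by auto
  note C = F_closed[OF x] F_closed[OF y]
  obtain p s where ps: "p \<in> F m" "s \<in> cartan" "bracket g (km_f A j) x = p \<oplus>\<^bsub>g\<^esub> s"
    using bracket.IH(1) by (rule g.sum_spaceE)
  obtain q t where qt: "q \<in> F n" "t \<in> cartan" "bracket g (km_f A j) y = q \<oplus>\<^bsub>g\<^esub> t"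
    using bracket.IH(2) by (rule g.sum_spaceE)
  have mono: "F m \<subseteq> F (m + n)" "F n \<subseteq> F (m + n)"
    by (rule F_mono, simp)+
  have "bracket g (km_f A j) (bracket g x y) =
      (bracket g p y \<oplus>\<^bsub>g\<^esub> bracket g s y) \<oplus>\<^bsub>g\<^esub> (bracket g x q \<oplus>\<^bsub>g\<^esub> bracket g x t)"
    using g.jacobi_left[OF g.f_closed C, of j] C F_closed[OF ps(1)] F_closed[OF qt(1)]
      cartan_closed[OF ps(2)] cartan_closed[OF qt(2)]
    by (simp add: ps(3) qt(3) g.bracket_add_left g.bracket_add_right)
  also have "\<dots> \<in> F (m + n)"
    by (intro g.submodule_add[OF F_submodule] F_bracket x y ps qt
        mono(2)[THEN subsetD, OF F_cartan(2)[OF ps(2) y]] mono(1)[THEN subsetD, OF F_cartan(1)[OF qt(2) x]])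
  finally show ?case
    by (rule g.sum_space_left[OF F_submodule cartan_submodule])
qed

lemma cartan_borel: "cartan \<subseteq> borel"
  by (rule g.lie_span_minimal[OF _ borel_submodule]) (use h_borel in blast)

lemma f_Q:
  assumes "y \<in> F k" shows "bracket g (km_f A j) y \<in> Q k"
proof (rule g.bracket_natural_filtration[OF _ range_e Q_submodule _ assms])
  fix n x assume nx: "(n, x) \<in> iterated_brackets g (range (km_e A))" "n \<le> k"
  show "bracket g (km_f A j) x \<in> Q k"
    using f_iterated[OF nx(1), of j] g.sum_space_mono[OF F_mono[OF nx(2)] cartan_borel] by blast
qed simp

text \<open>By the Jacobi identity, the elements of \<open>borel\<close> with this property for all
  \<open>k\<close> form a subalgebra; it contains the generators \<open>f_i\<close> and
  \<open>h_i\<close>.\<close>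

lemma borel_F:
  assumes "x \<in> borel" "y \<in> F k" shows "bracket g x y \<in> Q k"
proof -
  let ?N = "{x \<in> borel. \<forall>k. \<forall>y\<in>F k. bracket g x y \<in> Q k}"
  have "lie_subalgebra ?N g"
    unfolding lie_subalgebra_def g.submodule_iff
  proof (intro conjI ballI allI)
    show "?N \<subseteq> carrier g"
      using borel_closed by blast
    show "\<zero>\<^bsub>g\<^esub> \<in> ?N"
      using g.submodule_zero_mem[OF borel_submodule] g.submodule_zero_mem[OF Q_submodule]
      by (auto simp: F_closed)
  next
    fix x z assume x: "x \<in> ?N" and z: "z \<in> ?N"
    show "x \<oplus>\<^bsub>g\<^esub> z \<in> ?N"
    proof (intro CollectI conjI allI ballI)
      show "x \<oplus>\<^bsub>g\<^esub> z \<in> borel"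
        using x z g.submodule_add[OF borel_submodule] by blast
      fix k y assume y: "y \<in> F k"
      have "bracket g (x \<oplus>\<^bsub>g\<^esub> z) y = bracket g x y \<oplus>\<^bsub>g\<^esub> bracket g z y"
        by (rule g.bracket_add_left) (use x z borel_closed F_closed[OF y] in auto)
      then show "bracket g (x \<oplus>\<^bsub>g\<^esub> z) y \<in> Q k"
        using x z y g.submodule_add[OF Q_submodule, of "bracket g x y" k "bracket g z y"] by simp
    qed
    show "bracket g x z \<in> ?N"
    proof (intro CollectI conjI allI ballI)
      show "bracket g x z \<in> borel"
        using x z borel_bracket by blast
      fix k y assume y: "y \<in> F k"
      have C: "x \<in> carrier g" "z \<in> carrier g" "y \<in> carrier g"
        using x z borel_closed F_closed[OF y] by auto
      \<comment> \<open>Membership of \<open>v\<close> in \<open>?N\<close> speaks of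
        \<open>F k\<close>. It extends to \<open>Q k\<close> because \<open>v\<close> lies in
        \<open>borel\<close>, which is closed under brackets.\<close>
      have Q: "bracket g v w \<in> Q k" if v: "v \<in> ?N" and w: "w \<in> Q k" for v w
      proof -
        obtain p b where pb: "p \<in> F k" "b \<in> borel" "w = p \<oplus>\<^bsub>g\<^esub> b"
          using w by (rule g.sum_spaceE)
        have "bracket g v w = bracket g v p \<oplus>\<^bsub>g\<^esub> bracket g v b"
          unfolding pb(3) by (rule g.bracket_add_right) (use v pb borel_closed F_closed in auto)
        then show ?thesis
          using g.submodule_add[OF Q_submodule, of "bracket g v p" k "bracket g v b"] v pb
            borel_Q[OF borel_bracket] by simp
      qed
      have "bracket g (bracket g x z) y =
          bracket g x (bracket g z y) \<ominus>\<^bsub>g\<^esub> bracket g z (bracket g x y)"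
      proof (rule g.eq_by_dual)
        fix \<psi> assume "\<psi> \<in> dual g"
        then show "\<psi> (bracket g (bracket g x z) y) =
            \<psi> (bracket g x (bracket g z y) \<ominus>\<^bsub>g\<^esub> bracket g z (bracket g x y))"
          using C by (simp add: g.jacobi_left[OF C])
      qed (use C in auto)
      also have "\<dots> \<in> Q k"
        by (rule g.submodule_minus[OF Q_submodule]) (use x z y Q in blast)+
      finally show "bracket g (bracket g x z) y \<in> Q k" .
    qed
  next
    fix c x assume x: "x \<in> ?N"
    show "c \<odot>\<^bsub>g\<^esub> x \<in> ?N"
    proof (intro CollectI conjI allI ballI)
      show "c \<odot>\<^bsub>g\<^esub> x \<in> borel"
        using x g.submodule_smult[OF borel_submodule] by blast
      fix k y assume y: "y \<in> F k"
      have "bracket g (c \<odot>\<^bsub>g\<^esub> x) y = c \<odot>\<^bsub>g\<^esub> bracket g x y"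
        by (rule g.bracket_smult_left) (use x borel_closed F_closed[OF y] in auto)
      then show "bracket g (c \<odot>\<^bsub>g\<^esub> x) y \<in> Q k"
        using x y g.submodule_smult[OF Q_submodule, of "bracket g x y" k c] by simp
    qed
  qed
  moreover have "range (km_f A) \<union> range g.h \<subseteq> ?N"
    using f_borel h_borel f_Q h_F F_Q by blast
  ultimately have "borel \<subseteq> ?N"
    unfolding borel_def by (intro hull_minimal)
  then show ?thesis
    using assms by blast
qed

lemma Q_bracket:
  assumes "x \<in> Q i" "y \<in> Q j" shows "bracket g x y \<in> Q (i + j)"
proof -
  obtain p b where pb: "p \<in> F i" "b \<in> borel" "x = p \<oplus>\<^bsub>g\<^esub> b"
    using assms(1) by (rule g.sum_spaceE)
  obtain q d where qd: "q \<in> F j" "d \<in> borel" "y = q \<oplus>\<^bsub>g\<^esub> d"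
    using assms(2) by (rule g.sum_spaceE)
  note C = F_closed[OF pb(1)] borel_closed[OF pb(2)] F_closed[OF qd(1)] borel_closed[OF qd(2)]
  have mono: "Q i \<subseteq> Q (i + j)" "Q j \<subseteq> Q (i + j)"
    by (rule Q_mono, simp)+
  have "bracket g x y = (bracket g p q \<oplus>\<^bsub>g\<^esub> (-1) \<odot>\<^bsub>g\<^esub> bracket g d p) \<oplus>\<^bsub>g\<^esub>
      (bracket g b q \<oplus>\<^bsub>g\<^esub> bracket g b d)"
    using C g.bracket_antisym[OF C(4,1)] by (simp add: pb(3) qd(3) g.bracket_add_left g.bracket_add_right g.M.a_ac)
  also have "\<dots> \<in> Q (i + j)"
    by (intro g.submodule_add[OF Q_submodule] g.submodule_smult[OF Q_submodule] F_Q[OF F_bracket]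
        borel_Q[OF borel_bracket] pb qd mono(1)[THEN subsetD, OF borel_F[OF qd(2) pb(1)]]
        mono(2)[THEN subsetD, OF borel_F[OF pb(2) qd(1)]])
  finally show ?thesis .
qed

text \<open>On generators the difference is \<open>a_i h_i - a_i^2 f_i\<close>, an element of
  \<open>Q 0\<close>. For brackets it telescopes, and in each summand the factor that carries the
  difference loses one degree.\<close>

lemma eval_u_minus_eval_e:
  "homog n p \<Longrightarrow> lie_eval g (km_u A a) p \<ominus>\<^bsub>g\<^esub> lie_eval g (km_e A) p \<in> Q (n - 1)"
proof (induction rule: homog.induct)
  case (Gen i)
  have "km_u A a i \<ominus>\<^bsub>g\<^esub> km_e A i = a i \<odot>\<^bsub>g\<^esub> g.h i \<oplus>\<^bsub>g\<^esub> (- (a i)\<^sup>2) \<odot>\<^bsub>g\<^esub> km_f A i"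
    by (rule g.eq_by_dual) (auto simp: km_u_eq)
  also have "\<dots> \<in> borel"
    by (intro g.submodule_add[OF borel_submodule] g.submodule_smult[OF borel_submodule] f_borel h_borel)
  finally show ?case
    using borel_Q by simp
next
  case (Zero n)
  show ?case
    using g.submodule_zero_mem[OF Q_submodule] by (simp add: g.minus_eq_smult)
next
  case (Add n s t)
  have C: "lie_eval g (km_u A a) s \<in> carrier g" "lie_eval g (km_u A a) t \<in> carrier g"
    "lie_eval g (km_e A) s \<in> carrier g" "lie_eval g (km_e A) t \<in> carrier g"
    using g.lie_eval_closed'[OF km_u_closed] g.lie_eval_closed'[OF km_e_closed] by auto
  have "lie_eval g (km_u A a) (Add s t) \<ominus>\<^bsub>g\<^esub> lie_eval g (km_e A) (Add s t) =
      (lie_eval g (km_u A a) s \<ominus>\<^bsub>g\<^esub> lie_eval g (km_e A) s) \<oplus>\<^bsub>g\<^esub>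
      (lie_eval g (km_u A a) t \<ominus>\<^bsub>g\<^esub> lie_eval g (km_e A) t)"
    by (rule g.eq_by_dual) (use C in auto)
  then show ?case
    using g.submodule_add[OF Q_submodule Add.IH] by simp
next
  case (Scale n t c)
  have C: "lie_eval g (km_u A a) t \<in> carrier g" "lie_eval g (km_e A) t \<in> carrier g"
    using g.lie_eval_closed'[OF km_u_closed] g.lie_eval_closed'[OF km_e_closed] by auto
  have "lie_eval g (km_u A a) (Scale c t) \<ominus>\<^bsub>g\<^esub> lie_eval g (km_e A) (Scale c t) =
      c \<odot>\<^bsub>g\<^esub> (lie_eval g (km_u A a) t \<ominus>\<^bsub>g\<^esub> lie_eval g (km_e A) t)"
    by (rule g.eq_by_dual) (use C in \<open>auto simp: algebra_simps\<close>)
  then show ?case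
    using g.submodule_smult[OF Q_submodule Scale.IH] by simp
next
  case (Brk m s n t)
  let ?su = "lie_eval g (km_u A a) s" and ?tu = "lie_eval g (km_u A a) t"
  let ?se = "lie_eval g (km_e A) s" and ?te = "lie_eval g (km_e A) t"
  have C: "?su \<in> carrier g" "?tu \<in> carrier g" "?se \<in> carrier g" "?te \<in> carrier g"
    using g.lie_eval_closed'[OF km_u_closed] g.lie_eval_closed'[OF km_e_closed] by auto
  show ?case
  \<comment> \<open>Here the truncated \<open>m - 1\<close> or \<open>n - 1\<close> would spoil the
    addition of degrees; but terms of degree 0 evaluate to zero, so both brackets vanish.\<close>
  proof (cases "m = 0 \<or> n = 0")
    case True
    then have "bracket g ?su ?tu = \<zero>\<^bsub>g\<^esub> \<and> bracket g ?se ?te = \<zero>\<^bsub>g\<^esub>"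
      using g.homog_eval_0[where u = "km_u A a", OF km_u_closed]
        g.homog_eval_0[where u = "km_e A", OF km_e_closed] Brk.hyps C by auto
    then show ?thesis
      using g.submodule_zero_mem[OF Q_submodule] by (simp add: g.minus_eq_smult)
  next
    case False
    have "?te \<in> F n" "?se \<in> F m"
      using g.homog_eval_filtration[OF km_e_closed Brk.hyps(1)] g.homog_eval_filtration[OF km_e_closed Brk.hyps(2)]
      by simp_all
    have "?tu = ?te \<oplus>\<^bsub>g\<^esub> (?tu \<ominus>\<^bsub>g\<^esub> ?te)"
      by (rule g.eq_by_dual) (use C in auto)
    moreover have "?tu \<ominus>\<^bsub>g\<^esub> ?te \<in> Q n"
      using Brk.IH(2) Q_mono[of "n - 1" n] by auto
    ultimately have tu: "?tu \<in> Q n"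
      using g.submodule_add[OF Q_submodule F_Q[OF \<open>?te \<in> F n\<close>]] by metis
    have "bracket g ?su ?tu \<ominus>\<^bsub>g\<^esub> bracket g ?se ?te =
        bracket g (?su \<ominus>\<^bsub>g\<^esub> ?se) ?tu \<oplus>\<^bsub>g\<^esub> bracket g ?se (?tu \<ominus>\<^bsub>g\<^esub> ?te)"
      by (rule g.eq_by_dual) (use C in \<open>auto simp: g.minus_eq_smult g.bracket_add_left
          g.bracket_add_right g.bracket_smult_left g.bracket_smult_right\<close>)
    also have "\<dots> \<in> Q (m + n - 1)"
    proof (rule g.submodule_add[OF Q_submodule])
      have "m - 1 + n = m + n - 1" "m + (n - 1) = m + n - 1"
        using False by auto
      then show "bracket g (?su \<ominus>\<^bsub>g\<^esub> ?se) ?tu \<in> Q (m + n - 1)"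
        "bracket g ?se (?tu \<ominus>\<^bsub>g\<^esub> ?te) \<in> Q (m + n - 1)"
        using Q_bracket[OF Brk.IH(1) tu] Q_bracket[OF F_Q[OF \<open>?se \<in> F m\<close>] Brk.IH(2)] by simp_all
    qed
    finally show ?thesis by simp
  qed
qed

section \<open>Passage between the two filtrations modulo the Borel subalgebra\<close>

abbreviation Fu :: "('i \<Rightarrow> complex) \<Rightarrow> nat \<Rightarrow> 'i chevalley lie_term set set" where
  "Fu a k \<equiv> natural_filtration g (range (km_u A a)) k"

lemma range_km_u: "range (km_u A a) \<subseteq> carrier g"
  using km_u_closed by auto

lemmas Fu_submodule = g.submodule_natural_filtration[OF range_km_u]
  and Fu_closed = g.natural_filtration_closed[OF range_km_u]
  and Fu_mono = g.natural_filtration_mono[OF range_km_u]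

lemma Fu_to_F:
  assumes "x \<in> Fu a k" shows "\<exists>y\<in>F k. x \<ominus>\<^bsub>g\<^esub> y \<in> borel"
proof -
  have "Fu a k \<subseteq> Q k"
    unfolding natural_filtration_def[of g "range (km_u A a)"]
  proof (rule g.lie_span_minimal[OF _ Q_submodule], safe)
    fix x n assume nx: "n \<le> k" "(n, x) \<in> iterated_brackets g (range (km_u A a))"
    obtain p where p: "homog n p" "lie_eval g (km_u A a) p = x"
      using g.iterated_brackets_homog[OF nx(2)] by blast
    let ?e = "lie_eval g (km_e A) p"
    have e: "?e \<in> F n"
      by (rule g.homog_eval_filtration[OF km_e_closed p(1)])
    have x: "x \<in> carrier g"
      using g.iterated_brackets_closed[OF nx(2) range_km_u] .
    have "x = ?e \<oplus>\<^bsub>g\<^esub> (x \<ominus>\<^bsub>g\<^esub> ?e)"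
      by (rule g.eq_by_dual) (use x F_closed[OF e] in auto)
    moreover have "?e \<in> Q k" "x \<ominus>\<^bsub>g\<^esub> ?e \<in> Q k"
      using F_Q[OF e] Q_mono[OF nx(1)] eval_u_minus_eval_e[OF p(1), of a]
        Q_mono[OF order.trans[OF diff_le_self nx(1)], of 1] p(2) by auto
    ultimately show "x \<in> Q k"
      using g.submodule_add[OF Q_submodule] by metis
  qed
  then obtain y b where yb: "y \<in> F k" "b \<in> borel" "x = y \<oplus>\<^bsub>g\<^esub> b"
    using assms by (blast elim: g.sum_spaceE)
  have "x \<ominus>\<^bsub>g\<^esub> y = b"
    unfolding yb(3)
    by (rule g.eq_by_dual) (use F_closed[OF yb(1)] borel_closed[OF yb(2)] in auto)
  then show ?thesis
    using yb by blast
qed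

text \<open>The leading term of \<open>y\<close> is lifted by evaluating the same \<open>p\<close>
  at the \<open>u_i\<close>. Modulo \<open>borel\<close> this is wrong only by an element of
  \<open>F k\<close>, which the induction hypothesis repairs.\<close>

lemma F_to_Fu:
  assumes "y \<in> F k" shows "\<exists>x\<in>Fu a k. x \<ominus>\<^bsub>g\<^esub> y \<in> borel"
  using assms
proof (induction k arbitrary: y)
  case 0
  then have "y = \<zero>\<^bsub>g\<^esub>"
    using g.natural_filtration_0[OF range_e] by simp
  then show ?case
    using g.natural_filtration_zero[OF range_km_u] g.submodule_zero_mem[OF borel_submodule]
    by (intro bexI[of _ "\<zero>\<^bsub>g\<^esub>"]) (simp_all add: g.minus_eq_smult)
next
  case (Suc k)
  obtain p z where pz: "homog (Suc k) p" "z \<in> F k" "y = lie_eval g (km_e A) p \<oplus>\<^bsub>g\<^esub> z"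
    using g.natural_filtration_Suc_decomp[OF km_e_closed Suc.prems] by blast
  let ?e = "lie_eval g (km_e A) p" and ?u = "lie_eval g (km_u A a) p"
  have u: "?u \<in> Fu a (Suc k)"
    by (rule g.homog_eval_filtration[OF km_u_closed pz(1)])
  have eC: "?e \<in> carrier g"
    by (rule g.lie_eval_closed') (rule km_e_closed)
  obtain q b where qb: "q \<in> F k" "b \<in> borel" "?u \<ominus>\<^bsub>g\<^esub> ?e = q \<oplus>\<^bsub>g\<^esub> b"
    using eval_u_minus_eval_e[OF pz(1), of a] by (auto elim: g.sum_spaceE)
  \<comment> \<open>\<open>q\<close> is the unwanted lower part created by replacing
    \<open>e_i\<close> by \<open>u_i\<close> in \<open>p\<close>; it is subtracted before lifting,
    so that it cancels in the sum.\<close>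
  have "z \<ominus>\<^bsub>g\<^esub> q \<in> F k"
    by (rule g.submodule_minus[OF F_submodule pz(2) qb(1)])
  from Suc.IH[OF this] obtain x where x: "x \<in> Fu a k" "x \<ominus>\<^bsub>g\<^esub> (z \<ominus>\<^bsub>g\<^esub> q) \<in> borel"
    by blast
  note C = eC F_closed[OF pz(2)] F_closed[OF qb(1)] borel_closed[OF qb(2)] Fu_closed[OF u] Fu_closed[OF x(1)]
  have "(?u \<oplus>\<^bsub>g\<^esub> x) \<ominus>\<^bsub>g\<^esub> y = b \<oplus>\<^bsub>g\<^esub> (x \<ominus>\<^bsub>g\<^esub> (z \<ominus>\<^bsub>g\<^esub> q))"
  proof (rule g.eq_by_dual)
    fix \<psi> assume \<psi>: "\<psi> \<in> dual g"
    have "\<psi> (?u \<ominus>\<^bsub>g\<^esub> ?e) = \<psi> (q \<oplus>\<^bsub>g\<^esub> b)"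
      by (simp only: qb(3))
    then show "\<psi> ((?u \<oplus>\<^bsub>g\<^esub> x) \<ominus>\<^bsub>g\<^esub> y) = \<psi> (b \<oplus>\<^bsub>g\<^esub> (x \<ominus>\<^bsub>g\<^esub> (z \<ominus>\<^bsub>g\<^esub> q)))"
      using \<psi> C by (simp add: pz(3) algebra_simps)
  qed (use C in \<open>simp_all add: pz(3)\<close>)
  then have "(?u \<oplus>\<^bsub>g\<^esub> x) \<ominus>\<^bsub>g\<^esub> y \<in> borel"
    using g.submodule_add[OF borel_submodule qb(2) x(2)] by simp
  moreover have "?u \<oplus>\<^bsub>g\<^esub> x \<in> Fu a (Suc k)"
    using g.submodule_add[OF Fu_submodule u] Fu_mono[where a = a, of k "Suc k"] x(1) by auto
  ultimately show ?case by blast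
qed

text \<open>The lowest weight is 0, so \<open>f_i\<close> and \<open>h_i\<close> kill the lowest
  weight vector. The annihilator of a vector is a subalgebra; on functionals this uses that
  \<open>\<Phi> x\<close> preserves \<open>serre_dual A\<close>.\<close>

lemma borel_annihilated:
  assumes "x \<in> borel" shows "annihilated x"
proof -
  have "lie_subalgebra {x \<in> carrier g. annihilated x} g"
    unfolding lie_subalgebra_def g.submodule_iff
    by (auto simp: annihilated_def \<Phi>_simps \<Phi>_zero \<Phi>_mem)
  moreover have "range (km_f A) \<union> range g.h \<subseteq> {x \<in> carrier g. annihilated x}"
    by (auto simp: annihilated_def \<Phi>_f \<Phi>_h op_restrict_def)
  ultimately have "borel \<subseteq> {x \<in> carrier g. annihilated x}"
    unfolding borel_def by (intro hull_minimal)
  then show ?thesis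
    using assms by blast
qed

lemma km_n_eq: "km_n A = km_deformed A (\<lambda>_. 0)"
  by (simp add: km_n_def km_deformed_def km_u_zero)

lemma carrier_km_deformed_filtration: "carrier (km_deformed A a) = (\<Union>k. Fu a k)"
  by (simp add: km_deformed_def subalgebra_generated_def g.Union_natural_filtration[OF range_km_u])

lemma carrier_km_n_filtration: "carrier (km_n A) = (\<Union>k. F k)"
  by (simp add: km_n_eq carrier_km_deformed_filtration km_u_zero)

lemma km_deformed_submodule: "submodule (carrier (km_deformed A a)) complex_field g"
  using g.lie_subalgebra_hull[OF range_km_u, of a]
  by (simp add: km_deformed_def subalgebra_generated_def lie_subalgebra_def)

lemma km_deformed_inter_borel:
  "x \<in> carrier (km_deformed A a) \<Longrightarrow> x \<in> borel \<Longrightarrow> x = \<zero>\<^bsub>g\<^esub>"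
  by (rule km_deformed_faithful[OF _ borel_annihilated])

lemma km_deformed_eqI:
  assumes "x \<in> carrier (km_deformed A a)" "y \<in> carrier (km_deformed A a)" "x \<ominus>\<^bsub>g\<^esub> y \<in> borel"
  shows "x = y"
proof -
  have "x \<ominus>\<^bsub>g\<^esub> y = \<zero>\<^bsub>g\<^esub>"
    by (rule km_deformed_inter_borel[OF g.submodule_minus[OF km_deformed_submodule assms(1,2)] assms(3)])
  then show ?thesis
    using g.minus_zero_eq assms(1,2) g.submodule_in_carrier[OF km_deformed_submodule] by blast
qed

theorem km_deformed_filtered_iso:
  "\<exists>\<phi>. \<phi> \<in> filtered_iso
      (km_deformed A a) (natural_filtration (km_deformed A a) (range (km_u A a)))
      (km_n A) (natural_filtration (km_n A) (range (km_e A)))"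
proof -
  let ?G = "carrier (km_deformed A a)" and ?n = "carrier (km_n A)"
  have GC: "x \<in> carrier g" if "x \<in> ?G" for x
    by (rule g.submodule_in_carrier[OF km_deformed_submodule that])
  have n_sub: "submodule ?n complex_field g"
    unfolding km_n_eq by (rule km_deformed_submodule)
  have nC: "x \<in> carrier g" if "x \<in> ?n" for x
    by (rule g.submodule_in_carrier[OF n_sub that])
  \<comment> \<open>Existence of \<open>y\<close> comes from \<open>Fu_to_F\<close>, uniqueness from
    the trivial intersection of \<open>n\<close> with \<open>borel\<close>.\<close>
  define \<theta> where "\<theta> x = (THE y. y \<in> ?n \<and> x \<ominus>\<^bsub>g\<^esub> y \<in> borel)" for x
  have \<theta>: "\<theta> x = y" if x: "x \<in> ?G" and y: "y \<in> ?n" "x \<ominus>\<^bsub>g\<^esub> y \<in> borel" for x y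
    unfolding \<theta>_def
  proof (rule the_equality)
    fix z assume z: "z \<in> ?n \<and> x \<ominus>\<^bsub>g\<^esub> z \<in> borel"
    have "z \<ominus>\<^bsub>g\<^esub> y = (x \<ominus>\<^bsub>g\<^esub> y) \<ominus>\<^bsub>g\<^esub> (x \<ominus>\<^bsub>g\<^esub> z)"
      by (rule g.eq_by_dual) (use GC[OF x] nC y z in auto)
    then have "z \<ominus>\<^bsub>g\<^esub> y \<in> borel"
      using g.submodule_minus[OF borel_submodule y(2)] z by simp
    then show "z = y"
      using km_deformed_eqI[of z "\<lambda>_. 0" y] z y(1) by (simp add: km_n_eq)
  qed (use y in simp)
  have ex: "\<exists>y\<in>F k. \<theta> x = y \<and> x \<ominus>\<^bsub>g\<^esub> y \<in> borel" if xF: "x \<in> Fu a k" for x k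
  proof -
    obtain y where y: "y \<in> F k" "x \<ominus>\<^bsub>g\<^esub> y \<in> borel"
      using Fu_to_F[OF xF] by blast
    moreover have "\<theta> x = y"
      by (rule \<theta>) (use xF y in \<open>auto simp: carrier_km_deformed_filtration carrier_km_n_filtration\<close>)
    ultimately show ?thesis by blast
  qed
  have \<theta>G: "\<theta> x \<in> ?n" "x \<ominus>\<^bsub>g\<^esub> \<theta> x \<in> borel" if "x \<in> ?G" for x
    using that ex unfolding carrier_km_deformed_filtration carrier_km_n_filtration by blast+
  have img: "\<theta> ` Fu a k = F k" for k
  proof
    show "\<theta> ` Fu a k \<subseteq> F k"
      using ex by blast
    show "F k \<subseteq> \<theta> ` Fu a k"
    proof
      fix y assume y: "y \<in> F k"
      obtain x where x: "x \<in> Fu a k" "x \<ominus>\<^bsub>g\<^esub> y \<in> borel"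
        using F_to_Fu[OF y] by blast
      have "\<theta> x = y"
        by (rule \<theta>) (use x y in \<open>auto simp: carrier_km_deformed_filtration carrier_km_n_filtration\<close>)
      then show "y \<in> \<theta> ` Fu a k"
        using x(1) by blast
    qed
  qed
  have "\<theta> (x \<oplus>\<^bsub>g\<^esub> y) = \<theta> x \<oplus>\<^bsub>g\<^esub> \<theta> y" if xy: "x \<in> ?G" "y \<in> ?G" for x y
  proof (rule \<theta>)
    show "x \<oplus>\<^bsub>g\<^esub> y \<in> ?G"
      by (rule g.submodule_add[OF km_deformed_submodule xy])
    show "\<theta> x \<oplus>\<^bsub>g\<^esub> \<theta> y \<in> ?n"
      by (rule g.submodule_add[OF n_sub \<theta>G(1)[OF xy(1)] \<theta>G(1)[OF xy(2)]])
    have "(x \<oplus>\<^bsub>g\<^esub> y) \<ominus>\<^bsub>g\<^esub> (\<theta> x \<oplus>\<^bsub>g\<^esub> \<theta> y) =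
        (x \<ominus>\<^bsub>g\<^esub> \<theta> x) \<oplus>\<^bsub>g\<^esub> (y \<ominus>\<^bsub>g\<^esub> \<theta> y)"
      by (rule g.eq_by_dual) (use GC[OF xy(1)] GC[OF xy(2)] nC[OF \<theta>G(1)[OF xy(1)]]
          nC[OF \<theta>G(1)[OF xy(2)]] in auto)
    then show "(x \<oplus>\<^bsub>g\<^esub> y) \<ominus>\<^bsub>g\<^esub> (\<theta> x \<oplus>\<^bsub>g\<^esub> \<theta> y) \<in> borel"
      using g.submodule_add[OF borel_submodule \<theta>G(2)[OF xy(1)] \<theta>G(2)[OF xy(2)]] by simp
  qed
  moreover have "\<theta> (c \<odot>\<^bsub>g\<^esub> x) = c \<odot>\<^bsub>g\<^esub> \<theta> x" if x: "x \<in> ?G" for c x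
  proof (rule \<theta>)
    show "c \<odot>\<^bsub>g\<^esub> x \<in> ?G"
      by (rule g.submodule_smult[OF km_deformed_submodule x])
    show "c \<odot>\<^bsub>g\<^esub> \<theta> x \<in> ?n"
      by (rule g.submodule_smult[OF n_sub \<theta>G(1)[OF x]])
    have "c \<odot>\<^bsub>g\<^esub> x \<ominus>\<^bsub>g\<^esub> c \<odot>\<^bsub>g\<^esub> \<theta> x = c \<odot>\<^bsub>g\<^esub> (x \<ominus>\<^bsub>g\<^esub> \<theta> x)"
      by (rule g.eq_by_dual) (use GC[OF x] nC[OF \<theta>G(1)[OF x]] in \<open>auto simp: algebra_simps\<close>)
    then show "c \<odot>\<^bsub>g\<^esub> x \<ominus>\<^bsub>g\<^esub> c \<odot>\<^bsub>g\<^esub> \<theta> x \<in> borel"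
      using g.submodule_smult[OF borel_submodule \<theta>G(2)[OF x]] by simp
  qed
  ultimately have "\<theta> \<in> linear_hom (km_deformed A a) (km_n A)"
    using \<theta>G(1) by (simp add: linear_hom_def km_deformed_def km_n_def subalgebra_generated_def Pi_iff)
  moreover have "bij_betw \<theta> ?G ?n"
  proof (rule bij_betw_imageI)
    \<comment> \<open>Injectivity rests on the intersection of \<open>borel\<close> with the
      deformed subalgebra, while the intersection with \<open>n\<close> made \<open>\<theta>\<close>
      well defined.\<close>
    show "inj_on \<theta> ?G"
    proof (rule inj_onI)
      fix x y assume xy: "x \<in> ?G" "y \<in> ?G" "\<theta> x = \<theta> y"
      have "x \<ominus>\<^bsub>g\<^esub> y = (x \<ominus>\<^bsub>g\<^esub> \<theta> x) \<ominus>\<^bsub>g\<^esub> (y \<ominus>\<^bsub>g\<^esub> \<theta> y)"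
        by (rule g.eq_by_dual) (use GC[OF xy(1)] GC[OF xy(2)] nC[OF \<theta>G(1)[OF xy(1)]] xy(3) in auto)
      then have "x \<ominus>\<^bsub>g\<^esub> y \<in> borel"
        using g.submodule_minus[OF borel_submodule \<theta>G(2)[OF xy(1)] \<theta>G(2)[OF xy(2)]] by simp
      then show "x = y"
        by (rule km_deformed_eqI[OF xy(1,2)])
    qed
    show "\<theta> ` ?G = ?n"
      unfolding carrier_km_deformed_filtration carrier_km_n_filtration image_UN img ..
  qed
  moreover have "natural_filtration (km_deformed A a) (range (km_u A a)) k = Fu a k"
    "natural_filtration (km_n A) (range (km_e A)) k = F k" for k
    unfolding km_deformed_def km_n_def
    by (rule g.natural_filtration_subalgebra_generated[OF range_km_u]
        g.natural_filtration_subalgebra_generated[OF range_e])+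
  ultimately have "\<theta> \<in> filtered_iso
      (km_deformed A a) (natural_filtration (km_deformed A a) (range (km_u A a)))
      (km_n A) (natural_filtration (km_n A) (range (km_e A)))"
    by (simp add: filtered_iso_def img)
  then show ?thesis
    by (rule exI[of _ \<theta>])
qed

end

theorem theorem1p3:
  fixes A :: "'i \<Rightarrow> 'i \<Rightarrow> int" and a :: "'i \<Rightarrow> complex"
  assumes "generalized_cartan_matrix A"
  shows "presented_by (km_deformed A a) (km_u A a) (deformed_serre_relations A a)
    \<and> (\<exists>\<phi>. \<phi> \<in> filtered_iso
          (km_deformed A a) (natural_filtration (km_deformed A a) (range (km_u A a)))
          (km_n A) (natural_filtration (km_n A) (range (km_e A))))"
proof -
  interpret cartan_matrix A
    by unfold_locales (rule assms)
  obtain \<Phi> where "\<Phi> \<in> lie_hom (kac_moody A) (op_lie (serre_dual A))"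
    "\<And>i. \<Phi> (km_e A i) = op_restrict (serre_dual A) (raise i)"
    "\<And>i. \<Phi> (km_f A i) = op_restrict (serre_dual A) (lower A i)"
    using kac_moody_representation by blast
  then interpret kac_moody_module A \<Phi>
    by unfold_locales
  show ?thesis
    using km_deformed_presented km_deformed_filtered_iso by blast
qed

end
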